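(* Let $V$ be an $n$-dimensional left vector space over a division ring $K$, $2\le n<\infty$, and let $k\in\{1,\dots,n-1\}$. Every adjacency preserving transformation of $\mathcal G_k\times\mathcal G_{n-k}$ is of one of the following forms: (1) $f'\times f''$, where $f':\mathcal G_k\to\mathcal G_k$ and $f'':\mathcal G_{n-k}\to\mathcal G_{n-k}$ are bijections which preserve adjacency in both directions; (2) $g'\mathbin{\dot\times}g''$, where $g':\mathcal G_k\to\mathcal G_{n-k}$ and $g'':\mathcal G_{n-k}\to\mathcal G_k$ are bijections which preserve adjacency in both directions. (If $k=1$ or $k=n-1$, the adjacency condition on $f',f'',g',g''$ holds for arbitrary bijections.) If $1<k<n-1$, these mappings are explicitly as follows. In case (1): $f'=G_k(l')$ or (only when $n=2k$) $f'=D_k(s')$; and $f''=G_{n-k}(l'')$ or (only when $n=2k$) $f''=D_k(s'')$. In case (2): $g'=D_k(s')$ or (only when $n=2k$) $g'=G_k(l')$; and $g''=D_{n-k}(s'')$ or (only when $n=2k$) $g''=G_k(l'')$. Here $l',l'':V\to V$ and $s',s'':V\to V^*$ denote semilinear isomorphisms.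
   Context: $\mathcal G_i$ denotes the set of all $i$-dimensional subspaces of $V$. Subspaces $P,T$ of $V$ are adjacent, $P\sim T$, if $\dim P=\dim T=\dim(P\cap T)+1$. Elements $(S,U),(S',U')\in\mathcal G_k\times\mathcal G_{n-k}$ are adjacent if ($S=S'$ and $U\sim U'$) or ($S\sim S'$ and $U=U'$). An adjacency preserving transformation of $\mathcal G_k\times\mathcal G_{n-k}$ is a bijection $f$ of this set onto itself such that both $f$ and $f^{-1}$ map adjacent elements to adjacent elements. A bijection between sets $\mathcal G_i$ and $\mathcal G_j$ preserves adjacency in both directions if it and its inverse map adjacent subspaces to adjacent subspaces. The map $f'\times f''$ is $(S,U)\mapsto(f'(S),f''(U))$, and the map $g'\mathbin{\dot\times}g''$ is $(S,U)\mapsto(g''(U),g'(S))$, both from $\mathcal G_k\times\mathcal G_{n-k}$ to itself. A semilinear isomorphism $l:V\to V$ is an additive bijection with $l(av)=\sigma(a)l(v)$ for some automorphism $\sigma$ of $K$. $V^*$ is the dual space of $V$ (a right vector space over $K$); a semilinear isomorphism $s:V\to V^*$ is an additive bijection with $s(av)=s(v)\tau(a)$ for some anti-automorphism $\tau$ of $K$. For $1\le i\le n-1$, $G_i(l):\mathcal G_i\to\mathcal G_i$ is $S\mapsto l(S)$, and $D_i(s):\mathcal G_i\to\mathcal G_{n-i}$ is $S\mapsto (s(S))^\circ$, where $(s(S))^\circ\subset V$ is the annihilator of $s(S)$, i.e. the set of vectors on which all functionals in $s(S)$ vanish. *)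

theory Defs
  imports Main
begin

text \<open>The distribution's \<open>module\<close> and \<open>vector_space\<close> locales require commutative scalars, so
  the basic notions of linear algebra are restated here for left vector spaces over a division
  ring, following the definitions of \<open>HOL.Modules\<close> and \<open>HOL.Vector_Spaces\<close>. The vector space
  \<open>V\<close> is the whole type \<open>'v\<close>.\<close>

locale left_vector_space =
  fixes scale :: "'k::division_ring \<Rightarrow> 'v::ab_group_add \<Rightarrow> 'v"
  assumes scale_right_distrib: "scale a (x + y) = scale a x + scale a y"
    and scale_left_distrib: "scale (a + b) x = scale a x + scale b x"
    and scale_scale: "scale a (scale b x) = scale (a * b) x"
    and scale_one: "scale 1 x = x"

definition left_subspace ::
    "('k::division_ring \<Rightarrow> 'v::ab_group_add \<Rightarrow> 'v) \<Rightarrow> 'v set \<Rightarrow> bool" where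
  "left_subspace scale S \<longleftrightarrow>
     0 \<in> S \<and> (\<forall>x\<in>S. \<forall>y\<in>S. x + y \<in> S) \<and> (\<forall>c. \<forall>x\<in>S. scale c x \<in> S)"

definition left_span ::
    "('k::division_ring \<Rightarrow> 'v::ab_group_add \<Rightarrow> 'v) \<Rightarrow> 'v set \<Rightarrow> 'v set" where
  "left_span scale B = {(\<Sum>a\<in>t. scale (r a) a) | t r. finite t \<and> t \<subseteq> B}"

definition left_independent ::
    "('k::division_ring \<Rightarrow> 'v::ab_group_add \<Rightarrow> 'v) \<Rightarrow> 'v set \<Rightarrow> bool" where
  "left_independent scale B \<longleftrightarrow>
     (\<forall>t u. finite t \<and> t \<subseteq> B \<and> (\<Sum>v\<in>t. scale (u v) v) = 0 \<longrightarrow> (\<forall>v\<in>t. u v = 0))"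

text \<open>As in the library, an infinite-dimensional space gets dimension \<open>0\<close>; hence
  \<open>left_dim scale UNIV = n\<close> with \<open>n > 0\<close> includes finite-dimensionality.\<close>

definition left_dim ::
    "('k::division_ring \<Rightarrow> 'v::ab_group_add \<Rightarrow> 'v) \<Rightarrow> 'v set \<Rightarrow> nat" where
  "left_dim scale S =
     (if \<exists>B. left_independent scale B \<and> left_span scale B = left_span scale S
      then card (SOME B. left_independent scale B \<and> left_span scale B = left_span scale S)
      else 0)"

definition grassmannian ::
    "('k::division_ring \<Rightarrow> 'v::ab_group_add \<Rightarrow> 'v) \<Rightarrow> nat \<Rightarrow> 'v set set" where
  "grassmannian scale i = {S. left_subspace scale S \<and> left_dim scale S = i}"

definition adjacent_subspaces ::
    "('k::division_ring \<Rightarrow> 'v::ab_group_add \<Rightarrow> 'v) \<Rightarrow> 'v set \<Rightarrow> 'v set \<Rightarrow> bool" where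
  "adjacent_subspaces scale P T \<longleftrightarrow>
     left_subspace scale P \<and> left_subspace scale T \<and>
     left_dim scale P = left_dim scale T \<and>
     left_dim scale T = left_dim scale (P \<inter> T) + 1"

definition adjacent_pairs ::
    "('k::division_ring \<Rightarrow> 'v::ab_group_add \<Rightarrow> 'v) \<Rightarrow>
      'v set \<times> 'v set \<Rightarrow> 'v set \<times> 'v set \<Rightarrow> bool" where
  "adjacent_pairs scale p q \<longleftrightarrow>
     (fst p = fst q \<and> adjacent_subspaces scale (snd p) (snd q)) \<or>
     (adjacent_subspaces scale (fst p) (fst q) \<and> snd p = snd q)"

definition preserves_both_directions ::
    "('a \<Rightarrow> 'a \<Rightarrow> bool) \<Rightarrow> 'a set \<Rightarrow> ('b \<Rightarrow> 'b \<Rightarrow> bool) \<Rightarrow> 'b set \<Rightarrow> ('a \<Rightarrow> 'b) \<Rightarrow> bool" where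
  "preserves_both_directions R A Q B f \<longleftrightarrow>
     (\<forall>x\<in>A. \<forall>y\<in>A. R x y \<longrightarrow> Q (f x) (f y)) \<and>
     (\<forall>x\<in>B. \<forall>y\<in>B. Q x y \<longrightarrow> R (inv_into A f x) (inv_into A f y))"

definition adjacency_bijection ::
    "('k::division_ring \<Rightarrow> 'v::ab_group_add \<Rightarrow> 'v) \<Rightarrow> nat \<Rightarrow> nat \<Rightarrow> ('v set \<Rightarrow> 'v set) \<Rightarrow> bool" where
  "adjacency_bijection scale i j h \<longleftrightarrow>
     bij_betw h (grassmannian scale i) (grassmannian scale j) \<and>
     preserves_both_directions
       (adjacent_subspaces scale) (grassmannian scale i)
       (adjacent_subspaces scale) (grassmannian scale j) h"

definition adjacency_preserving_transformation ::
    "('k::division_ring \<Rightarrow> 'v::ab_group_add \<Rightarrow> 'v) \<Rightarrow> nat \<Rightarrow> nat \<Rightarrow>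
      ('v set \<times> 'v set \<Rightarrow> 'v set \<times> 'v set) \<Rightarrow> bool" where
  "adjacency_preserving_transformation scale i j f \<longleftrightarrow>
     (let X = grassmannian scale i \<times> grassmannian scale j in
       bij_betw f X X \<and>
       preserves_both_directions (adjacent_pairs scale) X (adjacent_pairs scale) X f)"

definition dot_times :: "('a \<Rightarrow> 'b) \<Rightarrow> ('b \<Rightarrow> 'a) \<Rightarrow> 'a \<times> 'b \<Rightarrow> 'a \<times> 'b" where
  "dot_times g' g'' = (\<lambda>(S, U). (g'' U, g' S))"

definition ring_automorphism :: "('k::division_ring \<Rightarrow> 'k) \<Rightarrow> bool" where
  "ring_automorphism \<sigma> \<longleftrightarrow>
     bij \<sigma> \<and> (\<forall>a b. \<sigma> (a + b) = \<sigma> a + \<sigma> b) \<and> (\<forall>a b. \<sigma> (a * b) = \<sigma> a * \<sigma> b) \<and> \<sigma> 1 = 1"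

definition ring_anti_automorphism :: "('k::division_ring \<Rightarrow> 'k) \<Rightarrow> bool" where
  "ring_anti_automorphism \<tau> \<longleftrightarrow>
     bij \<tau> \<and> (\<forall>a b. \<tau> (a + b) = \<tau> a + \<tau> b) \<and> (\<forall>a b. \<tau> (a * b) = \<tau> b * \<tau> a) \<and> \<tau> 1 = 1"

definition semilinear_isomorphism ::
    "('k::division_ring \<Rightarrow> 'v::ab_group_add \<Rightarrow> 'v) \<Rightarrow> ('v \<Rightarrow> 'v) \<Rightarrow> bool" where
  "semilinear_isomorphism scale l \<longleftrightarrow>
     bij l \<and> (\<forall>x y. l (x + y) = l x + l y) \<and>
     (\<exists>\<sigma>. ring_automorphism \<sigma> \<and> (\<forall>a v. l (scale a v) = scale (\<sigma> a) (l v)))"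

definition dual_space ::
    "('k::division_ring \<Rightarrow> 'v::ab_group_add \<Rightarrow> 'v) \<Rightarrow> ('v \<Rightarrow> 'k) set" where
  "dual_space scale =
     {\<phi>. (\<forall>x y. \<phi> (x + y) = \<phi> x + \<phi> y) \<and> (\<forall>a x. \<phi> (scale a x) = a * \<phi> x)}"

text \<open>The right vector space operations on the dual are pointwise.\<close>

definition dual_add :: "('v \<Rightarrow> 'k::division_ring) \<Rightarrow> ('v \<Rightarrow> 'k) \<Rightarrow> 'v \<Rightarrow> 'k" where
  "dual_add \<phi> \<psi> = (\<lambda>w. \<phi> w + \<psi> w)"

definition dual_scale :: "('v \<Rightarrow> 'k::division_ring) \<Rightarrow> 'k \<Rightarrow> 'v \<Rightarrow> 'k" where
  "dual_scale \<phi> a = (\<lambda>w. \<phi> w * a)"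

definition semilinear_isomorphism_dual ::
    "('k::division_ring \<Rightarrow> 'v::ab_group_add \<Rightarrow> 'v) \<Rightarrow> ('v \<Rightarrow> 'v \<Rightarrow> 'k) \<Rightarrow> bool" where
  "semilinear_isomorphism_dual scale s \<longleftrightarrow>
     bij_betw s UNIV (dual_space scale) \<and> (\<forall>x y. s (x + y) = dual_add (s x) (s y)) \<and>
     (\<exists>\<tau>. ring_anti_automorphism \<tau> \<and> (\<forall>a v. s (scale a v) = dual_scale (s v) (\<tau> a)))"

definition dual_annihilator :: "('v \<Rightarrow> 'k::division_ring) set \<Rightarrow> 'v set" where
  "dual_annihilator F = {v. \<forall>\<phi>\<in>F. \<phi> v = 0}"

text \<open>\<open>h = G\<^sub>i(l)\<close>, respectively \<open>h = D\<^sub>i(s)\<close>, on the \<open>i\<close>-dimensional subspaces.\<close>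

definition is_G_map ::
    "('k::division_ring \<Rightarrow> 'v::ab_group_add \<Rightarrow> 'v) \<Rightarrow> nat \<Rightarrow> ('v set \<Rightarrow> 'v set) \<Rightarrow> bool" where
  "is_G_map scale i h \<longleftrightarrow>
     (\<exists>l. semilinear_isomorphism scale l \<and> (\<forall>S\<in>grassmannian scale i. h S = l ` S))"

definition is_D_map ::
    "('k::division_ring \<Rightarrow> 'v::ab_group_add \<Rightarrow> 'v) \<Rightarrow> nat \<Rightarrow> ('v set \<Rightarrow> 'v set) \<Rightarrow> bool" where
  "is_D_map scale i h \<longleftrightarrow>
     (\<exists>s. semilinear_isomorphism_dual scale s \<and>
       (\<forall>S\<in>grassmannian scale i. h S = dual_annihilator (s ` S)))"

end

theory Submission
  imports Defs
begin

text \<open>The graph of pairs \<open>(S, U)\<close> is the Cartesian product of two Grassmann graphs, and its edges come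
  in two directions, according to the coordinate that changes. Two incident edges in different
  directions span a unique square, so that their end points are not adjacent and have exactly two common
  neighbours. Two incident edges in the same direction never look like this: subspaces at
  distance two have at least four common neighbours (lemma \<open>three_common_neighbours\<close> provides three).
  A transformation therefore respects "same direction" at every vertex, so at each
  vertex it either keeps or exchanges the two directions. Neighbouring vertices behave alike, and the
  product is connected, which leaves the two global cases \<open>f' \<times> f''\<close> and \<open>g' \<times>\<close> \<open>g''\<close> with
  interchanged factors (lemma \<open>product_isomorphism_cases\<close>). For \<open>k = 1\<close> and \<open>k = n - 1\<close> the Grassmann
  graphs are complete and every bijection preserves adjacency.

  For \<open>1 < k < n - 1\<close> the explicit form of the factors is Chow's theorem (\<open>chow\<close>). The cliques of a
  Grassmann graph lie in stars (all members contain a fixed hyperplane of each member) or in tops (all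
  members lie in a fixed subspace of one dimension more). An isomorphism maps every star to a star or
  to a top, and by connectedness the same alternative holds for all stars (\<open>star_type_constant\<close>).

  If stars go to stars, the map on centres is a bijection one dimension lower, and the two
  bijections preserve inclusion. Such inclusion preserving pairs descend further
  (\<open>inc_pair_descent\<close>) until one side consists of points. Points are pairwise adjacent, so the
  other side consists of points as well; this forces equal dimensions, and the
  fundamental theorem of projective geometry turns the collineation into a semilinear map, which
  then induces all the bijections passed on the way down. If stars go to tops, the map is first
  composed with the annihilator map into a dual space. That space is modelled on \<open>V\<close> itself, with
  scalars of the opposite ring acting on coordinates from the right, so that the first case applies with
  a different target space; this is why the theory is developed for maps between two spaces over
  two division rings.\<close>

section \<open>Linear algebra over a division ring\<close>

context left_vector_space
begin

abbreviation sub :: "'v set \<Rightarrow> bool" where "sub \<equiv> left_subspace scale"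
abbreviation span :: "'v set \<Rightarrow> 'v set" where "span \<equiv> left_span scale"
abbreviation indep :: "'v set \<Rightarrow> bool" where "indep \<equiv> left_independent scale"
abbreviation dim :: "'v set \<Rightarrow> nat" where "dim \<equiv> left_dim scale"
abbreviation G :: "nat \<Rightarrow> 'v set set" where "G \<equiv> grassmannian scale"
abbreviation adj :: "'v set \<Rightarrow> 'v set \<Rightarrow> bool" where "adj \<equiv> adjacent_subspaces scale"

lemma scale_zero_left [simp]: "scale 0 x = 0"
  using scale_left_distrib[of 0 0 x] by simp

lemma scale_zero_right [simp]: "scale a 0 = 0"
  using scale_right_distrib[of a 0 0] by simp

lemma scale_minus_left: "scale (- a) x = - scale a x"
  using scale_left_distrib[of a "- a" x] by (simp add: eq_neg_iff_add_eq_0 add.commute)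

lemma scale_minus_right: "scale a (- x) = - scale a x"
  using scale_right_distrib[of a x "- x"] by (simp add: eq_neg_iff_add_eq_0 add.commute)

lemma scale_left_diff: "scale (a - b) x = scale a x - scale b x"
  using scale_left_distrib[of a "- b" x] by (simp add: scale_minus_left)

lemma scale_right_diff: "scale a (x - y) = scale a x - scale a y"
  using scale_right_distrib[of a x "- y"] by (simp add: scale_minus_right)

lemma scale_one' [simp]: "scale 1 x = x" by (rule scale_one)

lemma scale_scale' [simp]: "scale a (scale b x) = scale (a * b) x" by (rule scale_scale)

lemma scale_inverse: "c \<noteq> 0 \<Longrightarrow> scale (inverse c) (scale c x) = x"
  by simp

lemma scale_eq_0_iff [simp]: "scale a x = 0 \<longleftrightarrow> a = 0 \<or> x = 0"
proof
  assume a: "scale a x = 0"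
  show "a = 0 \<or> x = 0"
  proof (rule ccontr)
    assume n: "\<not> (a = 0 \<or> x = 0)"
    have "scale (inverse a) (scale a x) = x" using n by (intro scale_inverse) auto
    with a n show False by simp
  qed
qed auto

lemma scale_eq_imp_eq: "x \<noteq> 0 \<Longrightarrow> scale a x = scale b x \<Longrightarrow> a = b"
  using scale_left_diff[of a b x] by simp

lemma scale_sum_right: "scale a (sum g t) = (\<Sum>i\<in>t. scale a (g i))"
  by (induction t rule: infinite_finite_induct) (auto simp: scale_right_distrib)

lemma sub_0: "sub S \<Longrightarrow> 0 \<in> S" by (simp add: left_subspace_def)
lemma sub_add: "sub S \<Longrightarrow> x \<in> S \<Longrightarrow> y \<in> S \<Longrightarrow> x + y \<in> S" by (simp add: left_subspace_def)
lemma sub_scale: "sub S \<Longrightarrow> x \<in> S \<Longrightarrow> scale c x \<in> S" by (simp add: left_subspace_def)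
lemma sub_minus: "sub S \<Longrightarrow> x \<in> S \<Longrightarrow> - x \<in> S"
  using sub_scale[of S x "- 1"] by (simp add: scale_minus_left)
lemma sub_diff: "sub S \<Longrightarrow> x \<in> S \<Longrightarrow> y \<in> S \<Longrightarrow> x - y \<in> S"
  using sub_add[of S x "- y"] sub_minus by simp
lemma sub_scale_iff: "sub S \<Longrightarrow> c \<noteq> 0 \<Longrightarrow> scale c x \<in> S \<longleftrightarrow> x \<in> S"
  using sub_scale[of S "scale c x" "inverse c"] sub_scale[of S x c] by auto
lemma sub_add_iff: "sub S \<Longrightarrow> x \<in> S \<Longrightarrow> x + y \<in> S \<longleftrightarrow> y \<in> S"
  using sub_diff[of S "x + y" x] sub_add by auto
lemma sub_Int: "sub S \<Longrightarrow> sub T \<Longrightarrow> sub (S \<inter> T)" by (simp add: left_subspace_def)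
lemma sub_UNIV: "sub UNIV" by (simp add: left_subspace_def)
lemma sub_zero: "sub {0}" by (simp add: left_subspace_def)
lemma sub_sum: "sub S \<Longrightarrow> (\<And>i. i \<in> t \<Longrightarrow> g i \<in> S) \<Longrightarrow> sum g t \<in> S"
  by (induction t rule: infinite_finite_induct) (auto simp: sub_0 sub_add)

lemma span_memI: "finite t \<Longrightarrow> t \<subseteq> B \<Longrightarrow> (\<Sum>a\<in>t. scale (r a) a) \<in> span B"
  unfolding left_span_def by blast

lemma sub_span: "sub (span B)"
  unfolding left_subspace_def
proof (intro conjI ballI allI)
  show "0 \<in> span B" unfolding left_span_def
    by (rule CollectI, rule exI[of _ "{}"]) auto
next
  fix x y assume "x \<in> span B" "y \<in> span B"
  then obtain t1 r1 t2 r2 where x: "x = (\<Sum>a\<in>t1. scale (r1 a) a)" "finite t1" "t1 \<subseteq> B"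
    and y: "y = (\<Sum>a\<in>t2. scale (r2 a) a)" "finite t2" "t2 \<subseteq> B"
    unfolding left_span_def by auto
  define r where "r a = (if a \<in> t1 then r1 a else 0) + (if a \<in> t2 then r2 a else 0)" for a
  have "(\<Sum>a\<in>t1. scale (r1 a) a) = (\<Sum>a\<in>t1 \<union> t2. scale (if a \<in> t1 then r1 a else 0) a)"
    using x y by (intro sum.mono_neutral_cong_left) auto
  moreover have "(\<Sum>a\<in>t2. scale (r2 a) a) = (\<Sum>a\<in>t1 \<union> t2. scale (if a \<in> t2 then r2 a else 0) a)"
    using x y by (intro sum.mono_neutral_cong_left) auto
  ultimately have "x + y = (\<Sum>a\<in>t1 \<union> t2. scale (r a) a)"
    unfolding x y r_def scale_left_distrib sum.distrib by simp
  then show "x + y \<in> span B" using x y span_memI by simp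
next
  fix c x assume "x \<in> span B"
  then obtain t r where x: "x = (\<Sum>a\<in>t. scale (r a) a)" "finite t" "t \<subseteq> B"
    unfolding left_span_def by auto
  have "scale c x = (\<Sum>a\<in>t. scale (c * r a) a)"
    unfolding x by (simp add: scale_sum_right)
  then show "scale c x \<in> span B" using x span_memI by simp
qed

lemma span_superset: "B \<subseteq> span B"
proof
  fix b assume "b \<in> B"
  then show "b \<in> span B" using span_memI[of "{b}" B "\<lambda>_. 1"] by simp
qed

lemma span_least: "B \<subseteq> S \<Longrightarrow> sub S \<Longrightarrow> span B \<subseteq> S"
  unfolding left_span_def by (auto intro!: sub_sum sub_scale)

lemma span_mono: "A \<subseteq> B \<Longrightarrow> span A \<subseteq> span B"
  by (meson order_trans span_least span_superset sub_span)

lemma span_sub: "sub S \<Longrightarrow> span S = S"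
  using span_least[of S S] span_superset by blast

definition adjoin :: "'v set \<Rightarrow> 'v \<Rightarrow> 'v set" where
  "adjoin S x = {s + scale c x | s c. s \<in> S}"

lemma adjoinI: "s \<in> S \<Longrightarrow> s + scale c x \<in> adjoin S x" by (auto simp: adjoin_def)
lemma adjoinE: assumes "v \<in> adjoin S x" obtains s c where "s \<in> S" "v = s + scale c x"
  using assms by (auto simp: adjoin_def)

lemma sub_adjoin: assumes "sub S" shows "sub (adjoin S x)"
  unfolding left_subspace_def
proof (intro conjI ballI allI)
  show "0 \<in> adjoin S x" using adjoinI[of 0 S 0 x] assms by (simp add: sub_0)
next
  fix u v assume "u \<in> adjoin S x" "v \<in> adjoin S x"
  then obtain s c s' c' where "s \<in> S" "s' \<in> S" and uv: "u = s + scale c x" "v = s' + scale c' x"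
    by (metis adjoinE)
  then have "(s + s') + scale (c + c') x \<in> adjoin S x" by (intro adjoinI sub_add assms)
  then show "u + v \<in> adjoin S x" unfolding uv by (simp add: scale_left_distrib algebra_simps)
next
  fix a u assume "u \<in> adjoin S x"
  then obtain s c where s: "s \<in> S" and u: "u = s + scale c x" by (metis adjoinE)
  then have "scale a s + scale (a * c) x \<in> adjoin S x" by (intro adjoinI sub_scale assms)
  then show "scale a u \<in> adjoin S x" unfolding u by (simp add: scale_right_distrib)
qed

lemma adjoin_superset: "S \<subseteq> adjoin S x"
proof
  fix s assume "s \<in> S" then show "s \<in> adjoin S x" using adjoinI[of s S 0 x] by simp
qed

lemma adjoin_mem: "sub S \<Longrightarrow> x \<in> adjoin S x"
  using adjoinI[of 0 S 1 x] by (simp add: sub_0)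

lemma adjoin_least: "S \<subseteq> T \<Longrightarrow> x \<in> T \<Longrightarrow> sub T \<Longrightarrow> adjoin S x \<subseteq> T"
  by (auto simp: adjoin_def intro!: sub_add sub_scale)

lemma adjoin_absorb: "sub S \<Longrightarrow> x \<in> S \<Longrightarrow> adjoin S x = S"
  using adjoin_least[of S S x] adjoin_superset by blast

lemma span_insert: "span (insert x B) = adjoin (span B) x"
proof
  show "span (insert x B) \<subseteq> adjoin (span B) x"
    using span_superset[of B] adjoin_superset[of "span B" x]
    by (intro span_least sub_adjoin sub_span) (auto intro: adjoin_mem sub_span)
  show "adjoin (span B) x \<subseteq> span (insert x B)"
    using span_superset[of "insert x B"] by (intro adjoin_least sub_span span_mono) auto
qed

lemma adjoin_exchange:
  assumes "sub S" "y \<in> adjoin S x" "y \<notin> S"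
  shows "adjoin S y = adjoin S x"
proof -
  obtain s c where s: "s \<in> S" and y: "y = s + scale c x" using assms(2) by (metis adjoinE)
  have c: "c \<noteq> 0" using s y assms(3) by auto
  have "x = scale (inverse c) (- s) + scale (inverse c) y"
    using c by (simp add: y scale_right_distrib scale_minus_right)
  moreover have "scale (inverse c) (- s) + scale (inverse c) y \<in> adjoin S y"
    using assms(1) s by (intro adjoinI sub_scale sub_minus)
  ultimately have "x \<in> adjoin S y" by simp
  then show ?thesis using assms
    by (intro equalityI adjoin_least sub_adjoin adjoin_superset) auto
qed

text \<open>Exchange arguments use independence in the form that no vector depends on the others.\<close>

lemma indep_iff_span: "indep B \<longleftrightarrow> (\<forall>b\<in>B. b \<notin> span (B - {b}))"
proof
  assume ind: "indep B"
  show "\<forall>b\<in>B. b \<notin> span (B - {b})"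
  proof (intro ballI notI)
    fix b assume b: "b \<in> B" "b \<in> span (B - {b})"
    then obtain t r where t: "finite t" "t \<subseteq> B - {b}" "b = (\<Sum>a\<in>t. scale (r a) a)"
      unfolding left_span_def by auto
    define u where "u a = (if a = b then - 1 else r a)" for a
    have "(\<Sum>a\<in>t. scale (u a) a) = (\<Sum>a\<in>t. scale (r a) a)"
      using t(2) by (intro sum.cong) (auto simp: u_def)
    moreover have "(\<Sum>a\<in>insert b t. scale (u a) a) = scale (u b) b + (\<Sum>a\<in>t. scale (u a) a)"
      using t by (intro sum.insert) auto
    ultimately have "(\<Sum>a\<in>insert b t. scale (u a) a) = 0"
      using t(3) by (simp add: u_def scale_minus_left)
    moreover have "finite (insert b t)" "insert b t \<subseteq> B" using t b by auto
    ultimately have "u b = 0" using ind unfolding left_independent_def by blast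
    then show False by (simp add: u_def)
  qed
next
  assume notin: "\<forall>b\<in>B. b \<notin> span (B - {b})"
  show "indep B" unfolding left_independent_def
  proof (intro allI impI ballI, rule ccontr, elim conjE)
    fix t u v assume t: "finite t" "t \<subseteq> B" "(\<Sum>v\<in>t. scale (u v) v) = 0" "v \<in> t" "u v \<noteq> 0"
    have "(\<Sum>v\<in>t. scale (u v) v) = scale (u v) v + (\<Sum>v\<in>t - {v}. scale (u v) v)"
      using t by (intro sum.remove) auto
    then have "scale (u v) v = - (\<Sum>v\<in>t - {v}. scale (u v) v)"
      using t(3) by (simp add: eq_neg_iff_add_eq_0)
    also have "\<dots> \<in> span (B - {v})"
    proof (intro sub_minus sub_span sub_sum sub_scale)
      fix w assume "w \<in> t - {v}" then show "w \<in> span (B - {v})"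
        using t(2) span_superset[of "B - {v}"] by blast
    qed
    finally have "v \<in> span (B - {v})" using t(5) sub_scale_iff sub_span by blast
    then show False using notin t by blast
  qed
qed

lemma indep_insert:
  assumes "indep B" "x \<notin> span B" shows "indep (insert x B)"
  unfolding indep_iff_span
proof
  fix b assume b: "b \<in> insert x B"
  show "b \<notin> span (insert x B - {b})"
  proof (cases "b = x")
    case True
    then have "insert x B - {b} \<subseteq> B" by auto
    then show ?thesis using True assms(2) span_mono by blast
  next
    case False
    then have eq: "insert x B - {b} = insert x (B - {b})" by auto
    have nb: "b \<notin> span (B - {b})" using False b assms(1) indep_iff_span by auto
    show ?thesis
    proof
      assume "b \<in> span (insert x B - {b})"
      then have bx: "b \<in> adjoin (span (B - {b})) x" unfolding eq span_insert .
      have "x \<in> adjoin (span (B - {b})) b"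
        using adjoin_exchange[OF sub_span bx nb] adjoin_mem[OF sub_span] by blast
      also have "\<dots> = span (insert b (B - {b}))" by (simp only: span_insert)
      also have "insert b (B - {b}) = B" using False b by auto
      finally show False using assms(2) by simp
    qed
  qed
qed

text \<open>Steinitz exchange: a vector of \<open>A\<close> outside \<open>B\<close> can take the place of at least one vector of \<open>B\<close>
  outside \<open>A\<close>, without making the span smaller. The induction is on the number of vectors of \<open>B\<close>
  outside \<open>A\<close>.\<close>

lemma steinitz:
  assumes "finite B" "indep A" "A \<subseteq> span B"
  shows "finite A \<and> card A \<le> card B"
  using assms
proof (induction "card (B - A)" arbitrary: B rule: less_induct)
  case less
  show ?case
  proof (cases "A \<subseteq> B")
    case True
    then show ?thesis using less.prems card_mono finite_subset by blast
  next
    case False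
    then obtain a where a: "a \<in> A" "a \<notin> B" by auto
    have "\<not> B \<subseteq> span (A - {a})"
    proof
      assume "B \<subseteq> span (A - {a})"
      then have "span B \<subseteq> span (A - {a})" by (intro span_least sub_span)
      then show False using a less.prems(2,3) indep_iff_span by blast
    qed
    \<comment> \<open>choose a maximal part of \<open>B\<close>, containing \<open>B \<inter> A\<close>, whose span misses \<open>a\<close>\<close>
    define M where "M = {D. B \<inter> A \<subseteq> D \<and> D \<subseteq> B \<and> a \<notin> span D}"
    have "B \<inter> A \<in> M"
    proof -
      have "B \<inter> A \<subseteq> A - {a}" using a by auto
      then have "a \<notin> span (B \<inter> A)" using a less.prems(2) indep_iff_span span_mono by blast
      then show ?thesis by (auto simp: M_def)
    qed
    moreover have "finite M" using less.prems(1) unfolding M_def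
      by (rule_tac finite_subset[of _ "Pow B"]) auto
    ultimately have "\<exists>D\<in>M. B \<inter> A \<subseteq> D \<and> (\<forall>D'\<in>M. D \<subseteq> D' \<longrightarrow> D = D')"
      by (intro finite_has_maximal2)
    then obtain D where D: "D \<in> M" "\<And>D'. D' \<in> M \<Longrightarrow> D \<subseteq> D' \<Longrightarrow> D = D'" by auto
    have DB: "D \<subseteq> B" "a \<notin> span D" "B \<inter> A \<subseteq> D" using D by (auto simp: M_def)
    have key: "b \<in> span (insert a D)" if "b \<in> B" for b
    proof (cases "b \<in> D")
      case True then show ?thesis using span_superset by blast
    next
      case False
      then have "insert b D \<notin> M" using D(2)[of "insert b D"] by auto
      then have "a \<in> span (insert b D)" using that DB by (auto simp: M_def)
      then have "adjoin (span D) a = adjoin (span D) b"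
        using DB unfolding span_insert by (intro adjoin_exchange sub_span) auto
      then show ?thesis unfolding span_insert using adjoin_mem[OF sub_span] by blast
    qed
    have spB: "span B \<subseteq> span (insert a D)" using key by (intro span_least sub_span) auto
    have ne: "D \<noteq> B" using less.prems(3) a DB(2) by auto
    have finD: "finite D" using DB less.prems finite_subset by blast
    have cD: "card D < card B" using ne DB less.prems(1) by (intro psubset_card_mono) auto
    have "\<exists>b. b \<in> B - D" using ne DB by auto
    then obtain b where b: "b \<in> B" "b \<notin> D" by auto
    have "insert a D - A \<subset> B - A" using b DB a by auto
    then have "card (insert a D - A) < card (B - A)"
      using less.prems(1) by (intro psubset_card_mono) auto
    then have "finite A \<and> card A \<le> card (insert a D)"
      using less.hyps[of "insert a D"] less.prems finD spB by auto
    moreover have "card (insert a D) \<le> card B" using cD finD by (simp add: card_insert_if)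
    ultimately show ?thesis by linarith
  qed
qed

text \<open>All bases of a subspace have the same size, so the choice made in \<open>left_dim\<close> is immaterial.\<close>

lemma dim_eq_card:
  assumes "indep B" "finite B" "span B = S"
  shows "dim S = card B"
proof -
  have S: "span S = S" using assms(3) sub_span span_sub by blast
  let ?P = "\<lambda>B. indep B \<and> span B = span S"
  have ex: "?P B" using assms S by simp
  then have "?P (Eps ?P)" by (rule someI)
  then have E: "indep (Eps ?P)" "span (Eps ?P) = span B" using ex by auto
  have 1: "finite (Eps ?P) \<and> card (Eps ?P) \<le> card B"
    using E span_superset[of "Eps ?P"] assms by (intro steinitz) auto
  have "card B \<le> card (Eps ?P)"
    using steinitz[of "Eps ?P" B] 1 E span_superset[of B] assms by auto
  with 1 have "card (Eps ?P) = card B" by simp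
  moreover have "dim S = card (Eps ?P)" unfolding left_dim_def using ex by auto
  ultimately show ?thesis by simp
qed

end

text \<open>A positive dimension guarantees that the space is finite-dimensional, as the default value of \<open>left_dim\<close>
  is \<open>0\<close>.\<close>

locale fin_space = left_vector_space scale
  for scale :: "'k::division_ring \<Rightarrow> 'v::ab_group_add \<Rightarrow> 'v" +
  fixes n :: nat
  assumes dim_UNIV: "left_dim scale UNIV = n" and n_pos: "0 < n"
begin

lemma basis_UNIV: "\<exists>B. indep B \<and> finite B \<and> span B = UNIV \<and> card B = n"
proof -
  let ?P = "\<lambda>B. indep B \<and> span B = span UNIV"
  have U: "span UNIV = UNIV" by (rule span_sub[OF sub_UNIV])
  have ex: "\<exists>B. ?P B" using dim_UNIV n_pos unfolding left_dim_def by (auto split: if_splits)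
  then have "?P (Eps ?P)" by (rule someI_ex)
  moreover have "card (Eps ?P) = n" using dim_UNIV ex unfolding left_dim_def by simp
  moreover have "finite (Eps ?P)" using calculation n_pos by (metis card.infinite less_irrefl)
  ultimately show ?thesis using U by auto
qed

lemma indep_bound: "indep A \<Longrightarrow> finite A \<and> card A \<le> n"
proof -
  obtain B where "finite B" "span B = UNIV" "card B = n" using basis_UNIV by blast
  then show "indep A \<Longrightarrow> finite A \<and> card A \<le> n" using steinitz[of B A] by simp
qed

lemma extend_to_basis:
  assumes "sub S" "indep A" "A \<subseteq> S"
  shows "\<exists>B. A \<subseteq> B \<and> indep B \<and> finite B \<and> span B = S"
  using assms(2,3)
proof (induction "n - card A" arbitrary: A rule: less_induct)
  case less
  have spS: "span A \<subseteq> S" using less.prems assms(1) by (intro span_least) auto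
  show ?case
  proof (cases "span A = S")
    case True then show ?thesis using less.prems(1) indep_bound[of A] by (intro exI[of _ A]) auto
  next
    case False
    then obtain x where x: "x \<in> S" "x \<notin> span A" using spS by auto
    have i: "indep (insert x A)" using x less.prems by (intro indep_insert)
    have "x \<notin> A" using x span_superset by blast
    then have "card (insert x A) = Suc (card A)" using less.prems(1) indep_bound by simp
    moreover have "card (insert x A) \<le> n" using i indep_bound by blast
    ultimately have "\<exists>B. insert x A \<subseteq> B \<and> indep B \<and> finite B \<and> span B = S"
      using x i less.prems by (intro less.hyps) auto
    then show ?thesis by blast
  qed
qed

lemma indep_empty: "indep {}" by (simp add: left_independent_def)

lemma basis_of:
  assumes "sub S"
  obtains B where "indep B" "finite B" "span B = S" "card B = dim S"
proof -
  obtain B where "indep B" "finite B" "span B = S"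
    using extend_to_basis[OF assms indep_empty] by auto
  then show ?thesis using that dim_eq_card by metis
qed

lemma dim_adjoin: assumes "sub S" "x \<notin> S" shows "dim (adjoin S x) = Suc (dim S)"
proof -
  obtain B where B: "indep B" "finite B" "span B = S" "card B = dim S" using basis_of assms by blast
  have "indep (insert x B)" using B assms by (intro indep_insert) auto
  moreover have "span (insert x B) = adjoin S x" using B by (simp add: span_insert)
  moreover have "x \<notin> B" using B assms span_superset by blast
  ultimately show ?thesis using dim_eq_card[of "insert x B"] B by simp
qed

lemma dim_mono: assumes "sub S" "sub T" "S \<subseteq> T" shows "dim S \<le> dim T"
proof -
  obtain B where B: "indep B" "finite B" "span B = S" "card B = dim S" using basis_of assms(1) by blast
  obtain C where C: "indep C" "finite C" "span C = T" "card C = dim T" using basis_of assms(2) by blast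
  show ?thesis using steinitz[of C B] B C assms(3) span_superset[of B] by auto
qed

lemma dim_strict: assumes "sub S" "sub T" "S \<subset> T" shows "dim S < dim T"
proof -
  obtain x where x: "x \<in> T" "x \<notin> S" using assms by auto
  have "dim (adjoin S x) \<le> dim T" using assms x by (intro dim_mono sub_adjoin adjoin_least) auto
  then show ?thesis using dim_adjoin[OF assms(1) x(2)] by simp
qed

lemma dim_eq_imp_eq: "sub S \<Longrightarrow> sub T \<Longrightarrow> S \<subseteq> T \<Longrightarrow> dim T \<le> dim S \<Longrightarrow> S = T"
  using dim_strict[of S T] by (metis not_less psubsetI)

lemma dim_le_n: "sub S \<Longrightarrow> dim S \<le> n"
  using dim_mono[OF _ sub_UNIV] dim_UNIV by simp

lemma dim_zero: "dim {0} = 0"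
proof -
  have "span {} = {0}"
    using span_least[of "{}" "{0}"] sub_zero sub_0[OF sub_span[of "{}"]] by auto
  then show ?thesis using dim_eq_card[OF indep_empty, of "{0}"] by simp
qed

lemma adjoin_eqI:
  assumes "sub S" "sub T" "S \<subseteq> T" "dim T = Suc (dim S)" "x \<in> T" "x \<notin> S"
  shows "T = adjoin S x"
  using dim_eq_imp_eq[of "adjoin S x" T] dim_adjoin[of S x] adjoin_least[of S T x] assms sub_adjoin by auto

lemma intermediate:
  assumes "sub S" "sub T" "S \<subseteq> T" "dim S \<le> m" "m \<le> dim T"
  obtains X where "sub X" "S \<subseteq> X" "X \<subseteq> T" "dim X = m"
proof -
  have "\<exists>X. sub X \<and> S \<subseteq> X \<and> X \<subseteq> T \<and> dim X = m"
    using assms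
  proof (induction "m - dim S" arbitrary: S)
    case 0
    then show ?case by (intro exI[of _ S]) auto
  next
    case (Suc j)
    have "S \<noteq> T" using Suc.hyps(2) Suc.prems(5) by auto
    then obtain x where x: "x \<in> T" "x \<notin> S" using Suc.prems(3) by auto
    have "\<exists>X. sub X \<and> adjoin S x \<subseteq> X \<and> X \<subseteq> T \<and> dim X = m"
    proof (rule Suc.hyps(1))
      show "j = m - dim (adjoin S x)" "dim (adjoin S x) \<le> m"
        using Suc.hyps(2) Suc.prems(1) dim_adjoin[of S x] x by auto
      show "adjoin S x \<subseteq> T" using Suc.prems x by (intro adjoin_least)
    qed (use Suc.prems sub_adjoin in auto)
    then show ?case using adjoin_superset by blast
  qed
  then show ?thesis using that by blast
qed

lemma hyperplane:
  assumes "sub S" "sub D" "D \<subset> S"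
  obtains H where "sub H" "D \<subseteq> H" "H \<subseteq> S" "dim S = Suc (dim H)"
proof -
  have lt: "dim D < dim S" using assms dim_strict by blast
  obtain H where "sub H" "D \<subseteq> H" "H \<subseteq> S" "dim H = dim S - 1"
    by (rule intermediate[of D S "dim S - 1"]) (use assms lt in auto)
  then show ?thesis using that lt by simp
qed

text \<open>A subspace of maximal dimension among those that contain \<open>S\<close> and miss \<open>x\<close> is a complement
  of the line through \<open>x\<close>; the functional reads off the coordinate along \<open>x\<close>.\<close>

lemma separating_functional:
  assumes "sub S" "x \<notin> S"
  obtains \<phi> where "\<phi> \<in> dual_space scale" "\<forall>v\<in>S. \<phi> v = 0" "\<phi> x = 1"
proof -
  have "\<exists>H. (sub H \<and> S \<subseteq> H \<and> x \<notin> H) \<and> (\<forall>H'. sub H' \<and> S \<subseteq> H' \<and> x \<notin> H' \<longrightarrow> dim H' \<le> dim H)"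
    using assms dim_le_n by (intro ex_has_greatest_nat[of _ S _ "Suc n"]) (auto simp: less_Suc_eq_le)
  then obtain H where H: "sub H" "S \<subseteq> H" "x \<notin> H"
    and max: "\<And>H'. sub H' \<Longrightarrow> S \<subseteq> H' \<Longrightarrow> x \<notin> H' \<Longrightarrow> dim H' \<le> dim H" by blast
  have all: "y \<in> adjoin H x" for y
  proof (cases "y \<in> H")
    case True then show ?thesis using adjoin_superset by blast
  next
    case False
    have "x \<in> adjoin H y"
    proof (rule ccontr)
      assume "x \<notin> adjoin H y"
      then have "dim (adjoin H y) \<le> dim H" using H adjoin_superset by (intro max sub_adjoin) blast+
      then show False using dim_adjoin[OF H(1) False] by simp
    qed
    then show ?thesis using adjoin_exchange[of H x y] H adjoin_mem[of H y] by simp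
  qed
  have ex1: "\<exists>!c. y - scale c x \<in> H" for y
  proof -
    obtain s c where sc: "s \<in> H" "y = s + scale c x" using all[of y] by (metis adjoinE)
    have "c' = c" if "y - scale c' x \<in> H" for c'
    proof (rule ccontr)
      assume ne: "c' \<noteq> c"
      have "(y - scale c x) - (y - scale c' x) \<in> H" using sc that H by (intro sub_diff[of H "y - scale c x"]) auto
      then have "scale (c' - c) x \<in> H" by (simp add: scale_left_diff)
      then show False using sub_scale_iff[OF H(1), of "c' - c" x] ne H(3) by simp
    qed
    then show ?thesis using sc by (intro ex1I[of _ c]) auto
  qed
  define \<phi> where "\<phi> y = (THE c. y - scale c x \<in> H)" for y
  have \<phi>: "y - scale (\<phi> y) x \<in> H" for y unfolding \<phi>_def by (rule theI'[OF ex1])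
  have \<phi>_eq: "\<phi> y = c" if "y - scale c x \<in> H" for y c using ex1 \<phi> that by blast
  have add: "\<phi> (u + v) = \<phi> u + \<phi> v" for u v
  proof (rule \<phi>_eq)
    have "(u - scale (\<phi> u) x) + (v - scale (\<phi> v) x) \<in> H" using \<phi> H by (intro sub_add)
    then show "u + v - scale (\<phi> u + \<phi> v) x \<in> H" by (simp add: scale_left_distrib algebra_simps)
  qed
  have mult: "\<phi> (scale c v) = c * \<phi> v" for c v
  proof (rule \<phi>_eq)
    have "scale c (v - scale (\<phi> v) x) \<in> H" using \<phi> H by (intro sub_scale)
    then show "scale c v - scale (c * \<phi> v) x \<in> H" by (simp add: scale_right_diff)
  qed
  show ?thesis
  proof (rule that[of \<phi>])
    show "\<phi> \<in> dual_space scale" by (simp add: dual_space_def add mult)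
    show "\<forall>v\<in>S. \<phi> v = 0" using H by (intro ballI \<phi>_eq) auto
    show "\<phi> x = 1" using H by (intro \<phi>_eq) (simp add: sub_0)
  qed
qed

end

section \<open>Adjacency of subspaces\<close>

context left_vector_space
begin

definition join :: "'v set \<Rightarrow> 'v set \<Rightarrow> 'v set" where
  "join P T = {p + t | p t. p \<in> P \<and> t \<in> T}"

lemma joinI: "p \<in> P \<Longrightarrow> t \<in> T \<Longrightarrow> p + t \<in> join P T" by (auto simp: join_def)

lemma joinE: assumes "v \<in> join P T" obtains p t where "p \<in> P" "t \<in> T" "v = p + t"
  using assms by (auto simp: join_def)

lemma sub_join: assumes "sub P" "sub T" shows "sub (join P T)"
  unfolding left_subspace_def
proof (intro conjI ballI allI)
  show "0 \<in> join P T" using joinI[of 0 P 0 T] assms by (simp add: sub_0)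
next
  fix u v assume "u \<in> join P T" "v \<in> join P T"
  obtain p t where "p \<in> P" "t \<in> T" "u = p + t" using \<open>u \<in> join P T\<close> by (rule joinE)
  moreover obtain p' t' where "p' \<in> P" "t' \<in> T" "v = p' + t'" using \<open>v \<in> join P T\<close> by (rule joinE)
  ultimately have "p \<in> P" "t \<in> T" "p' \<in> P" "t' \<in> T" and uv: "u = p + t" "v = p' + t'" by auto
  then have "(p + p') + (t + t') \<in> join P T" by (intro joinI sub_add assms)
  then show "u + v \<in> join P T" unfolding uv by (simp add: algebra_simps)
next
  fix a u assume "u \<in> join P T"
  then obtain p t where "p \<in> P" "t \<in> T" "u = p + t" by (rule joinE)
  then show "scale a u \<in> join P T"
    using joinI[of "scale a p" P "scale a t" T] assms by (simp add: sub_scale scale_right_distrib)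
qed

lemma join_commute: "join P T = join T P"
  unfolding join_def by (auto, (metis add.commute)+)

lemma join_superset1: "sub T \<Longrightarrow> P \<subseteq> join P T"
  using joinI[of _ P 0 T] by (auto simp: sub_0)

lemma join_superset2: "sub P \<Longrightarrow> T \<subseteq> join P T"
  using join_superset1[of P T] by (simp add: join_commute)

lemma join_least: "sub J \<Longrightarrow> P \<subseteq> J \<Longrightarrow> T \<subseteq> J \<Longrightarrow> join P T \<subseteq> J"
  by (auto simp: join_def intro!: sub_add)

lemma G_iff: "X \<in> G i \<longleftrightarrow> sub X \<and> dim X = i" by (simp add: grassmannian_def)

lemma adj_sym: "adj P T \<Longrightarrow> adj T P"
  by (simp add: adjacent_subspaces_def Int_commute)

lemma adj_irrefl: "\<not> adj P P"
  by (simp add: adjacent_subspaces_def)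

lemma adj_neq: "adj P T \<Longrightarrow> P \<noteq> T" using adj_irrefl by blast

lemma adj_sub: "adj P T \<Longrightarrow> sub P \<and> sub T"
  by (simp add: adjacent_subspaces_def)

lemma adj_dim_meet: "adj P T \<Longrightarrow> dim P = Suc (dim (P \<inter> T)) \<and> dim T = Suc (dim (P \<inter> T))"
  by (simp add: adjacent_subspaces_def)

end

context fin_space
begin

lemma G_eqI: "X \<in> G i \<Longrightarrow> Y \<in> G i \<Longrightarrow> X \<subseteq> Y \<Longrightarrow> X = Y"
  using dim_eq_imp_eq[of X Y] by (simp add: G_iff)

lemma G_not_sub: "X \<in> G i \<Longrightarrow> Y \<in> G i \<Longrightarrow> X \<noteq> Y \<Longrightarrow> \<exists>x. x \<in> X \<and> x \<notin> Y"
  using G_eqI by blast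

lemma adj_not_sub: assumes "adj P T" obtains x where "x \<in> P" "x \<notin> T"
proof -
  have "\<not> P \<subseteq> T"
    using adj_sub[OF assms] adj_dim_meet[OF assms] dim_eq_imp_eq[of P T] adj_neq[OF assms] by auto
  then show ?thesis using that by blast
qed

lemma adj_adjoin_meet: assumes "adj P T" "x \<in> P" "x \<notin> T" shows "P = adjoin (P \<inter> T) x"
  using assms adj_sub[OF assms(1)] adj_dim_meet[OF assms(1)] by (intro adjoin_eqI sub_Int) auto

lemma adj_join:
  assumes "adj P T" "x \<in> P" "x \<notin> T"
  shows "join P T = adjoin T x" "dim (join P T) = Suc (dim T)"
proof -
  have s: "sub P" "sub T" using adj_sub[OF assms(1)] by auto
  have "adjoin (P \<inter> T) x \<subseteq> adjoin T x"
    using s adjoin_superset[of T x] by (intro adjoin_least sub_adjoin adjoin_mem) auto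
  then have "P \<subseteq> adjoin T x" by (simp only: adj_adjoin_meet[OF assms, symmetric])
  then have "join P T \<subseteq> adjoin T x" using s adjoin_superset by (intro join_least sub_adjoin)
  moreover have "adjoin T x \<subseteq> join P T"
    using s assms join_superset1[of T P] join_superset2[of P T] by (intro adjoin_least sub_join) auto
  ultimately show eq: "join P T = adjoin T x" by auto
  show "dim (join P T) = Suc (dim T)" unfolding eq using assms s by (intro dim_adjoin)
qed

lemma adj_join_G: "adj P T \<Longrightarrow> P \<in> G m \<Longrightarrow> join P T \<in> G (Suc m)"
proof -
  assume a: "adj P T" "P \<in> G m"
  obtain x where "x \<in> P" "x \<notin> T" using adj_not_sub[OF a(1)] .
  then show "join P T \<in> G (Suc m)"
    using adj_join(2)[OF a(1)] adj_sub[OF a(1)] adj_dim_meet[OF a(1)] a(2) sub_join by (auto simp: G_iff)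
qed

lemma adj_meet_G: "adj P T \<Longrightarrow> P \<in> G (Suc m) \<Longrightarrow> P \<inter> T \<in> G m"
  using adj_dim_meet[of P T] adj_sub[of P T] by (simp add: G_iff sub_Int)

text \<open>Two subspaces of a space of one dimension more: each is a hyperplane there, so the trace of
  one on the other is a hyperplane.\<close>

lemma common_upper:
  assumes "P \<in> G m" "T \<in> G m" "P \<noteq> T" "J \<in> G (Suc m)" "P \<subseteq> J" "T \<subseteq> J"
  shows "adj P T" "join P T = J"
proof -
  have s: "sub P" "sub T" "sub J" "dim P = m" "dim T = m" "dim J = Suc m" using assms by (auto simp: G_iff)
  obtain x where x: "x \<in> P" "x \<notin> T" using G_not_sub assms by blast
  have J: "J = adjoin T x" using s x assms by (intro adjoin_eqI) auto
  have "P \<subseteq> adjoin (P \<inter> T) x"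
  proof
    fix u assume u: "u \<in> P"
    then obtain t c where t: "t \<in> T" "u = t + scale c x" using J assms(5) by (metis adjoinE subsetD)
    then have "t = u - scale c x" by simp
    then have "t \<in> P" using u x s by (simp add: sub_diff sub_scale)
    then show "u \<in> adjoin (P \<inter> T) x" using t adjoinI by blast
  qed
  then have "P = adjoin (P \<inter> T) x"
    using x s by (intro equalityI adjoin_least) auto
  then have "dim P = Suc (dim (P \<inter> T))" using dim_adjoin[of "P \<inter> T" x] x s sub_Int by auto
  then show a: "adj P T" using s by (simp add: adjacent_subspaces_def)
  show "join P T = J" using adj_join(1)[OF a x] J by simp
qed

lemma common_lower:
  assumes "P \<in> G (Suc m)" "T \<in> G (Suc m)" "P \<noteq> T" "W \<in> G m" "W \<subseteq> P" "W \<subseteq> T"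
  shows "adj P T" "P \<inter> T = W"
proof -
  have s: "sub P" "sub T" "sub W" "sub (P \<inter> T)" "dim P = Suc m" "dim T = Suc m" "dim W = m"
    using assms by (auto simp: G_iff sub_Int)
  have "P \<inter> T \<subset> P" using G_not_sub[OF assms(1,2,3)] by auto
  then have l: "dim (P \<inter> T) < Suc m" using dim_strict[of "P \<inter> T" P] s by simp
  have "dim W \<le> dim (P \<inter> T)" using s assms by (intro dim_mono) auto
  then have "dim (P \<inter> T) = m" using l s by simp
  then show "adj P T" using s by (simp add: adjacent_subspaces_def)
  show "P \<inter> T = W" using dim_eq_imp_eq[of W "P \<inter> T"] s assms(5,6) \<open>dim (P \<inter> T) = m\<close> by simp
qed

text \<open>If \<open>Z\<close> misses a vector \<open>x\<close> of \<open>P \<inter> T\<close>, then \<open>Z \<inter> P\<close> and \<open>Z \<inter> T\<close> are different hyperplanes of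
  \<open>Z\<close>, since adding \<open>x\<close> to them gives \<open>P\<close> and \<open>T\<close>; hence they span \<open>Z\<close>.\<close>

lemma triangle:
  assumes "adj P T" "adj Z P" "adj Z T"
  shows "P \<inter> T \<subseteq> Z \<or> Z \<subseteq> join P T"
proof (cases "P \<inter> T \<subseteq> Z")
  case False
  then obtain x where x: "x \<in> P" "x \<in> T" "x \<notin> Z" by auto
  have s: "sub P" "sub T" "sub Z" "sub (Z \<inter> P)"
    using adj_sub[OF assms(1)] adj_sub[OF assms(2)] sub_Int by auto
  have P: "P = adjoin (P \<inter> Z) x" using assms x by (intro adj_adjoin_meet adj_sym[of Z]) auto
  have T: "T = adjoin (T \<inter> Z) x" using assms x by (intro adj_adjoin_meet adj_sym[of Z]) auto
  have "\<not> Z \<inter> T \<subseteq> P"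
  proof
    assume "Z \<inter> T \<subseteq> P"
    then have "adjoin (T \<inter> Z) x \<subseteq> P" using x s by (intro adjoin_least) auto
    then have "T \<subseteq> P" by (simp only: T[symmetric])
    then have "T = P" using s adj_dim_meet[OF assms(1)] dim_eq_imp_eq[of T P] by simp
    then show False using adj_neq[OF assms(1)] by simp
  qed
  then obtain z where z: "z \<in> Z" "z \<in> T" "z \<notin> P" by auto
  have "Z = adjoin (Z \<inter> P) z" using assms z by (intro adj_adjoin_meet) auto
  also have "\<dots> \<subseteq> join P T"
    using s z join_superset1[of T P] join_superset2[of P T] by (intro adjoin_least sub_join) auto
  finally show ?thesis by simp
qed simp

definition star :: "nat \<Rightarrow> 'v set \<Rightarrow> 'v set set" where "star i S = {X \<in> G i. S \<subseteq> X}"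
definition tops :: "nat \<Rightarrow> 'v set \<Rightarrow> 'v set set" where "tops i U = {X \<in> G i. X \<subseteq> U}"

lemma star_clique: "S \<in> G m \<Longrightarrow> X \<in> star (Suc m) S \<Longrightarrow> Y \<in> star (Suc m) S \<Longrightarrow> X \<noteq> Y \<Longrightarrow> adj X Y"
  using common_lower(1)[of X m Y S] by (auto simp: star_def)

lemma tops_clique: "U \<in> G (Suc m) \<Longrightarrow> X \<in> tops m U \<Longrightarrow> Y \<in> tops m U \<Longrightarrow> X \<noteq> Y \<Longrightarrow> adj X Y"
  using common_upper(1)[of X m Y U] by (auto simp: tops_def)

text \<open>Suppose that \<open>Z\<close> misses part of \<open>X \<inter> Y\<close>, so that \<open>Z \<subseteq> X + Y\<close>. A member \<open>T\<close> of the clique that sticks out of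
  \<open>X + Y\<close> contains \<open>X \<inter> Y\<close>, and it meets \<open>X + Y\<close> in a hyperplane of \<open>T\<close> at most. This hyperplane has to be
  \<open>T \<inter> Z\<close>, so \<open>X \<inter> Y\<close> would be contained in \<open>Z\<close>.\<close>

lemma clique_star_or_tops:
  assumes C: "C \<subseteq> G (Suc m)" and cl: "\<And>X Y. X \<in> C \<Longrightarrow> Y \<in> C \<Longrightarrow> X \<noteq> Y \<Longrightarrow> adj X Y"
    and XY: "X \<in> C" "Y \<in> C" "X \<noteq> Y"
  shows "(\<exists>S\<in>G m. C \<subseteq> star (Suc m) S) \<or> (\<exists>U\<in>G (Suc (Suc m)). C \<subseteq> tops (Suc m) U)"
proof (cases "\<forall>Z\<in>C. X \<inter> Y \<subseteq> Z")
  case True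
  have "X \<inter> Y \<in> G m" using C XY cl by (intro adj_meet_G) auto
  moreover have "C \<subseteq> star (Suc m) (X \<inter> Y)" using True C by (auto simp: star_def)
  ultimately show ?thesis by blast
next
  case False
  then obtain Z where Z: "Z \<in> C" "\<not> X \<inter> Y \<subseteq> Z" by auto
  have aXY: "adj X Y" and aZ: "adj Z X" "adj Z Y" using cl XY Z by blast+
  have s: "sub X" "sub Y" "sub Z" using adj_sub[OF aXY] adj_sub[OF aZ(1)] by auto
  have ZJ: "Z \<subseteq> join X Y" using triangle[OF aXY aZ] Z by blast
  have J: "join X Y \<in> G (Suc (Suc m))" using C XY by (intro adj_join_G aXY) auto
  have "T \<subseteq> join X Y" if T: "T \<in> C" for T
  proof (rule ccontr)
    assume n: "\<not> T \<subseteq> join X Y"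
    then have ne: "T \<noteq> X" "T \<noteq> Y" "T \<noteq> Z"
      using ZJ join_superset1[OF s(2)] join_superset2[OF s(1)] by blast+
    have aT: "adj T X" "adj T Y" "adj T Z" using cl ne T XY Z by blast+
    have sT: "sub T" using adj_sub[OF aT(1)] by auto
    have XYT: "X \<inter> Y \<subseteq> T" using triangle[OF aXY aT(1,2)] n by blast
    \<comment> \<open>\<open>T\<close> meets \<open>X + Y\<close> in a proper subspace that contains the hyperplanes \<open>X \<inter> Y\<close> and \<open>T \<inter> Z\<close> of \<open>T\<close>\<close>
    have sI: "sub (T \<inter> join X Y)" using sT s by (intro sub_Int sub_join)
    have "T \<inter> join X Y \<subset> T" using n by auto
    then have "dim (T \<inter> join X Y) < dim T" using dim_strict sI sT by blast
    moreover have "dim T = Suc (dim (T \<inter> Z))" using adj_dim_meet[OF aT(3)] by simp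
    ultimately have "T \<inter> Z = T \<inter> join X Y"
      using ZJ sT s by (intro dim_eq_imp_eq sub_Int sI) auto
    then have "X \<inter> Y \<subseteq> Z" using XYT join_superset1[of Y X] s by blast
    then show False using Z by simp
  qed
  then have "C \<subseteq> tops (Suc m) (join X Y)" using C by (auto simp: tops_def)
  then show ?thesis using J by blast
qed

lemma sub_G_exists:
  assumes "m \<le> n" obtains X where "X \<in> G m"
proof -
  obtain X where "sub X" "{0} \<subseteq> X" "X \<subseteq> UNIV" "dim X = m"
    by (rule intermediate[of "{0}" UNIV m]) (use assms sub_zero sub_UNIV dim_zero dim_UNIV in auto)
  then show ?thesis using that by (simp add: G_iff)
qed

text \<open>One step towards \<open>T\<close>: replace \<open>S\<close> by a hyperplane of \<open>S\<close> containing \<open>S \<inter> T\<close> together with a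
  vector of \<open>T\<close>.\<close>

lemma grassmann_connected:
  assumes "S \<in> G m" "T \<in> G m"
  shows "(\<lambda>X Y. X \<in> G m \<and> Y \<in> G m \<and> adj X Y)\<^sup>*\<^sup>* S T"
  using assms
proof (induction "m - dim (S \<inter> T)" arbitrary: S rule: less_induct)
  case less
  show ?case
  proof (cases "S = T")
    case False
    have s: "sub S" "sub T" "sub (S \<inter> T)" "dim S = m" "dim T = m" using less.prems by (auto simp: G_iff sub_Int)
    obtain x where x: "x \<in> S" "x \<notin> T" using G_not_sub less.prems False by blast
    obtain t where t: "t \<in> T" "t \<notin> S" using G_not_sub less.prems False by blast
    have "S \<inter> T \<subset> S" using x by auto
    then obtain H where H: "sub H" "S \<inter> T \<subseteq> H" "H \<subseteq> S" "dim S = Suc (dim H)"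
      using hyperplane s by blast
    obtain k where k: "m = Suc k" using H s by simp
    define S' where "S' = adjoin H t"
    have tH: "t \<notin> H" using t H by auto
    have S': "S' \<in> G m" using H s tH dim_adjoin[of H t] sub_adjoin by (simp add: G_iff S'_def)
    have tS': "t \<in> S'" using adjoin_mem[OF H(1)] S'_def by simp
    have "S \<noteq> S'" using tS' t by auto
    moreover have "H \<in> G k" using H s k by (simp add: G_iff)
    ultimately have a: "adj S S'"
      using common_lower(1)[of S k S' H] less.prems(1) S' k H(3) adjoin_superset[of H t] S'_def by simp
    have "S \<inter> T \<subset> S' \<inter> T" using H(2) adjoin_superset[of H t] t tS' unfolding S'_def by blast
    then have "dim (S \<inter> T) < dim (S' \<inter> T)" using S' s by (intro dim_strict sub_Int) (auto simp: G_iff)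
    moreover have "dim (S \<inter> T) < m" using dim_strict[of "S \<inter> T" S] s x by auto
    ultimately have "m - dim (S' \<inter> T) < m - dim (S \<inter> T)" by simp
    then have "(\<lambda>X Y. X \<in> G m \<and> Y \<in> G m \<and> adj X Y)\<^sup>*\<^sup>* S' T"
      using less.hyps S' less.prems(2) by blast
    then show ?thesis using a less.prems(1) S' by (intro converse_rtranclp_into_rtranclp[of _ S S']) auto
  qed simp
qed

lemma G_other:
  assumes "S \<in> G m" "0 < m" "m < n"
  obtains T where "T \<in> G m" "adj S T"
proof -
  have s: "sub S" "dim S = m" using assms by (auto simp: G_iff)
  have "S \<noteq> UNIV" using s assms dim_UNIV by auto
  then obtain x where x: "x \<notin> S" by auto
  have "{0} \<noteq> S" using s assms dim_zero by auto
  then have "{0} \<subset> S" using sub_0[OF s(1)] by auto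
  then obtain H where H: "sub H" "H \<subseteq> S" "dim S = Suc (dim H)"
    using hyperplane s sub_zero by metis
  have T: "adjoin H x \<in> G m" using H s dim_adjoin[of H x] x sub_adjoin by (auto simp: G_iff)
  have "S \<noteq> adjoin H x" using x adjoin_mem[OF H(1)] by auto
  then have "adj S (adjoin H x)"
    using common_lower(1)[of S "dim H" "adjoin H x" H] assms(1) T H s adjoin_superset[of H x] by (simp add: G_iff)
  then show ?thesis using that T by blast
qed

text \<open>For distance two, \<open>S1 \<inter> S2 = D\<close> has codimension two in both; writing \<open>S1 = D + <a1, a2>\<close> and
  \<open>S2 = D + <b1, b2>\<close>, the four subspaces \<open>D + <ai, bj>\<close> are common neighbours.\<close>

lemma three_common_neighbours:
  assumes S: "S1 \<in> G m" "S2 \<in> G m" "S \<in> G m" and a: "adj S S1" "adj S S2"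
    and ne: "S1 \<noteq> S2" "\<not> adj S1 S2"
  shows "\<exists>X Y. X \<noteq> Y \<and> X \<noteq> S \<and> Y \<noteq> S \<and> X \<in> G m \<and> Y \<in> G m \<and> adj X S1 \<and> adj X S2 \<and> adj Y S1 \<and> adj Y S2"
proof -
  define D where "D = S1 \<inter> S2"
  have s: "sub S1" "sub S2" "sub S" "sub D" "dim S1 = m" "dim S2 = m" "dim S = m"
    using S by (auto simp: G_iff D_def sub_Int)
  define D1 where "D1 = S \<inter> S1"
  define D2 where "D2 = S \<inter> S2"
  have sD: "sub D1" "sub D2" by (simp_all add: D1_def D2_def sub_Int s)
  have dD: "m = Suc (dim D1)" "m = Suc (dim D2)" using adj_dim_meet[OF a(1)] adj_dim_meet[OF a(2)] s
    by (auto simp: D1_def D2_def)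
  have nD12: "D1 \<noteq> D2"
  proof
    assume eq: "D1 = D2"
    then have "D1 \<subseteq> S1" "D1 \<subseteq> S2" by (auto simp: D1_def D2_def)
    then show False
      using common_lower(1)[of S1 "dim D1" S2 D1] S ne dD sD by (simp add: G_iff)
  qed
  have DG: "D1 \<in> G (dim D1)" "D2 \<in> G (dim D1)" "S \<in> G (Suc (dim D1))" using sD dD S by (auto simp: G_iff)
  have sub12: "D1 \<subseteq> S" "D2 \<subseteq> S" by (auto simp: D1_def D2_def)
  have aD: "adj D1 D2" using common_upper(1)[OF DG(1,2) nD12 DG(3) sub12] .
  have DDI: "dim D1 = Suc (dim (D1 \<inter> D2))" using adj_dim_meet[OF aD] by simp
  have D_eq: "D = D1 \<inter> D2"
  proof (rule sym, rule dim_eq_imp_eq)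
    show "D1 \<inter> D2 \<subseteq> D" by (auto simp: D1_def D2_def D_def)
    have "D \<subset> S1" using G_not_sub[OF S(1,2) ne(1)] by (auto simp: D_def)
    then have "dim D < m" using dim_strict s by blast
    moreover have "Suc (dim D) \<noteq> m" using ne(2) s by (auto simp: adjacent_subspaces_def D_def)
    ultimately show "dim D \<le> dim (D1 \<inter> D2)" using dD DDI by simp
  qed (use sD s sub_Int in auto)
  obtain a1 where a1: "a1 \<in> D1" "a1 \<notin> D2" using adj_not_sub[OF aD] by blast
  obtain b1 where b1: "b1 \<in> D2" "b1 \<notin> D1" using adj_not_sub[OF adj_sym[OF aD]] by blast
  obtain a2 where a2: "a2 \<in> S1" "a2 \<notin> S" using adj_not_sub[OF adj_sym[OF a(1)]] by blast
  obtain b2 where b2: "b2 \<in> S2" "b2 \<notin> S" using adj_not_sub[OF adj_sym[OF a(2)]] by blast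
  define N where "N u v = adjoin (adjoin D u) v" for u v
  have N: "N u v \<in> G m \<and> adj (N u v) S1 \<and> adj (N u v) S2 \<and> u \<in> N u v \<and> v \<in> N u v \<and> D \<subseteq> N u v"
    if u: "u \<in> S1" "u \<notin> D" and v: "v \<in> S2" "v \<notin> D" for u v
  proof -
    have dm: "m = Suc (Suc (dim D))" using dD DDI D_eq by simp
    have DS: "D \<subseteq> S1" "D \<subseteq> S2" by (auto simp: D_def)
    have uS: "adjoin D u \<subseteq> S1" "adjoin D v \<subseteq> S2"
      using adjoin_least[OF DS(1) u(1) s(1)] adjoin_least[OF DS(2) v(1) s(2)] by auto
    have v1: "v \<notin> S1" and u2: "u \<notin> S2" using u v by (auto simp: D_def)
    have su: "sub (adjoin D u)" "sub (adjoin D v)" using s sub_adjoin by auto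
    have du: "dim (adjoin D u) = Suc (dim D)" "dim (adjoin D v) = Suc (dim D)" using u v dim_adjoin s by auto
    have "v \<notin> adjoin D u" using v1 uS by auto
    then have NG: "N u v \<in> G m" using dim_adjoin[OF su(1)] du dm sub_adjoin[OF su(1)] by (simp add: G_iff N_def)
    have mem: "u \<in> N u v" "v \<in> N u v" "D \<subseteq> N u v" "adjoin D u \<subseteq> N u v"
      using adjoin_mem[OF s(4), of u] adjoin_mem[OF su(1), of v] adjoin_superset[of D u] adjoin_superset[of "adjoin D u" v]
      by (auto simp: N_def)
    have "adjoin D v \<subseteq> N u v" using mem NG by (intro adjoin_least) (auto simp: G_iff)
    moreover have "N u v \<noteq> S1" "N u v \<noteq> S2" using mem v1 u2 by auto
    ultimately have "adj (N u v) S1 \<and> adj (N u v) S2"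
      using common_lower(1)[of "N u v" "Suc (dim D)" S1 "adjoin D u"]
        common_lower(1)[of "N u v" "Suc (dim D)" S2 "adjoin D v"] NG mem uS su du S dm
      by (simp add: G_iff)
    then show ?thesis using NG mem by simp
  qed
  have a1': "a1 \<in> S1" "a1 \<notin> D" "a1 \<in> S" using a1 D_eq by (auto simp: D1_def)
  have b1': "b1 \<in> S2" "b1 \<notin> D" "b1 \<in> S" "b1 \<notin> S1" using b1 D_eq by (auto simp: D1_def D2_def)
  have a2': "a2 \<notin> D" and b2': "b2 \<notin> D" using a2 b2 D_eq by (auto simp: D1_def)
  have X: "N a2 b1 \<in> G m \<and> adj (N a2 b1) S1 \<and> adj (N a2 b1) S2 \<and> a2 \<in> N a2 b1 \<and> b1 \<in> N a2 b1 \<and> D \<subseteq> N a2 b1"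
    by (rule N) (use a2 a2' b1' in auto)
  have Y: "N a1 b2 \<in> G m \<and> adj (N a1 b2) S1 \<and> adj (N a1 b2) S2 \<and> a1 \<in> N a1 b2 \<and> b2 \<in> N a1 b2 \<and> D \<subseteq> N a1 b2"
    by (rule N) (use b2 b2' a1' in auto)
  have "N a2 b1 \<noteq> N a1 b2"
  proof
    assume eq: "N a2 b1 = N a1 b2"
    have sN: "sub (N a2 b1)" using X by (simp add: G_iff)
    have "D1 = adjoin D a1"
      unfolding D_eq using a1 sD DDI by (intro adjoin_eqI sub_Int) auto
    then have D1: "D1 \<subseteq> N a2 b1" using adjoin_least[of D "N a2 b1" a1] Y eq sN by auto
    have "S1 = adjoin D1 a2" using a2 dD s sD by (intro adjoin_eqI) (auto simp: D1_def)
    then have "S1 \<subseteq> N a2 b1" using adjoin_least[of D1 "N a2 b1" a2] D1 X sN by auto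
    then have "S1 = N a2 b1" using G_eqI[OF S(1)] X by blast
    then show False using X b1' by auto
  qed
  moreover have "N a2 b1 \<noteq> S" "N a1 b2 \<noteq> S" using X Y a2 b2 by auto
  ultimately show ?thesis using X Y by blast
qed

lemma adj_G1: assumes "X \<in> G 1" "Y \<in> G 1" "X \<noteq> Y" shows "adj X Y"
  using common_lower(1)[of X 0 Y "{0}"] assms sub_zero dim_zero sub_0 by (auto simp: G_iff)

lemma adj_Gn1: assumes "X \<in> G (n - 1)" "Y \<in> G (n - 1)" "X \<noteq> Y" shows "adj X Y"
  using common_upper(1)[of X "n - 1" Y UNIV] assms n_pos sub_UNIV dim_UNIV by (auto simp: G_iff)

end

section \<open>Cartesian products of graphs\<close>

definition product_adjacent ::
    "('a \<Rightarrow> 'a \<Rightarrow> bool) \<Rightarrow> ('b \<Rightarrow> 'b \<Rightarrow> bool) \<Rightarrow> 'a \<times> 'b \<Rightarrow> 'a \<times> 'b \<Rightarrow> bool" where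
  "product_adjacent R Q p q \<longleftrightarrow>
     (fst p = fst q \<and> Q (snd p) (snd q)) \<or> (R (fst p) (fst q) \<and> snd p = snd q)"

locale factor_graph =
  fixes A :: "'a set" and R :: "'a \<Rightarrow> 'a \<Rightarrow> bool"
  assumes R_sym: "R x y \<Longrightarrow> R y x"
    and R_irrefl: "\<not> R x x"
    and connected: "x \<in> A \<Longrightarrow> y \<in> A \<Longrightarrow> (\<lambda>x y. x \<in> A \<and> y \<in> A \<and> R x y)\<^sup>*\<^sup>* x y"
    and neighbour: "x \<in> A \<Longrightarrow> \<exists>y\<in>A. R x y"
    and common_neighbours: "x \<in> A \<Longrightarrow> y \<in> A \<Longrightarrow> z \<in> A \<Longrightarrow> R z x \<Longrightarrow> R z y \<Longrightarrow> x \<noteq> y \<Longrightarrow> \<not> R x y \<Longrightarrow>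
      \<exists>u\<in>A. \<exists>v\<in>A. u \<noteq> v \<and> u \<noteq> z \<and> v \<noteq> z \<and> R u x \<and> R u y \<and> R v x \<and> R v y"

text \<open>An edge of the product changes exactly one coordinate. Whether two edges at \<open>q\<close> change the same
  coordinate is visible in the product graph: edges in different directions complete to a unique
  square, whose corners \<open>q\<close> and the opposite one are the only common neighbours of their end points.\<close>

lemma same_direction_iff:
  assumes "factor_graph A R" "factor_graph B Q"
    and X: "p \<in> A \<times> B" "q \<in> A \<times> B" "r \<in> A \<times> B"
    and e: "product_adjacent R Q q p" "product_adjacent R Q q r"
  shows "(fst p = fst q \<longleftrightarrow> fst r = fst q) \<longleftrightarrow>
    (p = r \<or> product_adjacent R Q p r \<or>
      (\<exists>u\<in>A \<times> B. \<exists>v\<in>A \<times> B. u \<noteq> v \<and> u \<noteq> q \<and> v \<noteq> q \<and>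
        product_adjacent R Q u p \<and> product_adjacent R Q u r \<and>
        product_adjacent R Q v p \<and> product_adjacent R Q v r))"
    (is "_ \<longleftrightarrow> ?C p r")
proof
  interpret r: factor_graph A R by fact
  interpret q: factor_graph B Q by fact
  assume same: "fst p = fst q \<longleftrightarrow> fst r = fst q"
  show "?C p r"
  proof (cases "p = r \<or> product_adjacent R Q p r")
    case False
    obtain a b where q: "q = (a, b)" "a \<in> A" "b \<in> B" using X by auto
    show ?thesis
    proof (cases "fst p = a")
      case True
      obtain b1 b2 where pr: "p = (a, b1)" "r = (a, b2)" "b1 \<in> B" "b2 \<in> B"
      proof
        have "fst p = a" "fst r = a" using True same q by auto
        then show "p = (a, snd p)" "r = (a, snd r)" by (simp_all add: prod_eq_iff)
        show "snd p \<in> B" "snd r \<in> B" using X by auto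
      qed
      have "Q b b1" "Q b b2" using e r.R_irrefl by (auto simp: pr q product_adjacent_def)
      moreover have "b1 \<noteq> b2" "\<not> Q b1 b2" using False by (auto simp: pr product_adjacent_def)
      ultimately obtain u v where "u \<in> B" "v \<in> B" "u \<noteq> v" "u \<noteq> b" "v \<noteq> b"
        "Q u b1" "Q u b2" "Q v b1" "Q v b2"
        using q.common_neighbours[of b1 b2 b] pr q by blast
      then show ?thesis using q(2,3)
        by - (rule disjI2, rule disjI2, rule bexI[of _ "(a, u)"], rule bexI[of _ "(a, v)"],
          auto simp: pr q(1) product_adjacent_def)
    next
      case neq: False
      obtain a1 a2 where pr: "p = (a1, b)" "r = (a2, b)" "a1 \<in> A" "a2 \<in> A"
      proof
        have "fst p \<noteq> fst q" "fst r \<noteq> fst q" using neq same q by auto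
        then have "snd p = b" "snd r = b" using e q by (auto simp: product_adjacent_def)
        then show "p = (fst p, b)" "r = (fst r, b)" by (simp_all add: prod_eq_iff)
        show "fst p \<in> A" "fst r \<in> A" using X by auto
      qed
      have "R a a1" "R a a2" using e q.R_irrefl by (auto simp: pr q product_adjacent_def)
      moreover have "a1 \<noteq> a2" "\<not> R a1 a2" using False by (auto simp: pr product_adjacent_def)
      ultimately obtain u v where "u \<in> A" "v \<in> A" "u \<noteq> v" "u \<noteq> a" "v \<noteq> a"
        "R u a1" "R u a2" "R v a1" "R v a2"
        using r.common_neighbours[of a1 a2 a] pr q by blast
      then show ?thesis using q(2,3)
        by - (rule disjI2, rule disjI2, rule bexI[of _ "(u, b)"], rule bexI[of _ "(v, b)"],
          auto simp: pr q(1) product_adjacent_def)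
    qed
  qed auto
next
  interpret r: factor_graph A R by fact
  interpret q: factor_graph B Q by fact
  have no: "\<not> ?C p r" if pr: "p = (a, b1)" "q = (a, b)" "r = (a1, b)" "a \<noteq> a1" "b \<noteq> b1" for p r a b a1 b1
  proof -
    have "x = q \<or> x = (a1, b1)" if "product_adjacent R Q x p" "product_adjacent R Q x r" for x
      using that pr by (cases x) (auto simp: product_adjacent_def)
    then show ?thesis using pr by (auto simp: product_adjacent_def)
  qed
  have diff: "(fst x = fst q) \<noteq> (snd x = snd q)" if "product_adjacent R Q q x" for x
    using that r.R_irrefl q.R_irrefl by (auto simp: product_adjacent_def)
  have sym: "?C r p" if "?C p r"
  proof -
    have "product_adjacent R Q r p" if "product_adjacent R Q p r"
      using that r.R_sym q.R_sym by (auto simp: product_adjacent_def)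
    then show ?thesis using that by blast
  qed
  assume C: "?C p r"
  show "fst p = fst q \<longleftrightarrow> fst r = fst q"
  proof (rule ccontr)
    assume "\<not> ?thesis"
    then consider "fst p = fst q" "fst r \<noteq> fst q" | "fst p \<noteq> fst q" "fst r = fst q" by auto
    then show False
    proof cases
      case 1
      then have "snd p \<noteq> snd q" "snd r = snd q" using diff[OF e(1)] diff[OF e(2)] by auto
      then have "\<not> ?C p r" using 1 by (intro no[of p "fst q" "snd p" "snd q" r "fst r"]) (auto simp: prod_eq_iff)
      then show False using C by (rule notE)
    next
      case 2
      then have "snd r \<noteq> snd q" "snd p = snd q" using diff[OF e(1)] diff[OF e(2)] by auto
      then have "\<not> ?C r p" using 2 by (intro no[of r "fst q" "snd r" "snd q" p "fst p"]) (auto simp: prod_eq_iff)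
      then show False using sym[OF C] by (rule notE)
    qed
  qed
qed

locale product_isomorphism =
  a: factor_graph A R + b: factor_graph B Q + c: factor_graph C R' + d: factor_graph D Q'
  for A :: "'a set" and R and B :: "'b set" and Q and C :: "'c set" and R' and D :: "'d set" and Q' +
  fixes f :: "'a \<times> 'b \<Rightarrow> 'c \<times> 'd"
  assumes bij: "bij_betw f (A \<times> B) (C \<times> D)"
    and edge_iff: "p \<in> A \<times> B \<Longrightarrow> q \<in> A \<times> B \<Longrightarrow>
      product_adjacent R Q p q \<longleftrightarrow> product_adjacent R' Q' (f p) (f q)"
begin

abbreviation "E \<equiv> product_adjacent R Q"
abbreviation "E' \<equiv> product_adjacent R' Q'"

lemma E_sym: "E p q \<Longrightarrow> E q p"
  using a.R_sym b.R_sym by (auto simp: product_adjacent_def)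

lemma direction: "E' p q \<Longrightarrow> (fst p = fst q) \<noteq> (snd p = snd q)"
  using c.R_irrefl d.R_irrefl by (auto simp: product_adjacent_def)

lemma f_mem: "p \<in> A \<times> B \<Longrightarrow> f p \<in> C \<times> D" using bij bij_betwE by blast

lemma f_inj: "p \<in> A \<times> B \<Longrightarrow> q \<in> A \<times> B \<Longrightarrow> f p = f q \<longleftrightarrow> p = q"
  using bij by (auto simp: bij_betw_def inj_on_eq_iff)

lemma f_surj: assumes "y \<in> C \<times> D" obtains p where "p \<in> A \<times> B" "f p = y"
proof -
  have "y \<in> f ` (A \<times> B)" using assms bij by (simp add: bij_betw_def)
  then show ?thesis using that by blast
qed

lemma same_direction:
  assumes X: "p \<in> A \<times> B" "q \<in> A \<times> B" "r \<in> A \<times> B" and e: "E q p" "E q r"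
  shows "(fst p = fst q \<longleftrightarrow> fst r = fst q) \<longleftrightarrow> (fst (f p) = fst (f q) \<longleftrightarrow> fst (f r) = fst (f q))"
proof -
  have ball: "(\<exists>u\<in>C \<times> D. P u) \<longleftrightarrow> (\<exists>u\<in>A \<times> B. P (f u))" for P
    using f_mem f_surj by metis
  have e': "E' (f q) (f p)" "E' (f q) (f r)" using e X edge_iff by blast+
  show ?thesis
    unfolding same_direction_iff[OF a.factor_graph_axioms b.factor_graph_axioms X e]
      same_direction_iff[OF c.factor_graph_axioms d.factor_graph_axioms f_mem[OF X(1)] f_mem[OF X(2)] f_mem[OF X(3)] e']
      ball
    using X by (simp only: f_inj edge_iff cong: bex_cong)
qed

text \<open>At a vertex \<open>q\<close> an isomorphism of products either keeps both directions or interchanges them.\<close>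

definition keeps :: "'a \<times> 'b \<Rightarrow> bool" where
  "keeps q \<longleftrightarrow> (\<forall>p\<in>A \<times> B. E q p \<longrightarrow> (fst p = fst q \<longleftrightarrow> fst (f p) = fst (f q)))"

definition swaps :: "'a \<times> 'b \<Rightarrow> bool" where
  "swaps q \<longleftrightarrow> (\<forall>p\<in>A \<times> B. E q p \<longrightarrow> (fst p = fst q \<longleftrightarrow> fst (f p) \<noteq> fst (f q)))"

lemma keeps_or_swaps:
  assumes q: "q \<in> A \<times> B" shows "keeps q \<or> swaps q"
proof -
  obtain y where "y \<in> A" "R (fst q) y" using a.neighbour q by (metis mem_Times_iff)
  then have p0: "(y, snd q) \<in> A \<times> B" "E q (y, snd q)" using q by (auto simp: product_adjacent_def)
  show ?thesis using same_direction[OF _ q p0(1) _ p0(2)] unfolding keeps_def swaps_def by blast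
qed

text \<open>The edge from \<open>q\<close> to \<open>q'\<close> and its image have the same direction, and at \<open>q'\<close> all other edges are compared
  with this one.\<close>

lemma keeps_step:
  assumes "keeps q" "q \<in> A \<times> B" "q' \<in> A \<times> B" "E q q'" shows "keeps q'"
proof -
  have "(fst q = fst q' \<longleftrightarrow> fst (f q) = fst (f q'))"
    using assms unfolding keeps_def by metis
  moreover have "E q' q" using assms E_sym by blast
  ultimately show ?thesis using same_direction[of _ q' q] assms(2,3) unfolding keeps_def by blast
qed

lemma keeps_all:
  assumes k: "keeps q" and q: "q \<in> A \<times> B" and p: "p \<in> A \<times> B" shows "keeps p"
proof -
  have 1: "keeps (x, snd q)" if "(\<lambda>x y. x \<in> A \<and> y \<in> A \<and> R x y)\<^sup>*\<^sup>* (fst q) x" for x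
    using that
  proof (induction rule: rtranclp_induct)
    case base then show ?case using k by simp
  next
    case (step y z)
    show ?case
      by (rule keeps_step[of "(y, snd q)"]) (use step q in \<open>auto simp: product_adjacent_def\<close>)
  qed
  have 2: "keeps (fst p, x)" if "(\<lambda>x y. x \<in> B \<and> y \<in> B \<and> Q x y)\<^sup>*\<^sup>* (snd q) x" for x
    using that
  proof (induction rule: rtranclp_induct)
    case base
    show ?case by (rule 1[OF a.connected]) (use p q in auto)
  next
    case (step y z)
    show ?case
      by (rule keeps_step[of "(fst p, y)"]) (use step p in \<open>auto simp: product_adjacent_def\<close>)
  qed
  have "keeps (fst p, snd p)" by (rule 2[OF b.connected]) (use p q in auto)
  then show ?thesis by simp
qed

lemma keeps_imp_product:
  assumes k: "\<And>q. q \<in> A \<times> B \<Longrightarrow> keeps q" and ne: "A \<noteq> {}" "B \<noteq> {}"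
  obtains f' f'' where "bij_betw f' A C" "bij_betw f'' B D"
    "\<And>x y. x \<in> A \<Longrightarrow> y \<in> A \<Longrightarrow> R x y \<longleftrightarrow> R' (f' x) (f' y)"
    "\<And>x y. x \<in> B \<Longrightarrow> y \<in> B \<Longrightarrow> Q x y \<longleftrightarrow> Q' (f'' x) (f'' y)"
    "\<And>x y. x \<in> A \<Longrightarrow> y \<in> B \<Longrightarrow> f (x, y) = (f' x, f'' y)"
proof -
  obtain a0 b0 where a0: "a0 \<in> A" and b0: "b0 \<in> B" using ne by auto
  have fst_const: "fst (f (x, y)) = fst (f (x, b0))"
    if x: "x \<in> A" and "(\<lambda>x y. x \<in> B \<and> y \<in> B \<and> Q x y)\<^sup>*\<^sup>* b0 y" for x y
    using that(2)
  proof (induction rule: rtranclp_induct)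
    case (step y z)
    have "fst (f (x, z)) = fst (f (x, y))"
      using k[of "(x, y)"] step x unfolding keeps_def by (auto simp: product_adjacent_def)
    then show ?case using step by simp
  qed simp
  have snd_const: "snd (f (x, y)) = snd (f (a0, y))"
    if y: "y \<in> B" and "(\<lambda>x y. x \<in> A \<and> y \<in> A \<and> R x y)\<^sup>*\<^sup>* a0 x" for x y
    using that(2)
  proof (induction rule: rtranclp_induct)
    case (step x z)
    have mem: "(x, y) \<in> A \<times> B" "(z, y) \<in> A \<times> B" using step y by auto
    have e: "E (x, y) (z, y)" using step by (simp add: product_adjacent_def)
    have "x \<noteq> z" using step a.R_irrefl by blast
    then have "fst (f (x, y)) \<noteq> fst (f (z, y))"
      using k[OF mem(1)] mem e unfolding keeps_def by fastforce
    then have "snd (f (z, y)) = snd (f (x, y))"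
      using direction[of "f (x, y)" "f (z, y)"] e edge_iff mem by auto
    then show ?case using step by simp
  qed simp
  define f' where "f' x = fst (f (x, b0))" for x
  define f'' where "f'' y = snd (f (a0, y))" for y
  have f: "f (x, y) = (f' x, f'' y)" if "x \<in> A" "y \<in> B" for x y
    unfolding f'_def f''_def
    using fst_const[OF that(1) b.connected[OF b0 that(2)]] snd_const[OF that(2) a.connected[OF a0 that(1)]]
    by (simp add: prod_eq_iff)
  have mem: "f' x \<in> C" "f'' y \<in> D" if "x \<in> A" "y \<in> B" for x y
    using f_mem[of "(x, y)"] f that by auto
  show ?thesis
  proof (rule that[of f' f''])
    show "bij_betw f' A C" unfolding bij_betw_def
    proof (intro conjI inj_onI equalityI subsetI)
      fix x y assume "x \<in> A" "y \<in> A" "f' x = f' y"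
      then show "x = y" using f_inj[of "(x, b0)" "(y, b0)"] f b0 by simp
    next
      fix c assume "c \<in> f' ` A" then show "c \<in> C" using mem b0 by auto
    next
      fix c assume "c \<in> C"
      then have "(c, f'' b0) \<in> C \<times> D" using mem a0 b0 by simp
      then obtain x y where "x \<in> A" "y \<in> B" "f (x, y) = (c, f'' b0)" by (metis f_surj mem_Sigma_iff surj_pair)
      then show "c \<in> f' ` A" using f by auto
    qed
    show "bij_betw f'' B D" unfolding bij_betw_def
    proof (intro conjI inj_onI equalityI subsetI)
      fix x y assume "x \<in> B" "y \<in> B" "f'' x = f'' y"
      then show "x = y" using f_inj[of "(a0, x)" "(a0, y)"] f a0 by simp
    next
      fix c assume "c \<in> f'' ` B" then show "c \<in> D" using mem a0 by auto
    next
      fix c assume "c \<in> D"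
      then have "(f' a0, c) \<in> C \<times> D" using mem a0 b0 by simp
      then obtain x y where "x \<in> A" "y \<in> B" "f (x, y) = (f' a0, c)" by (metis f_surj mem_Sigma_iff surj_pair)
      then show "c \<in> f'' ` B" using f by auto
    qed
    show "R x y \<longleftrightarrow> R' (f' x) (f' y)" if "x \<in> A" "y \<in> A" for x y
      using edge_iff[of "(x, b0)" "(y, b0)"] that b0 f b.R_irrefl d.R_irrefl
      by (auto simp: product_adjacent_def)
    show "Q x y \<longleftrightarrow> Q' (f'' x) (f'' y)" if "x \<in> B" "y \<in> B" for x y
      using edge_iff[of "(a0, x)" "(a0, y)"] that a0 f a.R_irrefl c.R_irrefl
      by (auto simp: product_adjacent_def)
    show "f (x, y) = (f' x, f'' y)" if "x \<in> A" "y \<in> B" for x y using f that .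
  qed
qed

end

text \<open>A map that interchanges the directions everywhere keeps them after its values have been swapped.\<close>

lemma product_isomorphism_cases:
  assumes "product_isomorphism A R B Q C R' D Q' f" and ne: "A \<noteq> {}" "B \<noteq> {}"
  shows "(\<exists>f' f''. bij_betw f' A C \<and> bij_betw f'' B D \<and>
      (\<forall>x\<in>A. \<forall>y\<in>A. R x y \<longleftrightarrow> R' (f' x) (f' y)) \<and> (\<forall>x\<in>B. \<forall>y\<in>B. Q x y \<longleftrightarrow> Q' (f'' x) (f'' y)) \<and>
      (\<forall>x\<in>A. \<forall>y\<in>B. f (x, y) = (f' x, f'' y))) \<or>
    (\<exists>g' g''. bij_betw g' A D \<and> bij_betw g'' B C \<and>
      (\<forall>x\<in>A. \<forall>y\<in>A. R x y \<longleftrightarrow> Q' (g' x) (g' y)) \<and> (\<forall>x\<in>B. \<forall>y\<in>B. Q x y \<longleftrightarrow> R' (g'' x) (g'' y)) \<and>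
      (\<forall>x\<in>A. \<forall>y\<in>B. f (x, y) = (g'' y, g' x)))"
proof -
  interpret product_isomorphism A R B Q C R' D Q' f by fact
  show ?thesis
  proof (cases "\<exists>q\<in>A \<times> B. keeps q")
    case True
    then have "\<And>q. q \<in> A \<times> B \<Longrightarrow> keeps q" using keeps_all by blast
    from keeps_imp_product[OF this ne] show ?thesis by (intro disjI1) metis
  next
    case False
    then have sw: "swaps q" if "q \<in> A \<times> B" for q using keeps_or_swaps that by blast
    interpret s: product_isomorphism A R B Q D Q' C R' "prod.swap \<circ> f"
    proof
      show "bij_betw (prod.swap \<circ> f) (A \<times> B) (D \<times> C)"
        by (rule bij_betw_trans[OF bij]) (auto simp: bij_betw_def inj_on_def image_iff)
      show "E p q \<longleftrightarrow> product_adjacent Q' R' ((prod.swap \<circ> f) p) ((prod.swap \<circ> f) q)"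
        if "p \<in> A \<times> B" "q \<in> A \<times> B" for p q
        using edge_iff[OF that] by (auto simp: product_adjacent_def)
    qed
    have "s.keeps q" if "q \<in> A \<times> B" for q unfolding s.keeps_def
    proof (intro ballI impI)
      fix p assume p: "p \<in> A \<times> B" "E q p"
      then have "fst p = fst q \<longleftrightarrow> fst (f p) \<noteq> fst (f q)" using sw[OF that] unfolding swaps_def by blast
      moreover have "(fst (f q) = fst (f p)) \<noteq> (snd (f q) = snd (f p))"
        using edge_iff[OF that p(1)] p(2) by (intro direction) simp
      ultimately show "fst p = fst q \<longleftrightarrow> fst ((prod.swap \<circ> f) p) = fst ((prod.swap \<circ> f) q)"
        by (metis comp_apply fst_swap)
    qed
    from s.keeps_imp_product[OF this ne]
    obtain g' g'' where "bij_betw g' A D" "bij_betw g'' B C"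
      "\<And>x y. x \<in> A \<Longrightarrow> y \<in> A \<Longrightarrow> R x y \<longleftrightarrow> Q' (g' x) (g' y)"
      "\<And>x y. x \<in> B \<Longrightarrow> y \<in> B \<Longrightarrow> Q x y \<longleftrightarrow> R' (g'' x) (g'' y)"
      and g: "\<And>x y. x \<in> A \<Longrightarrow> y \<in> B \<Longrightarrow> (prod.swap \<circ> f) (x, y) = (g' x, g'' y)" by blast
    moreover have "f (x, y) = (g'' y, g' x)" if "x \<in> A" "y \<in> B" for x y
      using g[OF that] by (cases "f (x, y)") auto
    ultimately show ?thesis by blast
  qed
qed

section \<open>The fundamental theorem of projective geometry\<close>

context left_vector_space
begin

definition line :: "'v \<Rightarrow> 'v set" where "line x = {scale c x | c. True}"

text \<open>Independence of two and of three vectors in terms of coefficients, for comparing coefficients in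
  the fundamental theorem.\<close>

definition ind2 :: "'v \<Rightarrow> 'v \<Rightarrow> bool" where
  "ind2 x y \<longleftrightarrow> (\<forall>p q. scale p x + scale q y = 0 \<longrightarrow> p = 0 \<and> q = 0)"

definition ind3 :: "'v \<Rightarrow> 'v \<Rightarrow> 'v \<Rightarrow> bool" where
  "ind3 x y z \<longleftrightarrow> (\<forall>p q r. scale p x + scale q y + scale r z = 0 \<longrightarrow> p = 0 \<and> q = 0 \<and> r = 0)"

lemma line_eq_adjoin: "line x = adjoin {0} x" by (auto simp: line_def adjoin_def)

lemma sub_line: "sub (line x)" unfolding line_eq_adjoin by (intro sub_adjoin sub_zero)

lemma line_mem: "x \<in> line x" unfolding line_eq_adjoin by (intro adjoin_mem sub_zero)

lemma line_scale_mem: "scale c x \<in> line x" by (auto simp: line_def)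

lemma line_subset: "sub S \<Longrightarrow> x \<in> S \<Longrightarrow> line x \<subseteq> S"
  by (auto simp: line_def sub_scale)

lemma line_adjoin_mem: "z \<in> adjoin (line x) y \<longleftrightarrow> (\<exists>p q. z = scale p x + scale q y)"
  by (auto simp: line_def adjoin_def)

lemma ind2_iff: "ind2 x y \<longleftrightarrow> x \<noteq> 0 \<and> y \<notin> line x"
proof
  assume i: "ind2 x y"
  have "x \<noteq> 0"
  proof
    assume "x = 0" then have "scale 1 x + scale 0 y = 0" by simp
    then show False using i unfolding ind2_def by (metis zero_neq_one)
  qed
  moreover have "y \<notin> line x"
  proof
    assume "y \<in> line x" then obtain c where "y = scale c x" by (auto simp: line_def)
    then have "scale c x + scale (- 1) y = 0" by (simp add: scale_minus_left)
    then show False using i unfolding ind2_def by (metis neg_equal_0_iff_equal zero_neq_one)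
  qed
  ultimately show "x \<noteq> 0 \<and> y \<notin> line x" by simp
next
  assume n: "x \<noteq> 0 \<and> y \<notin> line x"
  show "ind2 x y" unfolding ind2_def
  proof (intro allI impI)
    fix p q assume e: "scale p x + scale q y = 0"
    then have "scale q y = scale (- p) x" by (simp add: scale_minus_left eq_neg_iff_add_eq_0 add.commute)
    then have "scale q y \<in> line x" by (simp add: line_scale_mem)
    then have "q = 0" using n sub_scale_iff sub_line by blast
    then show "p = 0 \<and> q = 0" using e n by simp
  qed
qed

lemma ind3_iff: "ind3 x y z \<longleftrightarrow> ind2 x y \<and> z \<notin> adjoin (line x) y"
proof
  assume i: "ind3 x y z"
  have "ind2 x y" unfolding ind2_def
  proof (intro allI impI)
    fix p q assume "scale p x + scale q y = 0"
    then have "scale p x + scale q y + scale 0 z = 0" by simp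
    then show "p = 0 \<and> q = 0" using i unfolding ind3_def by blast
  qed
  moreover have "z \<notin> adjoin (line x) y"
  proof
    assume "z \<in> adjoin (line x) y" then obtain p q where "z = scale p x + scale q y" by (auto simp: line_adjoin_mem)
    then have "scale p x + scale q y + scale (- 1) z = 0" by (simp add: scale_minus_left)
    then show False using i unfolding ind3_def by (metis neg_equal_0_iff_equal zero_neq_one)
  qed
  ultimately show "ind2 x y \<and> z \<notin> adjoin (line x) y" by simp
next
  assume n: "ind2 x y \<and> z \<notin> adjoin (line x) y"
  show "ind3 x y z" unfolding ind3_def
  proof (intro allI impI)
    fix p q r assume e: "scale p x + scale q y + scale r z = 0"
    then have "scale r z + (scale p x + scale q y) = 0" by (simp add: add.commute)
    then have "scale r z = - (scale p x + scale q y)" by (simp only: eq_neg_iff_add_eq_0)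
    moreover have "scale p x + scale q y \<in> adjoin (line x) y" by (auto simp: line_adjoin_mem)
    ultimately have "scale r z \<in> adjoin (line x) y" using sub_minus sub_adjoin sub_line by metis
    then have "r = 0" using n sub_scale_iff sub_adjoin sub_line by blast
    then show "p = 0 \<and> q = 0 \<and> r = 0" using e n unfolding ind2_def by simp
  qed
qed

lemma ind3_eq:
  assumes "ind3 x y z" "scale p x + scale q y + scale r z = scale p' x + scale q' y + scale r' z"
  shows "p = p' \<and> q = q' \<and> r = r'"
proof -
  have "scale (p - p') x + scale (q - q') y + scale (r - r') z = 0"
    using assms(2) by (simp add: scale_left_diff algebra_simps)
  then show ?thesis using assms(1) unfolding ind3_def by (metis right_minus_eq)
qed

lemma ind3_swap: "ind3 x y z \<Longrightarrow> ind3 x z y"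
  unfolding ind3_def by (metis add.assoc add.commute)

end

context fin_space
begin

lemma line_G1: "x \<noteq> 0 \<Longrightarrow> line x \<in> G 1"
  using dim_adjoin[of "{0}" x] sub_zero dim_zero sub_line by (simp add: G_iff line_eq_adjoin)

lemma G1_eq_line: assumes "P \<in> G 1" "x \<in> P" "x \<noteq> 0" shows "P = line x"
  using G_eqI[OF line_G1[OF assms(3)] assms(1) line_subset] assms by (simp add: G_iff)

lemma G1_obtain: assumes "P \<in> G 1" obtains x where "x \<in> P" "x \<noteq> 0"
proof -
  have "P \<noteq> {0}" using assms dim_zero by (auto simp: G_iff)
  then show ?thesis using that assms sub_0[of P] by (auto simp: G_iff)
qed

lemma line_eq_iff: "x \<noteq> 0 \<Longrightarrow> y \<noteq> 0 \<Longrightarrow> line x = line y \<longleftrightarrow> y \<in> line x"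
  using G1_eq_line[OF line_G1, of x y] line_mem[of y] by auto

lemma ind2_adjoin_G2: "ind2 x y \<Longrightarrow> adjoin (line x) y \<in> G 2"
  using dim_adjoin[OF sub_line, of y x] line_G1[of x] sub_adjoin[OF sub_line] by (simp add: ind2_iff G_iff)

lemma G2_eq_adjoin: assumes "L \<in> G 2" "ind2 x y" "x \<in> L" "y \<in> L" shows "L = adjoin (line x) y"
  using G_eqI[OF ind2_adjoin_G2[OF assms(2)] assms(1)] adjoin_least[of "line x" L y] line_subset[of L x] assms
  by (simp add: G_iff)

lemma dim_adjoin_le: "sub S \<Longrightarrow> dim (adjoin S x) \<le> Suc (dim S)"
  by (cases "x \<in> S") (auto simp: dim_adjoin adjoin_absorb)

lemma dim_line_le: "dim (line x) \<le> 1"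
  using dim_adjoin_le[OF sub_zero, of x] dim_zero by (simp add: line_eq_adjoin)

lemma not_in_triple: assumes "4 \<le> n" obtains z where "z \<notin> adjoin (adjoin (line e) x) y"
proof -
  have "dim (adjoin (adjoin (line e) x) y) \<le> 3"
    using dim_adjoin_le[OF sub_adjoin[OF sub_line], of e x y] dim_adjoin_le[OF sub_line, of e x] dim_line_le[of e] by linarith
  then have "adjoin (adjoin (line e) x) y \<noteq> UNIV" using assms dim_UNIV by auto
  then show ?thesis using that by auto
qed

end

locale two_spaces = V: fin_space scale n + W: fin_space scale' n
  for scale :: "'k::division_ring \<Rightarrow> 'v::ab_group_add \<Rightarrow> 'v"
    and scale' :: "'l::division_ring \<Rightarrow> 'w::ab_group_add \<Rightarrow> 'w"
    and n :: nat

definition semilinear_between ::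
    "('k::division_ring \<Rightarrow> 'v::ab_group_add \<Rightarrow> 'v) \<Rightarrow> ('l::division_ring \<Rightarrow> 'w::ab_group_add \<Rightarrow> 'w) \<Rightarrow>
      ('k \<Rightarrow> 'l) \<Rightarrow> ('v \<Rightarrow> 'w) \<Rightarrow> bool" where
  "semilinear_between scale scale' \<sigma> l \<longleftrightarrow>
     bij \<sigma> \<and> (\<forall>a b. \<sigma> (a + b) = \<sigma> a + \<sigma> b) \<and> (\<forall>a b. \<sigma> (a * b) = \<sigma> a * \<sigma> b) \<and> \<sigma> 1 = 1 \<and>
     bij l \<and> (\<forall>x y. l (x + y) = l x + l y) \<and> (\<forall>a x. l (scale a x) = scale' (\<sigma> a) (l x))"

locale collineation = two_spaces +
  fixes a b
  assumes a_bij: "bij_betw a (V.G 1) (W.G 1)" and b_bij: "bij_betw b (V.G 2) (W.G 2)"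
    and inc: "P \<in> V.G 1 \<Longrightarrow> L \<in> V.G 2 \<Longrightarrow> P \<subseteq> L \<longleftrightarrow> a P \<subseteq> b L"
    and n4: "4 \<le> n"
begin

text \<open>\<open>rep x x'\<close> says that the vector \<open>x'\<close> spans the image of the line of \<open>x\<close>.\<close>

definition rep where "rep x x' \<longleftrightarrow> x \<noteq> 0 \<and> x' \<noteq> 0 \<and> x' \<in> a (V.line x)"

lemma a_G: "x \<noteq> 0 \<Longrightarrow> a (V.line x) \<in> W.G 1"
  using V.line_G1 a_bij bij_betwE by blast

lemma rep_exists: assumes "x \<noteq> 0" obtains x' where "rep x x'"
  using W.G1_obtain[OF a_G[OF assms]] assms unfolding rep_def by blast

lemma rep_line: "rep x x' \<Longrightarrow> a (V.line x) = W.line x'"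
  using W.G1_eq_line a_G unfolding rep_def by blast

lemma rep_rep: "rep x x' \<Longrightarrow> rep x y' \<longleftrightarrow> (\<exists>c. c \<noteq> 0 \<and> y' = scale' c x')"
  using rep_line[of x x'] by (auto simp: rep_def W.line_def)

lemma rep_eq: assumes "rep x x'" "rep y x'" shows "y \<in> V.line x"
proof -
  have "a (V.line x) = a (V.line y)" using rep_line assms by metis
  then have "V.line x = V.line y" using a_bij V.line_G1 assms unfolding rep_def by (meson bij_betw_def inj_onD)
  then show ?thesis using V.line_mem by blast
qed

lemma rep_surj: assumes "w \<noteq> 0" obtains x where "rep x w"
proof -
  obtain P where P: "P \<in> V.G 1" "a P = W.line w"
    using a_bij W.line_G1[OF assms] unfolding bij_betw_def by (metis imageE)
  obtain x where x: "x \<in> P" "x \<noteq> 0" using V.G1_obtain P by blast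
  then have "rep x w" using V.G1_eq_line[OF P(1)] P assms W.line_mem unfolding rep_def by metis
  then show ?thesis using that by blast
qed

lemma rep_ind2:
  assumes "V.ind2 x y" "rep x x'" "rep y y'" shows "W.ind2 x' y'"
proof -
  have "y' \<notin> W.line x'"
  proof
    assume "y' \<in> W.line x'"
    then have "rep x y'" using assms rep_line[OF assms(2)] by (simp add: rep_def)
    then show False using rep_eq assms V.ind2_iff by blast
  qed
  then show ?thesis using assms by (simp add: W.ind2_iff rep_def)
qed

lemma rep_plane:
  assumes i: "V.ind2 x y" and r: "rep x x'" "rep y y'" "rep z z'"
  shows "z \<in> V.adjoin (V.line x) y \<longleftrightarrow> z' \<in> W.adjoin (W.line x') y'"
proof -
  let ?L = "V.adjoin (V.line x) y"
  have L: "?L \<in> V.G 2" using V.ind2_adjoin_G2[OF i] .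
  have bL: "b ?L \<in> W.G 2" using L b_bij bij_betwE by blast
  have sL: "V.sub ?L" "W.sub (b ?L)" using L bL V.G_iff W.G_iff by auto
  have *: "u \<in> ?L \<longleftrightarrow> u' \<in> b ?L" if "rep u u'" for u u'
  proof -
    have u: "V.line u \<in> V.G 1" using that V.line_G1 by (simp add: rep_def)
    have "u \<in> ?L \<longleftrightarrow> V.line u \<subseteq> ?L" using V.line_mem V.line_subset sL by blast
    also have "\<dots> \<longleftrightarrow> W.line u' \<subseteq> b ?L" using inc[OF u L] rep_line[OF that] by simp
    also have "\<dots> \<longleftrightarrow> u' \<in> b ?L" using W.line_mem W.line_subset sL by blast
    finally show ?thesis .
  qed
  have "x \<in> ?L" "y \<in> ?L" using V.adjoin_superset[of "V.line x" y] V.line_mem V.adjoin_mem[OF V.sub_line] by auto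
  then have "x' \<in> b ?L" "y' \<in> b ?L" using * r by auto
  then have "b ?L = W.adjoin (W.line x') y'" using W.G2_eq_adjoin[OF bL rep_ind2[OF i r(1,2)]] by blast
  then show ?thesis using *[OF r(3)] by simp
qed

lemma rep_comb:
  assumes "V.ind2 x y" "rep x x'" "rep y y'" "rep z z'" "z = scale p x + scale q y"
  obtains c e where "z' = scale' c x' + scale' e y'"
proof -
  have "z \<in> V.adjoin (V.line x) y" unfolding V.line_adjoin_mem using assms(5) by blast
  then show ?thesis using rep_plane[OF assms(1-4)] that by (auto simp: W.line_adjoin_mem)
qed

lemma rep_ind3:
  assumes "V.ind3 x y z" "rep x x'" "rep y y'" "rep z z'" shows "W.ind3 x' y' z'"
  using rep_plane[of x y x' y' z z'] rep_ind2[of x y x' y'] assms by (simp add: V.ind3_iff W.ind3_iff)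

end

text \<open>Fixing the image \<open>e'\<close> of one vector \<open>e\<close> normalises representatives: \<open>l x\<close> is the vector on the image
  of the line of \<open>x\<close> for which \<open>l x + e'\<close> lies on the image of the line of \<open>x + e\<close>.\<close>

locale based_collineation = collineation +
  fixes e e'
  assumes e: "rep e e'"
begin

lemma e0: "e \<noteq> 0" "e' \<noteq> 0" using e by (auto simp: rep_def)

lemma l_ex1: assumes "x \<notin> V.line e" shows "\<exists>!x'. rep x x' \<and> rep (x + e) (x' + e')"
proof -
  have i: "V.ind2 x e"
    using assms V.line_eq_iff[of x e] V.line_eq_iff[of e x] V.line_scale_mem[of 0 e] e0 by (auto simp: V.ind2_iff)
  have x0: "x \<noteq> 0" using i V.ind2_iff by blast
  have xe0: "x + e \<noteq> 0" using i unfolding V.ind2_def by (metis V.scale_one' zero_neq_one)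
  obtain u where u: "rep x u" using rep_exists[OF x0] .
  obtain w where w: "rep (x + e) w" using rep_exists[OF xe0] .
  have iu: "W.ind2 u e'" using rep_ind2[OF i u e] .
  have "x + e = scale 1 x + scale 1 e" by simp
  then obtain c q where wc: "w = scale' c u + scale' q e'" using rep_comb[OF i u e w] by blast
  have nx: "x + e \<notin> V.line x"
    using i V.sub_add_iff[OF V.sub_line V.line_mem] V.ind2_iff by blast
  have ne: "x + e \<notin> V.line e"
    using assms V.sub_add_iff[OF V.sub_line V.line_mem, of e x] by (simp add: add.commute)
  have q: "q \<noteq> 0"
  proof
    assume "q = 0"
    then have "w = scale' c u" using wc by simp
    then have "rep x w" using w rep_line[OF u] x0 by (auto simp: rep_def W.line_scale_mem)
    then show False using nx rep_eq w by blast
  qed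
  have c: "c \<noteq> 0"
  proof
    assume "c = 0"
    then have "w = scale' q e'" using wc by simp
    then have "rep e w" using w rep_line[OF e] e0 by (auto simp: rep_def W.line_scale_mem)
    then show False using ne rep_eq w by blast
  qed
  show ?thesis
  proof (rule ex1I)
    have "rep x (scale' (inverse q * c) u)"
      unfolding rep_rep[OF u] using c q by (intro exI[of _ "inverse q * c"]) simp
    moreover have "scale' (inverse q) w = scale' (inverse q * c) u + e'"
      unfolding wc W.scale_right_distrib using q by simp
    then have "rep (x + e) (scale' (inverse q * c) u + e')" using rep_rep[OF w] q by (metis inverse_nonzero_iff_nonzero)
    ultimately show "rep x (scale' (inverse q * c) u) \<and> rep (x + e) (scale' (inverse q * c) u + e')" ..
  next
    fix x' assume x': "rep x x' \<and> rep (x + e) (x' + e')"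
    then obtain s t where s: "x' = scale' s u" and t: "x' + e' = scale' t w" using rep_rep u w by metis
    have "scale' s u + e' = scale' t (scale' c u + scale' q e')" using s t wc by simp
    then have "scale' (s - t * c) u + scale' (1 - t * q) e' = 0"
      by (simp add: W.scale_left_diff W.scale_right_distrib algebra_simps)
    then have "s - t * c = 0 \<and> 1 - t * q = 0" using iu unfolding W.ind2_def by blast
    then have "s = t * c" "t * q = 1" by auto
    then have "t = inverse q" using q by (metis mult.assoc mult_1_left mult_1_right right_inverse)
    then show "x' = scale' (inverse q * c) u" using s \<open>s = t * c\<close> by simp
  qed
qed

definition l where "l x = (THE x'. rep x x' \<and> rep (x + e) (x' + e'))"

lemma l_rep: "x \<notin> V.line e \<Longrightarrow> rep x (l x)" "x \<notin> V.line e \<Longrightarrow> rep (x + e) (l x + e')"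
  using theI'[OF l_ex1] unfolding l_def by auto

lemma l_eqI: "x \<notin> V.line e \<Longrightarrow> rep x x' \<Longrightarrow> rep (x + e) (x' + e') \<Longrightarrow> l x = x'"
  using l_ex1 l_rep by blast

text \<open>Each of the lines of \<open>x + y + e\<close> and \<open>x + y\<close> is the intersection of two lines through points with
  known images. So the images are spanned by \<open>l x + l y + e'\<close> and \<open>l x + l y\<close>.\<close>

lemma l_add:
  assumes i: "V.ind3 e x y" shows "l (x + y) = l x + l y"
proof -
  have i2: "V.ind2 (x + e) y" "V.ind2 (y + e) x" "V.ind2 (x + y + e) e" "V.ind2 x y"
    unfolding V.ind2_def
  proof (goal_cases)
    case 1
    show ?case
    proof (intro allI impI)
      fix p q assume "scale p (x + e) + scale q y = 0"
      then have "scale p e + scale p x + scale q y = 0" by (simp add: V.scale_right_distrib algebra_simps)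
      then show "p = 0 \<and> q = 0" using i unfolding V.ind3_def by blast
    qed
  next
    case 2
    show ?case
    proof (intro allI impI)
      fix p q assume "scale p (y + e) + scale q x = 0"
      then have "scale p e + scale q x + scale p y = 0" by (simp add: V.scale_right_distrib algebra_simps)
      then show "p = 0 \<and> q = 0" using i unfolding V.ind3_def by blast
    qed
  next
    case 3
    show ?case
    proof (intro allI impI)
      fix p q assume "scale p (x + y + e) + scale q e = 0"
      then have "scale (p + q) e + scale p x + scale p y = 0"
        by (simp add: V.scale_right_distrib V.scale_left_distrib algebra_simps)
      then show "p = 0 \<and> q = 0" using i unfolding V.ind3_def by (metis add.left_neutral)
    qed
  next
    case 4
    show ?case
    proof (intro allI impI)
      fix p q assume "scale p x + scale q y = 0"
      then have "scale 0 e + scale p x + scale q y = 0" by simp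
      then show "p = 0 \<and> q = 0" using i unfolding V.ind3_def by blast
    qed
  qed
  have xe: "x \<notin> V.line e" and ye: "y \<notin> V.line e"
    using i V.ind3_swap[OF i] by (auto simp: V.ind3_iff V.ind2_iff)
  have xye: "x + y \<notin> V.line e"
  proof
    assume "x + y \<in> V.line e"
    then obtain c where c: "scale c e = x + y" by (auto simp: V.line_def)
    have "scale (- c) e + scale 1 x + scale 1 y = 0"
      by (simp add: V.scale_minus_left c algebra_simps)
    then show False using i unfolding V.ind3_def by (metis zero_neq_one)
  qed
  have nz: "x + y + e \<noteq> 0" "x + y \<noteq> 0"
    using xye V.sub_0[OF V.sub_line] V.sub_minus[OF V.sub_line V.line_mem[of e]] by (auto simp: eq_neg_iff_add_eq_0[symmetric])
  let ?x = "l x" and ?y = "l y"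
  have I: "W.ind3 e' ?x ?y" using rep_ind3[OF i e] l_rep xe ye by blast
  \<comment> \<open>the line of \<open>x + y + e\<close> is the intersection of two lines\<close>
  obtain w where w: "rep (x + y + e) w" using rep_exists[OF nz(1)] .
  have "x + y + e = scale 1 (x + e) + scale 1 y" by (simp add: algebra_simps)
  then obtain p q where 1: "w = scale' p (?x + e') + scale' q ?y"
    using rep_comb[OF i2(1) l_rep(2)[OF xe] l_rep(1)[OF ye] w] by blast
  have "x + y + e = scale 1 (y + e) + scale 1 x" by (simp add: algebra_simps)
  then obtain r s where 2: "w = scale' r (?y + e') + scale' s ?x"
    using rep_comb[OF i2(2) l_rep(2)[OF ye] l_rep(1)[OF xe] w] by blast
  have "scale' p e' + scale' p ?x + scale' q ?y = scale' r e' + scale' s ?x + scale' r ?y"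
    using 1 2 by (simp add: W.scale_right_distrib algebra_simps)
  from W.ind3_eq[OF I this] have pq: "p = r" "q = r" by auto
  have wp: "w = scale' p (?x + ?y + e')" using 1 pq by (simp add: W.scale_right_distrib algebra_simps)
  have p0: "p \<noteq> 0" using w wp by (auto simp: rep_def)
  have r1: "rep (x + y + e) (?x + ?y + e')"
    using rep_rep[OF w, of "?x + ?y + e'"] wp p0 W.scale_inverse[OF p0] by (metis inverse_nonzero_iff_nonzero)
  \<comment> \<open>and so is the line of \<open>x + y\<close>\<close>
  obtain v where v: "rep (x + y) v" using rep_exists[OF nz(2)] .
  have "x + y = scale 1 x + scale 1 y" by simp
  then obtain p q where 3: "v = scale' p ?x + scale' q ?y"
    using rep_comb[OF i2(4) l_rep(1)[OF xe] l_rep(1)[OF ye] v] by blast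
  have "x + y = scale 1 (x + y + e) + scale (- 1) e" by (simp add: V.scale_minus_left)
  then obtain r s where 4: "v = scale' r (?x + ?y + e') + scale' s e'"
    using rep_comb[OF i2(3) r1 e v] by blast
  have "scale' 0 e' + scale' p ?x + scale' q ?y = scale' (r + s) e' + scale' r ?x + scale' r ?y"
    using 3 4 by (simp add: W.scale_right_distrib W.scale_left_distrib algebra_simps)
  from W.ind3_eq[OF I this] have "p = r" "q = r" by auto
  then have vp: "v = scale' p (?x + ?y)" using 3 by (simp add: W.scale_right_distrib)
  have p0: "p \<noteq> 0" using v vp by (auto simp: rep_def)
  have "rep (x + y) (?x + ?y)"
    using rep_rep[OF v, of "?x + ?y"] vp p0 W.scale_inverse[OF p0] by (metis inverse_nonzero_iff_nonzero)
  then show ?thesis using l_eqI[OF xye] r1 by blast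
qed

text \<open>\<open>l\<close> is only defined off the line of \<open>e\<close>. The difference \<open>l (x + z) - l z\<close> does not depend on \<open>z\<close>
  and extends it to an additive map.\<close>

lemma difference_step:
  assumes z: "z \<notin> V.adjoin (V.line e) x" and t: "t \<notin> V.adjoin (V.adjoin (V.line e) x) z"
  shows "l (x + z) - l z = l (x + t) - l t"
proof -
  let ?P = "V.adjoin (V.line e) x" and ?H = "V.adjoin (V.adjoin (V.line e) x) z"
  have sP: "V.sub ?P" and sH: "V.sub ?H" using V.sub_adjoin V.sub_line by blast+
  have eP: "V.line e \<subseteq> ?P" "x \<in> ?P" using V.adjoin_superset V.adjoin_mem[OF V.sub_line] by blast+
  have PH: "?P \<subseteq> ?H" "z \<in> ?H" using V.adjoin_superset V.adjoin_mem[OF sP] by blast+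
  have "z \<notin> V.line e" using z eP by blast
  have xz: "x + z \<notin> V.line e" using z V.sub_add_iff[OF sP eP(2), of z] eP by blast
  have H1: "V.adjoin (V.line e) (x + z) \<subseteq> ?H"
    using eP PH sH by (intro V.adjoin_least V.sub_add) auto
  have H2: "V.adjoin (V.line e) z \<subseteq> ?H" using eP PH sH by (intro V.adjoin_least) auto
  have "V.ind3 e (x + z) t" using xz H1 t e0 by (auto simp: V.ind3_iff V.ind2_iff)
  then have 1: "l (x + z + t) = l (x + z) + l t" by (rule l_add)
  have "x + t \<notin> V.adjoin (V.line e) z"
    using t H2 V.sub_add_iff[OF sH, of x t] eP PH by blast
  then have "V.ind3 e z (x + t)" using \<open>z \<notin> V.line e\<close> e0 by (auto simp: V.ind3_iff V.ind2_iff)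
  then have "l (z + (x + t)) = l z + l (x + t)" by (rule l_add)
  then have "l (x + z) + l t = l z + l (x + t)" using 1 by (simp add: algebra_simps)
  then show ?thesis by (simp add: algebra_simps)
qed

lemma difference_unique:
  assumes z: "z \<notin> V.adjoin (V.line e) x" and w: "w \<notin> V.adjoin (V.line e) x"
  shows "l (x + z) - l z = l (x + w) - l w"
proof (cases "w \<in> V.adjoin (V.adjoin (V.line e) x) z")
  case False
  then show ?thesis using difference_step z by blast
next
  case True
  obtain t where t: "t \<notin> V.adjoin (V.adjoin (V.line e) x) z" using V.not_in_triple[OF n4] .
  have "V.adjoin (V.adjoin (V.line e) x) w \<subseteq> V.adjoin (V.adjoin (V.line e) x) z"
    by (rule V.adjoin_least[OF V.adjoin_superset True V.sub_adjoin[OF V.sub_adjoin[OF V.sub_line]]])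
  then have "t \<notin> V.adjoin (V.adjoin (V.line e) x) w" using t by blast
  then show ?thesis using difference_step[OF z t] difference_step[OF w] by simp
qed

definition L where "L x = l (x + (SOME z. z \<notin> V.adjoin (V.line e) x)) - l (SOME z. z \<notin> V.adjoin (V.line e) x)"

lemma not_in_pair: obtains z where "z \<notin> V.adjoin (V.line e) x"
proof -
  obtain z where "z \<notin> V.adjoin (V.adjoin (V.line e) x) x" using V.not_in_triple[OF n4] .
  then show ?thesis using that V.adjoin_superset[of "V.adjoin (V.line e) x" x] by blast
qed

lemma L_eq: "z \<notin> V.adjoin (V.line e) x \<Longrightarrow> L x = l (x + z) - l z"
proof -
  assume z: "z \<notin> V.adjoin (V.line e) x"
  then have "(SOME z. z \<notin> V.adjoin (V.line e) x) \<notin> V.adjoin (V.line e) x" by (rule someI)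
  then show "L x = l (x + z) - l z" unfolding L_def using z by (rule difference_unique)
qed

lemma L_add: "L (x + y) = L x + L y"
proof -
  let ?H = "V.adjoin (V.adjoin (V.line e) x) y"
  obtain z where z: "z \<notin> ?H" using V.not_in_triple[OF n4] .
  have s: "V.sub (V.adjoin (V.line e) x)" "V.sub ?H" using V.sub_adjoin V.sub_line by blast+
  have m: "V.line e \<subseteq> ?H" "x \<in> ?H" "y \<in> ?H" "V.adjoin (V.line e) x \<subseteq> ?H"
    using V.adjoin_superset V.adjoin_mem[OF V.sub_line] V.adjoin_mem[OF s(1)] by blast+
  have 1: "V.adjoin (V.line e) (x + y) \<subseteq> ?H" using m s by (intro V.adjoin_least V.sub_add) auto
  have 2: "V.adjoin (V.line e) y \<subseteq> ?H" using m s by (intro V.adjoin_least) auto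
  have 3: "y + z \<notin> V.adjoin (V.line e) x" using z m V.sub_add_iff[OF s(2) m(3), of z] by blast
  have "L (x + y) = l (x + y + z) - l z" using z 1 by (intro L_eq) blast
  moreover have "L x = l (x + (y + z)) - l (y + z)" using 3 by (intro L_eq)
  moreover have "L y = l (y + z) - l z" using z 2 by (intro L_eq) blast
  ultimately show ?thesis by (simp add: add.assoc)
qed

lemma L_nonzero: assumes "x \<noteq> 0" shows "L x \<noteq> 0"
proof
  assume 0: "L x = 0"
  obtain z where z: "z \<notin> V.adjoin (V.line e) x" using not_in_pair .
  have sP: "V.sub (V.adjoin (V.line e) x)" using V.sub_adjoin V.sub_line by blast
  have eP: "V.line e \<subseteq> V.adjoin (V.line e) x" "x \<in> V.adjoin (V.line e) x"
    using V.adjoin_superset V.adjoin_mem[OF V.sub_line] by blast+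
  have "z \<notin> V.line e" "x + z \<notin> V.line e" using z eP V.sub_add_iff[OF sP eP(2), of z] by blast+
  moreover have "l (x + z) = l z" using L_eq[OF z] 0 by simp
  ultimately have "x + z \<in> V.line z" using l_rep(1)[of z] l_rep(1)[of "x + z"] rep_eq by metis
  then have "x \<in> V.line z" using V.sub_add_iff[OF V.sub_line V.line_mem, of z x] by (simp add: add.commute)
  moreover have "z \<noteq> 0" using z V.sub_0[OF sP] by auto
  ultimately have "z \<in> V.line x" using assms V.line_eq_iff[of x z] V.line_eq_iff[of z x] by simp
  then show False using z V.line_subset[OF sP eP(2)] by blast
qed

lemma L_rep: assumes "x \<noteq> 0" shows "rep x (L x)"
proof (cases "x \<in> V.line e")
  case False
  obtain z where z: "z \<notin> V.adjoin (V.line e) x" using not_in_pair .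
  have "V.ind3 e x z" using z False e0 by (auto simp: V.ind3_iff V.ind2_iff)
  then have "L x = l x" using L_eq[OF z] l_add by simp
  then show ?thesis using l_rep False by simp
next
  case True
  have ex: "V.adjoin (V.line e) x = V.line e" using True V.adjoin_absorb V.sub_line by blast
  obtain z where z: "z \<notin> V.line e" using not_in_pair[of x] ex by auto
  obtain t where t: "t \<notin> V.adjoin (V.line e) z" using not_in_pair .
  have te: "t \<notin> V.line e" using t V.adjoin_superset by blast
  obtain c where c: "x = scale c e" using True by (auto simp: V.line_def)
  \<comment> \<open>\<open>L x\<close> lies in the plane of \<open>e'\<close> and \<open>l u\<close> for every \<open>u\<close> off the line of \<open>e\<close>\<close>
  have plane: "\<exists>p q. L x = scale' p e' + scale' q (l u)" if u: "u \<notin> V.line e" for u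
  proof -
    have "x + u \<notin> V.line e" using u V.sub_add_iff[OF V.sub_line True] by blast
    then have "rep (x + u) (l (x + u))" by (rule l_rep)
    moreover have "x + u = scale c e + scale 1 u" using c by simp
    moreover have "V.ind2 e u" using u e0 by (simp add: V.ind2_iff)
    ultimately obtain p q where "l (x + u) = scale' p e' + scale' q (l u)"
      using rep_comb[OF _ e l_rep(1)[OF u]] by blast
    then have "L x = scale' p e' + scale' (q - 1) (l u)"
      using L_eq[of u x] u ex by (simp add: W.scale_left_diff)
    then show ?thesis by blast
  qed
  obtain p q where 1: "L x = scale' p e' + scale' q (l z)" using plane[OF z] by blast
  obtain r s where 2: "L x = scale' r e' + scale' s (l t)" using plane[OF te] by blast
  have "V.ind3 e z t" using z t e0 by (auto simp: V.ind3_iff V.ind2_iff)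
  then have "W.ind3 e' (l z) (l t)" using rep_ind3 e l_rep(1)[OF z] l_rep(1)[OF te] by blast
  moreover have "scale' p e' + scale' q (l z) + scale' 0 (l t) = scale' r e' + scale' 0 (l z) + scale' s (l t)"
    using 1 2 by simp
  ultimately have "q = 0" using W.ind3_eq by blast
  then have "L x \<in> W.line e'" using 1 by (simp add: W.line_scale_mem)
  also have "W.line e' = a (V.line x)" using rep_line[OF e] V.line_eq_iff[OF e0(1) assms] True by simp
  finally show ?thesis using L_nonzero[OF assms] assms by (simp add: rep_def)
qed

lemma L_zero [simp]: "L 0 = 0" using L_add[of 0 0] by simp

lemma L_diff: "L (x - y) = L x - L y" using L_add[of "x - y" y] by (simp add: algebra_simps)

lemma L_inj: "L x = L y \<Longrightarrow> x = y" using L_nonzero[of "x - y"] L_diff by auto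

text \<open>The factor by which \<open>L\<close> transforms a scalar \<open>c\<close> is the same at all vectors: for independent \<open>x\<close> and \<open>y\<close> by
  looking at \<open>x + y\<close>, and in general by comparison with a third vector.\<close>

lemma L_scale_ex: "\<exists>c'. L (scale c x) = scale' c' (L x)"
proof (cases "x = 0 \<or> c = 0")
  case True then show ?thesis by (auto intro: exI[of _ 0])
next
  case False
  then have "rep (scale c x) (L (scale c x))" by (intro L_rep) auto
  moreover have "V.line (scale c x) = V.line x"
    using False V.line_eq_iff[of x "scale c x"] V.line_scale_mem by auto
  ultimately have "L (scale c x) \<in> W.line (L x)" using rep_line[OF L_rep] False by (metis rep_def)
  then show ?thesis by (auto simp: W.line_def)
qed

lemma L_ind2: "V.ind2 x y \<Longrightarrow> W.ind2 (L x) (L y)"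
  using rep_ind2 L_rep V.ind2_iff V.sub_0[OF V.sub_line] by metis

lemma scalar_agrees_ind2:
  assumes "V.ind2 x y" "L (scale c x) = scale' p (L x)" "L (scale c y) = scale' q (L y)"
  shows "p = q"
proof -
  obtain r where "L (scale c (x + y)) = scale' r (L (x + y))" using L_scale_ex by blast
  then have "scale' p (L x) + scale' q (L y) = scale' r (L x) + scale' r (L y)"
    using assms by (simp add: V.scale_right_distrib L_add W.scale_right_distrib)
  then have "scale' (p - r) (L x) + scale' (q - r) (L y) = 0"
    by (simp add: W.scale_left_diff algebra_simps)
  then have "p - r = 0 \<and> q - r = 0" using L_ind2[OF assms(1)] unfolding W.ind2_def by blast
  then show ?thesis by auto
qed

lemma scalar_agrees:
  assumes "x \<noteq> 0" "y \<noteq> 0" "L (scale c x) = scale' p (L x)" "L (scale c y) = scale' q (L y)"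
  shows "p = q"
proof -
  obtain z where "z \<notin> V.adjoin (V.adjoin (V.line x) y) y" using V.not_in_triple[OF n4] .
  then have z: "z \<notin> V.adjoin (V.line x) y" using V.adjoin_superset[of "V.adjoin (V.line x) y" y] by blast
  obtain r where r: "L (scale c z) = scale' r (L z)" using L_scale_ex by blast
  have "z \<notin> V.line x" using z V.adjoin_superset by blast
  then have "V.ind2 x z" using assms by (simp add: V.ind2_iff)
  moreover have "V.line y \<subseteq> V.adjoin (V.line x) y"
    using V.adjoin_mem[OF V.sub_line] V.sub_adjoin V.sub_line by (intro V.line_subset) auto
  then have "V.ind2 y z" using assms z by (auto simp: V.ind2_iff)
  ultimately show ?thesis using scalar_agrees_ind2 assms r by metis
qed

definition \<sigma> where "\<sigma> c = (SOME c'. L (scale c e) = scale' c' (L e))"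

lemma L_scale: "L (scale c x) = scale' (\<sigma> c) (L x)"
proof (cases "x = 0")
  case False
  obtain p where p: "L (scale c x) = scale' p (L x)" using L_scale_ex by blast
  have "L (scale c e) = scale' (\<sigma> c) (L e)" unfolding \<sigma>_def using L_scale_ex by (rule someI_ex)
  then show ?thesis using scalar_agrees[OF False e0(1) p] p by simp
qed simp

lemma \<sigma>_eqI: "L (scale c e) = scale' c' (L e) \<Longrightarrow> \<sigma> c = c'"
  using L_scale[of c e] W.scale_eq_imp_eq[OF L_nonzero[OF e0(1)]] by simp

text \<open>The image line of \<open>p e + q y\<close> is spanned by \<open>\<sigma> p (L e) + \<sigma> q (L y)\<close>. As every line of the image plane is
  hit, every scalar is of the form \<open>c * \<sigma> p\<close> with \<open>c * \<sigma> q = 1\<close>, hence a value of \<open>\<sigma>\<close>.\<close>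

lemma \<sigma>_surj: "\<exists>c. \<sigma> c = r"
proof -
  obtain y where "y \<notin> V.adjoin (V.line e) e" using not_in_pair .
  then have y: "y \<notin> V.line e" using V.adjoin_superset[of "V.line e" e] by blast
  have i: "V.ind2 e y" using y e0 by (simp add: V.ind2_iff)
  have y0: "y \<noteq> 0" using y V.sub_0[OF V.sub_line] by auto
  have I: "W.ind2 (L e) (L y)" using L_ind2[OF i] .
  let ?w = "scale' r (L e) + scale' 1 (L y)"
  have "?w \<noteq> 0" using I unfolding W.ind2_def by (metis zero_neq_one)
  then obtain z where z: "rep z ?w" using rep_surj by blast
  have "?w \<in> W.adjoin (W.line (L e)) (L y)" unfolding W.line_adjoin_mem by blast
  then have "z \<in> V.adjoin (V.line e) y" using rep_plane[OF i L_rep[OF e0(1)] L_rep[OF y0] z] by blast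
  then obtain p q where pq: "z = scale p e + scale q y" by (auto simp: V.line_adjoin_mem)
  have "z \<noteq> 0" using z rep_def by blast
  then obtain c where c: "c \<noteq> 0" "?w = scale' c (L z)" using rep_rep[OF L_rep] z by metis
  then have "?w = scale' (c * \<sigma> p) (L e) + scale' (c * \<sigma> q) (L y)"
    unfolding pq L_add L_scale by (simp add: W.scale_right_distrib)
  then have "scale' (r - c * \<sigma> p) (L e) + scale' (1 - c * \<sigma> q) (L y) = 0"
    by (simp add: W.scale_left_diff algebra_simps)
  then have "r - c * \<sigma> p = 0 \<and> 1 - c * \<sigma> q = 0" using I unfolding W.ind2_def by blast
  then have rc: "r = c * \<sigma> p" "c * \<sigma> q = 1" by auto
  have mult: "\<sigma> (s * t) = \<sigma> s * \<sigma> t" for s t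
    by (rule \<sigma>_eqI) (metis L_scale V.scale_scale' W.scale_scale')
  have one: "\<sigma> 1 = 1" by (rule \<sigma>_eqI) simp
  have "q \<noteq> 0"
  proof
    assume "q = 0"
    moreover have "\<sigma> 0 = 0" by (rule \<sigma>_eqI) simp
    ultimately show False using rc by simp
  qed
  then have "\<sigma> q * \<sigma> (inverse q) = 1" using mult one by (metis right_inverse)
  then have "c = \<sigma> (inverse q)" using rc(2) by (metis mult.assoc mult_1_left mult_1_right)
  then show ?thesis using rc(1) mult by metis
qed

lemma semilinear_L: "semilinear_between scale scale' \<sigma> L"
  unfolding semilinear_between_def
proof (intro conjI allI)
  show "\<sigma> (s + t) = \<sigma> s + \<sigma> t" for s t
    by (rule \<sigma>_eqI) (simp add: L_scale V.scale_left_distrib W.scale_left_distrib L_add)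
  show "\<sigma> (s * t) = \<sigma> s * \<sigma> t" for s t
    by (rule \<sigma>_eqI) (metis L_scale V.scale_scale' W.scale_scale')
  show "\<sigma> 1 = 1" by (rule \<sigma>_eqI) simp
  show "bij \<sigma>"
  proof (rule bijI)
    show "surj \<sigma>" using \<sigma>_surj by (metis surjI)
    show "inj \<sigma>"
    proof (rule injI)
      fix s t assume "\<sigma> s = \<sigma> t"
      then have "L (scale s e) = L (scale t e)" by (simp add: L_scale)
      then show "s = t" using L_inj V.scale_eq_imp_eq e0 by blast
    qed
  qed
  show "bij L"
  proof (rule bijI)
    show "inj L" using L_inj by (rule injI)
    show "surj L" unfolding surj_def
    proof
      fix w
      show "\<exists>x. w = L x"
      proof (cases "w = 0")
        case False
        then obtain x where x: "rep x w" using rep_surj by blast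
        then have "x \<noteq> 0" by (simp add: rep_def)
        then obtain c where "w = scale' c (L x)" using rep_rep[OF L_rep] x by blast
        moreover obtain c' where "\<sigma> c' = c" using \<sigma>_surj by blast
        ultimately have "w = L (scale c' x)" by (simp add: L_scale)
        then show ?thesis by blast
      qed (auto intro: exI[of _ 0])
    qed
  qed
qed (simp_all add: L_add L_scale)

end

theorem (in collineation) fundamental_theorem:
  obtains \<sigma> l where "semilinear_between scale scale' \<sigma> l" "\<And>P. P \<in> V.G 1 \<Longrightarrow> l ` P \<subseteq> a P"
proof -
  obtain P where P: "P \<in> V.G 1" by (rule V.sub_G_exists[of 1]) (use n4 in auto)
  obtain e where e: "e \<in> P" "e \<noteq> 0" using V.G1_obtain[OF P] .
  obtain e' where "rep e e'" using rep_exists[OF e(2)] .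
  then interpret B: based_collineation scale scale' n a b e e' by unfold_locales
  show ?thesis
  proof (rule that[OF B.semilinear_L])
    fix P assume P: "P \<in> V.G 1"
    show "B.L ` P \<subseteq> a P"
    proof
      fix w assume "w \<in> B.L ` P"
      then obtain x where x: "x \<in> P" "w = B.L x" by auto
      have aP: "a P \<in> W.G 1" using P a_bij bij_betwE by blast
      show "w \<in> a P"
      proof (cases "x = 0")
        case True then show ?thesis using x aP W.sub_0 by (simp add: W.G_iff)
      next
        case False
        then show ?thesis using B.L_rep[OF False] V.G1_eq_line[OF P x(1)] x by (simp add: rep_def)
      qed
    qed
  qed
qed

section \<open>Chow's theorem\<close>

context fin_space
begin

lemma not_sub_exists: assumes "sub S" "dim S < n" obtains x where "x \<notin> S"
proof -
  have "S \<noteq> UNIV" using assms dim_UNIV by auto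
  then show ?thesis using that by blast
qed

lemma adjoin_G: "S \<in> G m \<Longrightarrow> x \<notin> S \<Longrightarrow> adjoin S x \<in> G (Suc m)"
  using dim_adjoin[of S x] sub_adjoin by (simp add: G_iff)

lemma adjoin_star: "S \<in> G m \<Longrightarrow> x \<notin> S \<Longrightarrow> adjoin S x \<in> star (Suc m) S"
  using adjoin_G adjoin_superset by (simp add: star_def)

text \<open>A subspace of codimension at least two is the intersection of two one-step extensions.\<close>

lemma star_pair:
  assumes "S \<in> G m" "Suc m < n"
  obtains X Y where "X \<in> star (Suc m) S" "Y \<in> star (Suc m) S" "X \<noteq> Y" "adj X Y" "X \<inter> Y = S"
proof -
  have s: "sub S" "dim S = m" using assms by (auto simp: G_iff)
  obtain x where x: "x \<notin> S" using not_sub_exists[of S] s assms by auto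
  have X: "adjoin S x \<in> G (Suc m)" using adjoin_G assms x by blast
  obtain y where y: "y \<notin> adjoin S x" using not_sub_exists[of "adjoin S x"] X assms by (auto simp: G_iff)
  have yS: "y \<notin> S" using y adjoin_superset by blast
  have Y: "adjoin S y \<in> G (Suc m)" using adjoin_G assms yS by blast
  have ne: "adjoin S x \<noteq> adjoin S y" using y adjoin_mem[OF s(1), of y] by auto
  show ?thesis
    using that[OF adjoin_star[OF assms(1) x] adjoin_star[OF assms(1) yS] ne]
      common_lower[OF X Y ne assms(1) adjoin_superset adjoin_superset] by blast
qed

lemma star_inj:
  assumes "S \<in> G m" "T \<in> G m" "Suc m < n" and sub: "star (Suc m) S \<subseteq> star (Suc m) T" shows "S = T"
proof -
  obtain X Y where XY: "X \<in> star (Suc m) S" "Y \<in> star (Suc m) S" "X \<inter> Y = S"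
    by (rule star_pair[OF assms(1,3)])
  then have "T \<subseteq> X" "T \<subseteq> Y" using sub by (auto simp: star_def)
  then have "T \<subseteq> S" using XY by blast
  then show ?thesis using G_eqI assms by blast
qed

lemma star_not_tops:
  assumes "S \<in> G m" "U \<in> G (Suc (Suc m))" "Suc (Suc m) < n"
  shows "\<not> star (Suc m) S \<subseteq> tops (Suc m) U"
proof
  assume sub: "star (Suc m) S \<subseteq> tops (Suc m) U"
  obtain y where y: "y \<notin> U" using not_sub_exists[of U] assms by (auto simp: G_iff)
  show False
  proof (cases "S \<subseteq> U")
    case True
    then have "y \<notin> S" using y by blast
    then have "adjoin S y \<in> tops (Suc m) U" using adjoin_star assms(1) sub by blast
    then show False using y adjoin_mem[of S y] assms(1) by (auto simp: tops_def G_iff)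
  next
    case False
    obtain x where x: "x \<notin> S" using not_sub_exists[of S] assms by (auto simp: G_iff)
    then have "adjoin S x \<in> tops (Suc m) U" using adjoin_star assms(1) sub by blast
    then show False using False adjoin_superset[of S x] by (auto simp: tops_def)
  qed
qed

lemma not_all_adjacent:
  assumes "0 < m" "Suc (Suc m) < n"
  obtains X Y where "X \<in> G (Suc m)" "Y \<in> G (Suc m)" "X \<noteq> Y" "\<not> adj X Y"
proof (rule ccontr)
  note goal = that
  assume none: "\<not> thesis"
  have all: "adj X Y" if "X \<in> G (Suc m)" "Y \<in> G (Suc m)" "X \<noteq> Y" for X Y
    using goal[OF that] none by blast
  obtain S0 where S0: "S0 \<in> G m" using sub_G_exists[of m] assms by auto
  obtain X Y where XY: "X \<in> star (Suc m) S0" "Y \<in> star (Suc m) S0" "X \<noteq> Y"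
    by (rule star_pair[OF S0]) (use assms in auto)
  have "X \<in> G (Suc m)" "Y \<in> G (Suc m)" using XY by (auto simp: star_def)
  then have "(\<exists>S\<in>G m. G (Suc m) \<subseteq> star (Suc m) S) \<or> (\<exists>U\<in>G (Suc (Suc m)). G (Suc m) \<subseteq> tops (Suc m) U)"
    using XY(3) by (intro clique_star_or_tops all) auto
  then show False
  proof (elim disjE bexE)
    fix S assume S: "S \<in> G m" "G (Suc m) \<subseteq> star (Suc m) S"
    obtain T where T: "T \<in> G m" "adj S T" by (rule G_other[OF S(1)]) (use assms in auto)
    have "star (Suc m) T \<subseteq> star (Suc m) S" using S by (auto simp: star_def)
    then have "T = S" using star_inj[OF T(1) S(1)] assms by simp
    then show False using T adj_irrefl by blast
  next
    fix U assume U: "U \<in> G (Suc (Suc m))" "G (Suc m) \<subseteq> tops (Suc m) U"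
    then have "star (Suc m) S0 \<subseteq> tops (Suc m) U" by (auto simp: star_def)
    then show False using star_not_tops S0 U assms by blast
  qed
qed

end

context two_spaces
begin

text \<open>Bijections on subspaces of two consecutive dimensions that preserve and reflect inclusion.
  The dimension may shift from \<open>i\<close> to \<open>j\<close>.\<close>

definition inc_pair :: "nat \<Rightarrow> nat \<Rightarrow> ('v set \<Rightarrow> 'w set) \<Rightarrow> ('v set \<Rightarrow> 'w set) \<Rightarrow> bool" where
  "inc_pair i j a b \<longleftrightarrow> bij_betw a (V.G i) (W.G j) \<and> bij_betw b (V.G (Suc i)) (W.G (Suc j)) \<and>
     (\<forall>S\<in>V.G i. \<forall>X\<in>V.G (Suc i). S \<subseteq> X \<longleftrightarrow> a S \<subseteq> b X)"

lemma inc_pair_adj: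
  assumes ip: "inc_pair i j a b" and S: "S \<in> V.G i" "T \<in> V.G i" "V.adj S T"
  shows "W.adj (a S) (a T)" "b (V.join S T) = W.join (a S) (a T)"
proof -
  have J: "V.join S T \<in> V.G (Suc i)" using S V.adj_join_G by blast
  have s: "V.sub S" "V.sub T" using S by (auto simp: V.G_iff)
  have "S \<subseteq> V.join S T" "T \<subseteq> V.join S T" using V.join_superset1 V.join_superset2 s by blast+
  then have "a S \<subseteq> b (V.join S T)" "a T \<subseteq> b (V.join S T)" using ip S J unfolding inc_pair_def by blast+
  moreover have "a S \<in> W.G j" "a T \<in> W.G j" "b (V.join S T) \<in> W.G (Suc j)"
    using ip S J bij_betwE unfolding inc_pair_def by metis+
  moreover have "a S \<noteq> a T"
    using ip S V.adj_neq[OF S(3)] unfolding inc_pair_def bij_betw_def by (metis inj_onD)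
  ultimately show "W.adj (a S) (a T)" "b (V.join S T) = W.join (a S) (a T)"
    using W.common_upper by metis+
qed

text \<open>All images \<open>a X\<close> of subspaces \<open>X \<supseteq> S\<close> have a common hyperplane. For three such subspaces that are not in a
  common subspace of one dimension more, the images are pairwise adjacent and not in a common subspace
  of one dimension more either, so by lemma \<open>triangle\<close> the third image contains the meet of the other two.\<close>

lemma inc_pair_center:
  assumes ip: "inc_pair (Suc m) (Suc p) a b" and n: "Suc (Suc m) < n" and S: "S \<in> V.G m"
  shows "\<exists>T\<in>W.G p. \<forall>X\<in>V.star (Suc m) S. T \<subseteq> a X"
proof -
  have aG: "a X \<in> W.G (Suc p)" if "X \<in> V.G (Suc m)" for X
    using that ip bij_betwE unfolding inc_pair_def by metis
  have sG: "X \<in> V.G (Suc m)" if "X \<in> V.star (Suc m) S" for X using that by (simp add: V.star_def)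
  have step: "a X \<inter> a Y \<subseteq> a Z"
    if X: "X \<in> V.star (Suc m) S" and Y: "Y \<in> V.star (Suc m) S" and ne: "X \<noteq> Y"
      and Z: "Z \<in> V.star (Suc m) S" "\<not> Z \<subseteq> V.join X Y" for X Y Z
  proof -
    have adj: "V.adj X Y" using V.star_clique[OF S X Y ne] .
    have s: "V.sub X" "V.sub Y" using V.adj_sub[OF adj] by auto
    have "Z \<noteq> X" "Z \<noteq> Y" using Z(2) V.join_superset1[OF s(2)] V.join_superset2[OF s(1)] by blast+
    then have "V.adj Z X" "V.adj Z Y" using V.star_clique[OF S] X Y Z by blast+
    then have t: "W.adj (a Z) (a X)" "W.adj (a Z) (a Y)" "W.adj (a X) (a Y)"
      using inc_pair_adj(1)[OF ip] adj X Y Z sG by blast+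
    have J: "V.join X Y \<in> V.G (Suc (Suc m))" using V.adj_join_G[OF adj] sG[OF X] .
    have "\<not> a Z \<subseteq> b (V.join X Y)" using ip J Z sG unfolding inc_pair_def by blast
    then have "\<not> a Z \<subseteq> W.join (a X) (a Y)" using inc_pair_adj(2)[OF ip sG[OF X] sG[OF Y] adj] by simp
    then show ?thesis using W.triangle[OF t(3,1,2)] by blast
  qed
  obtain X Y where X: "X \<in> V.star (Suc m) S" and Y: "Y \<in> V.star (Suc m) S"
    and ne: "X \<noteq> Y" and adj: "V.adj X Y" "X \<inter> Y = S"
    by (rule V.star_pair[OF S]) (use n in auto)
  have J: "V.join X Y \<in> V.G (Suc (Suc m))" using V.adj_join_G[OF adj(1)] sG[OF X] .
  have sX: "V.sub X" "V.sub Y" using V.adj_sub[OF adj(1)] by auto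
  have aXY: "W.adj (a X) (a Y)" using inc_pair_adj(1)[OF ip] adj X Y sG by blast
  have T: "a X \<inter> a Y \<in> W.G p" using W.adj_meet_G[OF aXY] aG sG X by blast
  obtain z where z: "z \<notin> V.join X Y"
    using V.not_sub_exists[of "V.join X Y"] J n by (auto simp: V.G_iff)
  have SJ: "S \<subseteq> V.join X Y" using V.join_superset1[OF sX(2)] X by (auto simp: V.star_def)
  define Z where "Z = V.adjoin S z"
  have Z: "Z \<in> V.star (Suc m) S" using V.adjoin_star[OF S] z SJ unfolding Z_def by blast
  have zZ: "z \<in> Z" using V.adjoin_mem[of S z] S by (simp add: Z_def V.G_iff)
  have ZJ: "\<not> Z \<subseteq> V.join X Y" using z zZ by blast
  have XZ: "X \<noteq> Z" using ZJ V.join_superset1[OF sX(2)] by blast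
  have TZ: "a X \<inter> a Y \<subseteq> a Z" using step[OF X Y ne Z ZJ] .
  have aZ: "V.adj X Z" using V.star_clique[OF S X Z XZ] .
  have "W.adj (a X) (a Z)" using inc_pair_adj(1)[OF ip] aZ X Z sG by blast
  then have T2: "a X \<inter> a Z = a X \<inter> a Y"
    using W.common_lower(2)[OF aG[OF sG[OF X]] aG[OF sG[OF Z]] _ T] TZ W.adj_neq by blast
  have K: "V.join X Z \<in> V.G (Suc (Suc m))" using V.adj_join_G[OF aZ] sG[OF X] .
  have sZ: "V.sub Z" using V.adj_sub[OF aZ] by simp
  have JK: "V.join X Y \<noteq> V.join X Z" using ZJ V.join_superset2[OF sX(1)] by blast
  \<comment> \<open>the planes \<open>X + Y\<close> and \<open>X + Z\<close> over \<open>S\<close> only share \<open>X\<close>, so one of the two pairs serves any member of the star\<close>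
  have JKX: "V.join X Y \<inter> V.join X Z = X"
    using V.common_lower(2)[OF J K JK sG[OF X]] V.join_superset1 sX sZ by blast
  have "a X \<inter> a Y \<subseteq> a Q" if Q: "Q \<in> V.star (Suc m) S" for Q
  proof (cases "Q = X \<or> \<not> Q \<subseteq> V.join X Y")
    case True
    then show ?thesis using step[OF X Y ne Q] by blast
  next
    case False
    then have "\<not> Q \<subseteq> V.join X Z" using JKX V.G_eqI[OF sG[OF Q] sG[OF X]] by blast
    then show ?thesis using step[OF X Z XZ Q] T2 by blast
  qed
  then show ?thesis using T by blast
qed

lemma inc_pair_inverse:
  assumes "inc_pair i j a b"
  shows "two_spaces.inc_pair scale' scale j i (inv_into (V.G i) a) (inv_into (V.G (Suc i)) b)"
proof -
  interpret r: two_spaces scale' scale n by unfold_locales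
  have a: "bij_betw a (V.G i) (W.G j)" and b: "bij_betw b (V.G (Suc i)) (W.G (Suc j))"
    and I: "\<And>S X. S \<in> V.G i \<Longrightarrow> X \<in> V.G (Suc i) \<Longrightarrow> S \<subseteq> X \<longleftrightarrow> a S \<subseteq> b X"
    using assms unfolding inc_pair_def by auto
  have ai: "bij_betw (inv_into (V.G i) a) (W.G j) (V.G i)"
    and bi: "bij_betw (inv_into (V.G (Suc i)) b) (W.G (Suc j)) (V.G (Suc i))"
    using a b bij_betw_inv_into by blast+
  show ?thesis unfolding r.inc_pair_def
  proof (intro conjI ai bi ballI)
    fix S X assume SX: "S \<in> W.G j" "X \<in> W.G (Suc j)"
    then have "inv_into (V.G i) a S \<in> V.G i" "inv_into (V.G (Suc i)) b X \<in> V.G (Suc i)"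
      using ai bi bij_betwE by blast+
    from I[OF this] show "S \<subseteq> X \<longleftrightarrow> inv_into (V.G i) a S \<subseteq> inv_into (V.G (Suc i)) b X"
      using bij_betw_inv_into_right[OF a SX(1)] bij_betw_inv_into_right[OF b SX(2)] by simp
  qed
qed

text \<open>The inverse pair sends the star of the new centre \<open>T\<close> into a star again, whose centre can only be \<open>S\<close>.\<close>

lemma inc_pair_center_iff:
  assumes ip: "inc_pair (Suc m) (Suc p) a b" and n: "Suc (Suc m) < n" "Suc (Suc p) < n"
    and S: "S \<in> V.G m"
  shows "\<exists>T\<in>W.G p. \<forall>X\<in>V.G (Suc m). S \<subseteq> X \<longleftrightarrow> T \<subseteq> a X"
proof -
  interpret r: two_spaces scale' scale n by unfold_locales
  have a: "bij_betw a (V.G (Suc m)) (W.G (Suc p))" using ip unfolding inc_pair_def by simp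
  obtain T where T: "T \<in> W.G p" "\<And>X. X \<in> V.star (Suc m) S \<Longrightarrow> T \<subseteq> a X"
    using inc_pair_center[OF ip n(1) S] by blast
  let ?ai = "inv_into (V.G (Suc m)) a"
  obtain S' where S': "S' \<in> V.G m" "\<And>Y. Y \<in> W.star (Suc p) T \<Longrightarrow> S' \<subseteq> ?ai Y"
    using r.inc_pair_center[OF inc_pair_inverse[OF ip] n(2) T(1)] by blast
  have S'X: "S' \<subseteq> X" if "X \<in> V.G (Suc m)" "T \<subseteq> a X" for X
  proof -
    have "a X \<in> W.star (Suc p) T" using that bij_betw_apply[OF a that(1)] by (simp add: W.star_def)
    then have "S' \<subseteq> ?ai (a X)" by (rule S')
    then show ?thesis using bij_betw_inv_into_left[OF a that(1)] by simp
  qed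
  have "V.star (Suc m) S \<subseteq> V.star (Suc m) S'"
    using S'X T(2) by (auto simp: V.star_def)
  then have "S = S'" using V.star_inj[OF S S'(1)] n by simp
  then have "\<forall>X\<in>V.G (Suc m). S \<subseteq> X \<longleftrightarrow> T \<subseteq> a X" using S'X T(2) by (auto simp: V.star_def)
  then show ?thesis using T(1) by blast
qed

lemma inc_pair_descent:
  assumes ip: "inc_pair (Suc m) (Suc p) a b" and n: "Suc (Suc m) < n" "Suc (Suc p) < n"
  obtains c where "inc_pair m p c a"
proof -
  interpret r: two_spaces scale' scale n by unfold_locales
  have a: "bij_betw a (V.G (Suc m)) (W.G (Suc p))" using ip unfolding inc_pair_def by simp
  obtain c where c: "\<And>S. S \<in> V.G m \<Longrightarrow> c S \<in> W.G p"
    "\<And>S X. S \<in> V.G m \<Longrightarrow> X \<in> V.G (Suc m) \<Longrightarrow> S \<subseteq> X \<longleftrightarrow> c S \<subseteq> a X"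
    using inc_pair_center_iff[OF ip n] by metis
  have "bij_betw c (V.G m) (W.G p)" unfolding bij_betw_def
  proof (intro conjI inj_onI)
    fix S T assume ST: "S \<in> V.G m" "T \<in> V.G m" "c S = c T"
    then have "V.star (Suc m) S \<subseteq> V.star (Suc m) T"
      using c(2)[OF ST(1)] c(2)[OF ST(2)] ST(3) by (simp add: V.star_def Collect_mono_iff) blast
    then show "S = T" using V.star_inj ST n by simp
  next
    show "c ` V.G m = W.G p"
    proof (intro equalityI subsetI)
      fix T assume "T \<in> c ` V.G m" then show "T \<in> W.G p" by (elim imageE) (simp add: c(1))
    next
      fix T assume T: "T \<in> W.G p"
      obtain S where S: "S \<in> V.G m"
        "\<forall>Y\<in>W.G (Suc p). T \<subseteq> Y \<longleftrightarrow> S \<subseteq> inv_into (V.G (Suc m)) a Y"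
        by (rule bexE[OF r.inc_pair_center_iff[OF inc_pair_inverse[OF ip] n(2,1) T]])
      have "W.star (Suc p) T \<subseteq> W.star (Suc p) (c S)"
      proof
        fix Y assume Y: "Y \<in> W.star (Suc p) T"
        then have YG: "Y \<in> W.G (Suc p)" by (simp add: W.star_def)
        then have iY: "inv_into (V.G (Suc m)) a Y \<in> V.G (Suc m)"
          using bij_betw_apply[OF bij_betw_inv_into[OF a]] by simp
        have "S \<subseteq> inv_into (V.G (Suc m)) a Y" using bspec[OF S(2) YG] Y by (simp add: W.star_def)
        then have "c S \<subseteq> a (inv_into (V.G (Suc m)) a Y)" by (simp only: c(2)[OF S(1) iY])
        then show "Y \<in> W.star (Suc p) (c S)" using bij_betw_inv_into_right[OF a YG] YG by (simp add: W.star_def)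
      qed
      then have "T = c S" using W.star_inj[OF T c(1)[OF S(1)]] n by simp
      then show "T \<in> c ` V.G m" using S by blast
    qed
  qed
  then have "inc_pair m p c a" using a c(2) unfolding inc_pair_def by blast
  then show ?thesis by (rule that)
qed

text \<open>Semilinear bijections turn the adjunction of a vector into the adjunction of its image.\<close>

lemma semilinear_image_G:
  assumes sl: "semilinear_between scale scale' \<sigma> l" and S: "S \<in> V.G i"
  shows "l ` S \<in> W.G i"
  using S
proof (induction i arbitrary: S)
  case 0
  have l0: "l 0 = 0"
  proof -
    have "l (0 + 0) = l 0 + l 0" using sl unfolding semilinear_between_def by blast
    then show ?thesis by simp
  qed
  have "{0} = S" using 0 V.dim_eq_imp_eq[of "{0}" S] V.sub_zero V.sub_0 by (simp add: V.G_iff)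
  then show ?case using l0 W.dim_zero W.sub_zero by (auto simp: W.G_iff)
next
  case (Suc i)
  have l: "bij l" "\<And>x y. l (x + y) = l x + l y" "\<And>a x. l (scale a x) = scale' (\<sigma> a) (l x)" "bij \<sigma>"
    using sl unfolding semilinear_between_def by auto
  have s: "V.sub S" "V.dim S = Suc i" using Suc.prems by (auto simp: V.G_iff)
  have "{0} \<noteq> S" using V.dim_zero s by auto
  then have S0: "{0} \<subset> S" using V.sub_0[OF s(1)] by auto
  obtain H where H: "V.sub H" "{0} \<subseteq> H" "H \<subseteq> S" "V.dim S = Suc (V.dim H)"
    by (rule V.hyperplane[OF s(1) V.sub_zero S0])
  have HG: "H \<in> V.G i" using H s by (simp add: V.G_iff)
  have "H \<noteq> S" using H by auto
  then obtain x where x: "x \<in> S" "x \<notin> H" using H by blast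
  have S: "S = V.adjoin H x" using H s x by (intro V.adjoin_eqI) auto
  have "l ` S = W.adjoin (l ` H) (l x)"
  proof (intro equalityI subsetI)
    fix w assume "w \<in> l ` S"
    then obtain h c where "h \<in> H" "w = l (h + scale c x)" using S by (auto simp: V.adjoin_def)
    then show "w \<in> W.adjoin (l ` H) (l x)" using W.adjoinI[of "l h" "l ` H" "\<sigma> c" "l x"] l by simp
  next
    fix w assume "w \<in> W.adjoin (l ` H) (l x)"
    then obtain h c where h: "h \<in> H" "w = l h + scale' c (l x)" by (auto simp: W.adjoin_def)
    obtain c' where "c = \<sigma> c'" using l(4) by (metis bij_pointE)
    then have "w = l (h + scale c' x)" using h l by simp
    then show "w \<in> l ` S" using S h V.adjoinI by blast
  qed
  moreover have "l x \<notin> l ` H" using x l(1) by (auto simp: bij_def inj_def)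
  ultimately show ?case using W.adjoin_G[OF Suc.IH[OF HG]] by simp
qed

lemma inc_pair_extend:
  assumes ip: "inc_pair (Suc i) (Suc i) c a" and sl: "semilinear_between scale scale' \<sigma> l"
    and c: "\<And>S. S \<in> V.G (Suc i) \<Longrightarrow> c S = l ` S" and X: "X \<in> V.G (Suc (Suc i))"
  shows "a X = l ` X"
proof -
  have aX: "a X \<in> W.G (Suc (Suc i))" using ip X bij_betwE unfolding inc_pair_def by metis
  have s: "V.sub X" "V.dim X = Suc (Suc i)" using X by (auto simp: V.G_iff)
  have "l ` X \<subseteq> a X"
  proof
    fix w assume "w \<in> l ` X"
    then obtain x where x: "x \<in> X" "w = l x" by auto
    have "V.line x \<subseteq> X" using V.line_subset[OF s(1) x(1)] .
    then obtain S where S: "V.sub S" "V.line x \<subseteq> S" "S \<subseteq> X" "V.dim S = Suc i"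
      by (rule V.intermediate[OF V.sub_line s(1), of x "Suc i"]) (use V.dim_line_le[of x] s in auto)
    then have SG: "S \<in> V.G (Suc i)" by (simp add: V.G_iff)
    then have "c S \<subseteq> a X" using ip X S unfolding inc_pair_def by blast
    then show "w \<in> a X" using c[OF SG] S V.line_mem[of x] x by blast
  qed
  then show ?thesis using W.G_eqI[OF semilinear_image_G[OF sl X] aX] by simp
qed

text \<open>Descend until one side reaches dimension one. There all subspaces are adjacent, which fails in the
  dimensions strictly between \<open>1\<close> and \<open>n - 1\<close>; so both sides arrive at points simultaneously, where the
  fundamental theorem applies.\<close>

theorem inc_pair_semilinear:
  assumes n4: "4 \<le> n"
  shows "inc_pair (Suc m) (Suc p) a b \<Longrightarrow> Suc (Suc m) < n \<Longrightarrow> Suc (Suc p) < n \<Longrightarrow>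
    m = p \<and> (\<exists>\<sigma> l. semilinear_between scale scale' \<sigma> l \<and> (\<forall>S\<in>V.G (Suc m). a S = l ` S))"
proof (induction m arbitrary: p a b)
  case 0
  have a: "bij_betw a (V.G 1) (W.G (Suc p))" and ip: "inc_pair 1 (Suc p) a b"
    using 0 unfolding inc_pair_def by auto
  have "p = 0"
  proof (rule ccontr)
    assume "p \<noteq> 0"
    then obtain X Y where XY: "X \<in> W.G (Suc p)" "Y \<in> W.G (Suc p)" "X \<noteq> Y" "\<not> W.adj X Y"
      using W.not_all_adjacent[of p] 0 by auto
    obtain P Q where PQ: "P \<in> V.G 1" "Q \<in> V.G 1" "a P = X" "a Q = Y"
      using XY a unfolding bij_betw_def by (metis imageE)
    then have "V.adj P Q" using XY by (intro V.adj_G1) auto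
    then show False using inc_pair_adj(1)[OF ip PQ(1,2)] PQ XY by simp
  qed
  have ip1: "inc_pair 1 1 a b" using ip \<open>p = 0\<close> by simp
  interpret c: collineation scale scale' n a b
    using ip1 n4 unfolding inc_pair_def by unfold_locales (auto simp: numeral_2_eq_2)
  obtain \<sigma> l where l: "semilinear_between scale scale' \<sigma> l" "\<And>P. P \<in> V.G 1 \<Longrightarrow> l ` P \<subseteq> a P"
    using c.fundamental_theorem by blast
  have "a P = l ` P" if P: "P \<in> V.G 1" for P
    using W.G_eqI[OF semilinear_image_G[OF l(1) P], of "a P"] l(2)[OF P] c.a_bij P bij_betwE by metis
  then show ?case using l(1) \<open>p = 0\<close> by auto
next
  case (Suc m)
  have a: "bij_betw a (V.G (Suc (Suc m))) (W.G (Suc p))" using Suc.prems unfolding inc_pair_def by simp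
  have "p \<noteq> 0"
  proof
    assume p0: "p = 0"
    obtain X Y where XY: "X \<in> V.G (Suc (Suc m))" "Y \<in> V.G (Suc (Suc m))" "X \<noteq> Y" "\<not> V.adj X Y"
      using V.not_all_adjacent[of "Suc m"] Suc.prems by auto
    interpret r: two_spaces scale' scale n by unfold_locales
    have "a X \<in> W.G 1" "a Y \<in> W.G 1" "a X \<noteq> a Y"
      using a XY p0 unfolding bij_betw_def by (auto dest: inj_onD)
    then have "W.adj (a X) (a Y)" by (rule W.adj_G1)
    then have "V.adj (inv_into (V.G (Suc (Suc m))) a (a X)) (inv_into (V.G (Suc (Suc m))) a (a Y))"
      using r.inc_pair_adj(1)[OF inc_pair_inverse[OF Suc.prems(1)]] \<open>a X \<in> W.G 1\<close> \<open>a Y \<in> W.G 1\<close> p0 by simp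
    then show False using XY bij_betw_inv_into_left[OF a] by simp
  qed
  then obtain p' where p': "p = Suc p'" by (cases p) auto
  obtain c where c: "inc_pair (Suc m) (Suc p') c a"
    using inc_pair_descent[of "Suc m" p a b] Suc.prems p' by blast
  have "m = p' \<and> (\<exists>\<sigma> l. semilinear_between scale scale' \<sigma> l \<and> (\<forall>S\<in>V.G (Suc m). c S = l ` S))"
    by (rule Suc.IH[OF c]) (use Suc.prems p' in auto)
  then obtain \<sigma> l where mp: "m = p'" and sl: "semilinear_between scale scale' \<sigma> l"
    and cl: "\<And>S. S \<in> V.G (Suc m) \<Longrightarrow> c S = l ` S" by auto
  have "a S = l ` S" if "S \<in> V.G (Suc (Suc m))" for S
    by (rule inc_pair_extend[OF _ sl cl that]) (use c mp in simp_all)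
  then show ?case using sl mp p' by auto
qed

text \<open>The preimage of the maximal clique containing the image of a star is again a clique, so it lies in
  a star or a top; as it contains the given star, it must be this star.\<close>

lemma star_image:
  assumes h: "bij_betw h (V.G (Suc m)) (W.G (Suc p))"
    and adj: "\<And>X Y. X \<in> V.G (Suc m) \<Longrightarrow> Y \<in> V.G (Suc m) \<Longrightarrow> V.adj X Y \<longleftrightarrow> W.adj (h X) (h Y)"
    and n: "Suc (Suc m) < n" "Suc (Suc p) < n" and S: "S \<in> V.G m"
  shows "(\<exists>T\<in>W.G p. h ` V.star (Suc m) S = W.star (Suc p) T) \<or>
    (\<exists>U\<in>W.G (Suc (Suc p)). h ` V.star (Suc m) S = W.tops (Suc p) U)"
proof -
  have sG: "V.star (Suc m) S \<subseteq> V.G (Suc m)" by (auto simp: V.star_def)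
  have hinj: "h X = h Y \<longleftrightarrow> X = Y" if "X \<in> V.G (Suc m)" "Y \<in> V.G (Suc m)" for X Y
    using h that by (auto simp: bij_betw_def dest: inj_onD)
  obtain X Y where XY: "X \<in> V.star (Suc m) S" "Y \<in> V.star (Suc m) S" "X \<noteq> Y"
    by (rule V.star_pair[OF S]) (use n in auto)
  have XYG: "X \<in> V.G (Suc m)" "Y \<in> V.G (Suc m)" using XY sG by auto
  have full: "h ` V.star (Suc m) S = C"
    if C: "C \<subseteq> W.G (Suc p)" "\<And>A B. A \<in> C \<Longrightarrow> B \<in> C \<Longrightarrow> A \<noteq> B \<Longrightarrow> W.adj A B"
      and sub: "h ` V.star (Suc m) S \<subseteq> C" for C
  proof -
    define D where "D = {Z \<in> V.G (Suc m). h Z \<in> C}"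
    have DG: "D \<subseteq> V.G (Suc m)" by (auto simp: D_def)
    have SD: "V.star (Suc m) S \<subseteq> D" using sG sub by (auto simp: D_def)
    have "V.adj A B" if "A \<in> D" "B \<in> D" "A \<noteq> B" for A B
      using that adj hinj C(2) unfolding D_def by auto
    then have "(\<exists>S'\<in>V.G m. D \<subseteq> V.star (Suc m) S') \<or> (\<exists>U\<in>V.G (Suc (Suc m)). D \<subseteq> V.tops (Suc m) U)"
      using V.clique_star_or_tops[OF DG _ _ _ XY(3)] SD XY by blast
    moreover have "\<not> D \<subseteq> V.tops (Suc m) U" if "U \<in> V.G (Suc (Suc m))" for U
      using V.star_not_tops[OF S that n(1)] SD by blast
    ultimately obtain S' where S': "S' \<in> V.G m" "D \<subseteq> V.star (Suc m) S'" by blast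
    then have "S = S'" using V.star_inj[OF S S'(1)] SD n by auto
    then have "D = V.star (Suc m) S" using S' SD by blast
    moreover have "C \<subseteq> h ` D"
    proof
      fix A assume A: "A \<in> C"
      then obtain Z where "Z \<in> V.G (Suc m)" "A = h Z" using C(1) h unfolding bij_betw_def by blast
      then show "A \<in> h ` D" using A by (auto simp: D_def)
    qed
    ultimately show ?thesis using sub by blast
  qed
  have hG: "h ` V.star (Suc m) S \<subseteq> W.G (Suc p)" using h sG by (auto simp: bij_betw_def)
  have cl: "W.adj A B" if AB: "A \<in> h ` V.star (Suc m) S" "B \<in> h ` V.star (Suc m) S" "A \<noteq> B" for A B
  proof -
    obtain P Q where PQ: "P \<in> V.star (Suc m) S" "Q \<in> V.star (Suc m) S" "A = h P" "B = h Q" using AB by blast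
    then have "V.adj P Q" using V.star_clique[OF S] AB by blast
    then show ?thesis using adj PQ sG by blast
  qed
  have "h X \<noteq> h Y" using hinj XYG XY by simp
  then have "(\<exists>T\<in>W.G p. h ` V.star (Suc m) S \<subseteq> W.star (Suc p) T) \<or>
    (\<exists>U\<in>W.G (Suc (Suc p)). h ` V.star (Suc m) S \<subseteq> W.tops (Suc p) U)"
    using W.clique_star_or_tops[OF hG cl, of "h X" "h Y"] XY by blast
  then show ?thesis
  proof (elim disjE bexE)
    fix T assume T: "T \<in> W.G p" "h ` V.star (Suc m) S \<subseteq> W.star (Suc p) T"
    have "h ` V.star (Suc m) S = W.star (Suc p) T"
      by (rule full[OF _ W.star_clique[OF T(1)] T(2)]) (auto simp: W.star_def)
    then show ?thesis using T(1) by blast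
  next
    fix U assume U: "U \<in> W.G (Suc (Suc p))" "h ` V.star (Suc m) S \<subseteq> W.tops (Suc p) U"
    have "h ` V.star (Suc m) S = W.tops (Suc p) U"
      by (rule full[OF _ W.tops_clique[OF U(1)] U(2)]) (auto simp: W.tops_def)
    then show ?thesis using U(1) by blast
  qed
qed

text \<open>The stars of adjacent centres share exactly one element, whereas a star and a top that meet have a
  whole line in common.\<close>

lemma star_type_step:
  assumes h: "bij_betw h (V.G (Suc m)) (W.G (Suc p))"
    and S: "S \<in> V.G m" "T \<in> V.G m" "V.adj S T"
    and A: "A \<in> W.G p" "h ` V.star (Suc m) S = W.star (Suc p) A"
    and B: "B \<in> W.G (Suc (Suc p))" "h ` V.star (Suc m) T = W.tops (Suc p) B"
  shows False
proof -
  have s: "V.sub S" "V.sub T" using S by (auto simp: V.G_iff)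
  have JG: "V.join S T \<in> V.G (Suc m)" using V.adj_join_G S by blast
  then have J: "V.join S T \<in> V.star (Suc m) S" "V.join S T \<in> V.star (Suc m) T"
    using V.join_superset1[OF s(2)] V.join_superset2[OF s(1)] by (auto simp: V.star_def)
  define X where "X = h (V.join S T)"
  have "X \<in> h ` V.star (Suc m) S" "X \<in> h ` V.star (Suc m) T" using J unfolding X_def by auto
  then have X: "X \<in> W.G (Suc p)" "A \<subseteq> X" "X \<subseteq> B"
    unfolding A B by (auto simp: W.star_def W.tops_def)
  have "X \<noteq> B" using X B by (auto simp: W.G_iff)
  then obtain z where z: "z \<in> B" "z \<notin> X" using X by blast
  have Bs: "W.sub B" using B by (simp add: W.G_iff)
  have "z \<notin> A" using z X by blast
  then have Y: "W.adjoin A z \<in> W.G (Suc p)" "W.adjoin A z \<subseteq> B"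
    using W.adjoin_G[OF A(1)] W.adjoin_least[of A B z] X z Bs by auto
  then have "W.adjoin A z \<in> h ` V.star (Suc m) S" "W.adjoin A z \<in> h ` V.star (Suc m) T"
    unfolding A B using W.adjoin_superset[of A z] by (auto simp: W.star_def W.tops_def)
  then obtain P Q where PQ: "P \<in> V.star (Suc m) S" "Q \<in> V.star (Suc m) T" "h P = W.adjoin A z" "h Q = W.adjoin A z"
    by (metis imageE)
  moreover have "P = Q"
    by (rule inj_onD[OF bij_betw_imp_inj_on[OF h]]) (use PQ in \<open>auto simp: V.star_def\<close>)
  ultimately have "S \<subseteq> P" "T \<subseteq> P" "P \<in> V.G (Suc m)" by (auto simp: V.star_def)
  then have "V.join S T = P" using V.common_upper(2) S V.adj_neq by blast
  then have "W.adjoin A z = X" using PQ X_def by simp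
  then show False using z W.adjoin_mem[of A z] A(1) by (auto simp: W.G_iff)
qed

lemma star_type_constant:
  assumes h: "bij_betw h (V.G (Suc m)) (W.G (Suc p))"
    and adj: "\<And>X Y. X \<in> V.G (Suc m) \<Longrightarrow> Y \<in> V.G (Suc m) \<Longrightarrow> V.adj X Y \<longleftrightarrow> W.adj (h X) (h Y)"
    and n: "Suc (Suc m) < n" "Suc (Suc p) < n"
  shows "(\<forall>S\<in>V.G m. \<exists>T\<in>W.G p. h ` V.star (Suc m) S = W.star (Suc p) T) \<or>
    (\<forall>S\<in>V.G m. \<exists>U\<in>W.G (Suc (Suc p)). h ` V.star (Suc m) S = W.tops (Suc p) U)"
proof (rule ccontr)
  define P where "P S \<longleftrightarrow> (\<exists>T\<in>W.G p. h ` V.star (Suc m) S = W.star (Suc p) T)" for S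
  define Q where "Q S \<longleftrightarrow> (\<exists>U\<in>W.G (Suc (Suc p)). h ` V.star (Suc m) S = W.tops (Suc p) U)" for S
  have PQ: "P S \<or> Q S" if "S \<in> V.G m" for S
    using star_image[OF h adj n that] unfolding P_def Q_def .
  have step: "\<not> (P S \<and> Q T)" if "S \<in> V.G m" "T \<in> V.G m" "V.adj S T" for S T
    using star_type_step[OF h that] unfolding P_def Q_def by blast
  assume "\<not> ?thesis"
  then obtain S T where ST: "S \<in> V.G m" "T \<in> V.G m" "\<not> P S" "\<not> Q T" unfolding P_def Q_def by blast
  have "\<not> P X" if "(\<lambda>X Y. X \<in> V.G m \<and> Y \<in> V.G m \<and> V.adj X Y)\<^sup>*\<^sup>* S X" for X
    using that
  proof (induction rule: rtranclp_induct)
    case base then show ?case using ST by simp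
  next
    case (step Y Z)
    then have "Q Y" using PQ by blast
    then show ?case using \<open>\<And>S T. \<lbrakk>S \<in> V.G m; T \<in> V.G m; V.adj S T\<rbrakk> \<Longrightarrow> \<not> (P S \<and> Q T)\<close> step V.adj_sym by blast
  qed
  then have "\<not> P T" using V.grassmann_connected ST by blast
  then show False using PQ ST by blast
qed

text \<open>The only delicate point is that every star of the target is hit. If the preimage of the star of \<open>T\<close>
  were a top, two of its members \<open>X\<close>, \<open>Y\<close> would also lie in the star of \<open>X \<inter> Y\<close>. Then both \<open>T\<close> and the
  centre assigned to \<open>X \<inter> Y\<close> equal the meet of the images of \<open>X\<close> and \<open>Y\<close>,
  so that \<open>T\<close> is hit after all.\<close>

theorem chow_stars:
  assumes n4: "4 \<le> n"
    and h: "bij_betw h (V.G (Suc (Suc m))) (W.G (Suc (Suc p)))"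
    and adj: "\<And>X Y. X \<in> V.G (Suc (Suc m)) \<Longrightarrow> Y \<in> V.G (Suc (Suc m)) \<Longrightarrow> V.adj X Y \<longleftrightarrow> W.adj (h X) (h Y)"
    and n: "Suc (Suc (Suc m)) < n" "Suc (Suc (Suc p)) < n"
    and stars: "\<forall>S\<in>V.G (Suc m). \<exists>T\<in>W.G (Suc p). h ` V.star (Suc (Suc m)) S = W.star (Suc (Suc p)) T"
  shows "m = p \<and> (\<exists>\<sigma> l. semilinear_between scale scale' \<sigma> l \<and> (\<forall>X\<in>V.G (Suc (Suc m)). h X = l ` X))"
proof -
  interpret r: two_spaces scale' scale n by unfold_locales
  obtain c where cG: "\<And>S. S \<in> V.G (Suc m) \<Longrightarrow> c S \<in> W.G (Suc p)"
    and c: "\<And>S. S \<in> V.G (Suc m) \<Longrightarrow> h ` V.star (Suc (Suc m)) S = W.star (Suc (Suc p)) (c S)"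
    using stars by metis
  have hinj: "X = Y" if "h X = h Y" "X \<in> V.G (Suc (Suc m))" "Y \<in> V.G (Suc (Suc m))" for X Y
    by (rule inj_onD[OF bij_betw_imp_inj_on[OF h]]) (use that in auto)
  have inc: "S \<subseteq> X \<longleftrightarrow> c S \<subseteq> h X" if S: "S \<in> V.G (Suc m)" and X: "X \<in> V.G (Suc (Suc m))" for S X
  proof -
    have hX: "h X \<in> W.G (Suc (Suc p))" using h X bij_betwE by blast
    have "S \<subseteq> X \<longleftrightarrow> X \<in> V.star (Suc (Suc m)) S" using X by (simp add: V.star_def)
    also have "\<dots> \<longleftrightarrow> h X \<in> h ` V.star (Suc (Suc m)) S"
      using X hinj by (auto simp: V.star_def)
    also have "\<dots> \<longleftrightarrow> c S \<subseteq> h X" unfolding c[OF S] using hX by (simp add: W.star_def)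
    finally show ?thesis .
  qed
  let ?g = "inv_into (V.G (Suc (Suc m))) h"
  have g: "bij_betw ?g (W.G (Suc (Suc p))) (V.G (Suc (Suc m)))" using h by (rule bij_betw_inv_into)
  have gadj: "W.adj X Y \<longleftrightarrow> V.adj (?g X) (?g Y)" if "X \<in> W.G (Suc (Suc p))" "Y \<in> W.G (Suc (Suc p))" for X Y
    using adj[OF bij_betw_apply[OF g that(1)] bij_betw_apply[OF g that(2)]]
      bij_betw_inv_into_right[OF h that(1)] bij_betw_inv_into_right[OF h that(2)] by simp
  have "bij_betw c (V.G (Suc m)) (W.G (Suc p))" unfolding bij_betw_def
  proof (intro conjI inj_onI)
    fix S T assume ST: "S \<in> V.G (Suc m)" "T \<in> V.G (Suc m)" "c S = c T"
    then have "V.star (Suc (Suc m)) S \<subseteq> V.star (Suc (Suc m)) T"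
      using inc[OF ST(1)] inc[OF ST(2)] ST(3) by (simp add: V.star_def Collect_mono_iff) blast
    then show "S = T" using V.star_inj ST n by simp
  next
    show "c ` V.G (Suc m) = W.G (Suc p)"
    proof (intro equalityI subsetI)
      fix T assume "T \<in> c ` V.G (Suc m)" then show "T \<in> W.G (Suc p)" by (elim imageE) (simp add: cG)
    next
      fix T assume T: "T \<in> W.G (Suc p)"
      have "(\<lambda>X. h (?g X)) ` W.star (Suc (Suc p)) T = (\<lambda>X. X) ` W.star (Suc (Suc p)) T"
        by (rule image_cong[OF refl]) (simp add: W.star_def bij_betw_inv_into_right[OF h])
      then have hg: "h ` ?g ` W.star (Suc (Suc p)) T = W.star (Suc (Suc p)) T"
        by (simp add: image_image)
      have "(\<exists>S\<in>V.G (Suc m). ?g ` W.star (Suc (Suc p)) T = V.star (Suc (Suc m)) S) \<or>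
        (\<exists>U\<in>V.G (Suc (Suc (Suc m))). ?g ` W.star (Suc (Suc p)) T = V.tops (Suc (Suc m)) U)"
        by (rule r.star_image[OF g _ n(2,1) T]) (rule gadj)
      then show "T \<in> c ` V.G (Suc m)"
      proof (elim disjE bexE)
        fix S assume S: "S \<in> V.G (Suc m)" "?g ` W.star (Suc (Suc p)) T = V.star (Suc (Suc m)) S"
        then have "W.star (Suc (Suc p)) T = W.star (Suc (Suc p)) (c S)" using c[OF S(1)] hg by simp
        then have "T = c S" using W.star_inj[OF T cG[OF S(1)]] n by simp
        then show ?thesis using S by blast
      next
        fix U assume U: "U \<in> V.G (Suc (Suc (Suc m)))" "?g ` W.star (Suc (Suc p)) T = V.tops (Suc (Suc m)) U"
        \<comment> \<open>a hyperplane pair \<open>X, Y\<close> of the top \<open>U\<close> lies in the star of \<open>X \<inter> Y\<close>, which forces \<open>T = c (X \<inter> Y)\<close>\<close>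
        obtain A B where AB: "A \<in> W.star (Suc (Suc p)) T" "B \<in> W.star (Suc (Suc p)) T" "A \<noteq> B"
          by (rule W.star_pair[OF T]) (use n in auto)
        have ABG: "A \<in> W.G (Suc (Suc p))" "B \<in> W.G (Suc (Suc p))" using AB by (auto simp: W.star_def)
        define X where "X = ?g A"
        define Y where "Y = ?g B"
        have hXY: "h X = A" "h Y = B" unfolding X_def Y_def by (simp_all add: bij_betw_inv_into_right[OF h] ABG)
        have XYG: "X \<in> V.G (Suc (Suc m))" "Y \<in> V.G (Suc (Suc m))"
          unfolding X_def Y_def by (simp_all add: bij_betw_apply[OF g] ABG)
        have "W.adj A B" using W.star_clique[OF T AB] .
        then have aXY: "V.adj X Y" using gadj ABG unfolding X_def Y_def by blast
        define S where "S = X \<inter> Y"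
        have S: "S \<in> V.G (Suc m)" unfolding S_def using V.adj_meet_G[OF aXY XYG(1)] .
        have "c S \<subseteq> A" "c S \<subseteq> B" using inc[OF S XYG(1)] inc[OF S XYG(2)] hXY by (auto simp: S_def)
        then have "A \<inter> B = c S" using W.common_lower(2)[OF ABG AB(3) cG[OF S]] by blast
        moreover have "A \<inter> B = T" using W.common_lower(2)[OF ABG AB(3) T] AB by (auto simp: W.star_def)
        ultimately have "T = c S" by simp
        then show ?thesis using S by blast
      qed
    qed
  qed
  then have ip: "inc_pair (Suc m) (Suc p) c h" using h inc unfolding inc_pair_def by blast
  have "m = p \<and> (\<exists>\<sigma> l. semilinear_between scale scale' \<sigma> l \<and> (\<forall>S\<in>V.G (Suc m). c S = l ` S))"
    by (rule inc_pair_semilinear[OF n4 ip]) (use n in auto)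
  then obtain \<sigma> l where mp: "m = p" and sl: "semilinear_between scale scale' \<sigma> l"
    and cl: "\<And>S. S \<in> V.G (Suc m) \<Longrightarrow> c S = l ` S" by auto
  have "h X = l ` X" if "X \<in> V.G (Suc (Suc m))" for X
    by (rule inc_pair_extend[OF _ sl cl that]) (use ip mp in simp_all)
  then show ?thesis using sl mp by auto
qed

end

section \<open>Duality\<close>

locale dual_pairing = two_spaces +
  fixes orth :: "'b \<Rightarrow> 'd \<Rightarrow> bool"
  assumes sub_perp_V: "W.sub {y. \<forall>x\<in>S. orth x y}"
    and sub_perp_W: "V.sub {x. \<forall>y\<in>T. orth x y}"
    and separate_V: "V.sub S \<Longrightarrow> x \<notin> S \<Longrightarrow> \<exists>y. (\<forall>s\<in>S. orth s y) \<and> \<not> orth x y"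
    and separate_W: "W.sub T \<Longrightarrow> y \<notin> T \<Longrightarrow> \<exists>x. (\<forall>t\<in>T. orth x t) \<and> \<not> orth x y"
begin

definition "perp S = {y. \<forall>x\<in>S. orth x y}"
definition "perp' T = {x. \<forall>y\<in>T. orth x y}"

lemma dual_pairing_swap: "dual_pairing scale' scale n (\<lambda>y x. orth x y)"
  by unfold_locales (use sub_perp_V sub_perp_W separate_V separate_W in auto)

lemma sub_perp: "W.sub (perp S)" unfolding perp_def by (rule sub_perp_V)

lemma perp_antimono: "S \<subseteq> T \<Longrightarrow> perp T \<subseteq> perp S" unfolding perp_def by blast

lemma perp'_perp: "V.sub S \<Longrightarrow> perp' (perp S) = S"
  using separate_V[of S] unfolding perp_def perp'_def by blast

lemma perp_perp': "W.sub T \<Longrightarrow> perp (perp' T) = T"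
  using separate_W[of T] unfolding perp_def perp'_def by blast

lemma perp_strict: "V.sub S \<Longrightarrow> V.sub T \<Longrightarrow> S \<subset> T \<Longrightarrow> W.dim (perp T) < W.dim (perp S)"
proof -
  assume s: "V.sub S" "V.sub T" "S \<subset> T"
  have "perp T \<noteq> perp S" using perp'_perp[OF s(1)] perp'_perp[OF s(2)] s(3) by force
  moreover have "perp T \<subseteq> perp S" using s(3) by (intro perp_antimono) auto
  ultimately show "W.dim (perp T) < W.dim (perp S)" by (intro W.dim_strict sub_perp) (rule psubsetI)
qed

text \<open>Taking complements reverses chains of subspaces strictly, and a chain in an \<open>n\<close>-dimensional space
  has at most \<open>n\<close> steps.\<close>

lemma dim_perp:
  assumes "V.sub S" shows "V.dim S + W.dim (perp S) = n"
proof (rule antisym)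
  have "V.dim S \<le> i \<Longrightarrow> V.sub S \<Longrightarrow> V.dim S + W.dim (perp S) \<le> n" for i S
  proof (induction i arbitrary: S)
    case 0
    then show ?case using W.dim_le_n[OF sub_perp, of S] by simp
  next
    case (Suc i)
    show ?case
    proof (cases "S = {0}")
      case True
      then show ?thesis using W.dim_le_n[OF sub_perp, of S] V.dim_zero by simp
    next
      case False
      then have "{0} \<subset> S" using V.sub_0[OF Suc.prems(2)] by auto
      then obtain H where H: "V.sub H" "{0} \<subseteq> H" "H \<subseteq> S" "V.dim S = Suc (V.dim H)"
        by (rule V.hyperplane[OF Suc.prems(2) V.sub_zero])
      have "V.dim H + W.dim (perp H) \<le> n" using Suc.IH[of H] Suc.prems H by simp
      moreover have "H \<subset> S" using H by auto
      then have "W.dim (perp S) < W.dim (perp H)" using perp_strict H(1) Suc.prems(2) by simp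
      ultimately show ?thesis using H(4) by simp
    qed
  qed
  then show "V.dim S + W.dim (perp S) \<le> n" using assms by blast
  have "n - V.dim S \<le> i \<Longrightarrow> V.sub S \<Longrightarrow> n \<le> V.dim S + W.dim (perp S)" for i S
  proof (induction i arbitrary: S)
    case 0
    then show ?case by simp
  next
    case (Suc i)
    show ?case
    proof (cases "V.dim S < n")
      case True
      obtain x where x: "x \<notin> S" using V.not_sub_exists[OF Suc.prems(2) True] .
      have dx: "V.dim (V.adjoin S x) = Suc (V.dim S)" "V.sub (V.adjoin S x)"
        using V.dim_adjoin[OF Suc.prems(2) x] V.sub_adjoin[OF Suc.prems(2)] by auto
      have "n \<le> V.dim (V.adjoin S x) + W.dim (perp (V.adjoin S x))" using Suc.IH[of "V.adjoin S x"] Suc.prems dx by simp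
      moreover have "S \<subset> V.adjoin S x" using V.adjoin_superset[of S x] V.adjoin_mem[OF Suc.prems(2), of x] x by blast
      then have "W.dim (perp (V.adjoin S x)) < W.dim (perp S)" using perp_strict dx(2) Suc.prems(2) by simp
      ultimately show ?thesis using dx(1) by simp
    qed simp
  qed
  then show "n \<le> V.dim S + W.dim (perp S)" using assms by blast
qed

lemma perp_G: "S \<in> V.G i \<Longrightarrow> i + j = n \<Longrightarrow> perp S \<in> W.G j"
  using dim_perp[of S] sub_perp[of S] by (simp add: V.G_iff W.G_iff)

lemma perp'_G: "T \<in> W.G j \<Longrightarrow> i + j = n \<Longrightarrow> perp' T \<in> V.G i"
proof -
  interpret r: dual_pairing scale' scale n "\<lambda>y x. orth x y" by (rule dual_pairing_swap)
  show "T \<in> W.G j \<Longrightarrow> i + j = n \<Longrightarrow> perp' T \<in> V.G i"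
    using r.perp_G[of T j i] unfolding r.perp_def perp'_def by (simp add: add.commute)
qed

lemma perp_bij:
  assumes "i + j = n" shows "bij_betw perp (V.G i) (W.G j)"
proof (rule bij_betw_byWitness[where f' = perp'])
  show "\<forall>S\<in>V.G i. perp' (perp S) = S" using perp'_perp by (simp add: V.G_iff)
  show "\<forall>T\<in>W.G j. perp (perp' T) = T" using perp_perp' by (simp add: W.G_iff)
  show "perp ` V.G i \<subseteq> W.G j" by (rule image_subsetI) (rule perp_G[OF _ assms])
  show "perp' ` W.G j \<subseteq> V.G i" by (rule image_subsetI) (rule perp'_G[OF _ assms])
qed

lemma perp_adj_imp:
  assumes ij: "Suc i + j = n" and P: "P \<in> V.G (Suc i)" "T \<in> V.G (Suc i)" and a: "V.adj P T"
  shows "W.adj (perp P) (perp T)"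
proof -
  have "P \<inter> T \<in> V.G i" using V.adj_meet_G[OF a P(1)] .
  then have M: "perp (P \<inter> T) \<in> W.G (Suc j)" using perp_G ij by simp
  have s: "V.sub P" "V.sub T" using V.adj_sub[OF a] by auto
  have "perp P \<noteq> perp T"
    using perp'_perp[OF s(1)] perp'_perp[OF s(2)] V.adj_neq[OF a] by metis
  then show ?thesis
    using W.common_upper(1)[OF perp_G[OF P(1) ij] perp_G[OF P(2) ij] _ M] perp_antimono by simp
qed

lemma perp_adj:
  assumes ij: "Suc i + Suc j = n" and P: "P \<in> V.G (Suc i)" "T \<in> V.G (Suc i)"
  shows "V.adj P T \<longleftrightarrow> W.adj (perp P) (perp T)"
proof
  assume "W.adj (perp P) (perp T)"
  interpret r: dual_pairing scale' scale n "\<lambda>y x. orth x y" by (rule dual_pairing_swap)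
  have "r.perp = perp'" by (simp add: fun_eq_iff r.perp_def perp'_def)
  then have "V.adj (perp' (perp P)) (perp' (perp T))"
    using r.perp_adj_imp[of j "Suc i" "perp P" "perp T"] perp_G[OF P(1) ij] perp_G[OF P(2) ij]
      ij \<open>W.adj (perp P) (perp T)\<close> by simp
  then show "V.adj P T" using perp'_perp P by (simp add: V.G_iff)
qed (rule perp_adj_imp[OF ij P])

lemma perp_tops:
  assumes ij: "i + j = n" and U: "V.sub U"
  shows "perp ` V.tops i U = W.star j (perp U)"
proof (intro equalityI subsetI)
  fix T assume "T \<in> perp ` V.tops i U"
  then obtain P where P: "P \<in> V.G i" "P \<subseteq> U" "T = perp P" by (auto simp: V.tops_def)
  then show "T \<in> W.star j (perp U)" using perp_G[OF P(1) ij] perp_antimono[OF P(2)] by (simp add: W.star_def)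
next
  fix T assume "T \<in> W.star j (perp U)"
  then have T: "T \<in> W.G j" "perp U \<subseteq> T" by (auto simp: W.star_def)
  have "perp' T \<subseteq> perp' (perp U)" using T(2) unfolding perp'_def by blast
  then have "perp' T \<in> V.tops i U" using perp'_G[OF T(1) ij] perp'_perp[OF U] by (simp add: V.tops_def)
  moreover have "T = perp (perp' T)" using perp_perp' T by (simp add: W.G_iff)
  ultimately show "T \<in> perp ` V.tops i U" by blast
qed

end

text \<open>The dual of a left vector space is a right vector space, that is, a left vector space over the
  opposite ring.\<close>

datatype 'a opposite = Opp (unopp: 'a)

lemma unopp_eq_0: "unopp a = 0 \<longleftrightarrow> a = Opp 0"
  by (cases a) simp

instantiation opposite :: (division_ring) division_ring
begin

definition "0 = Opp 0"
definition "1 = Opp 1"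
definition "x + y = Opp (unopp x + unopp y)"
definition "x - y = Opp (unopp x - unopp y)"
definition "- x = Opp (- unopp x)"
definition "x * y = Opp (unopp y * unopp x)"
definition "inverse x = Opp (inverse (unopp x))"
definition "x div y = Opp (inverse (unopp y) * unopp x)"

instance
  by standard
    (simp_all add: zero_opposite_def one_opposite_def plus_opposite_def minus_opposite_def
      uminus_opposite_def times_opposite_def inverse_opposite_def divide_opposite_def
      algebra_simps opposite.expand unopp_eq_0)

end

lemma unopp_simps [simp]:
  "unopp 0 = 0" "unopp 1 = 1" "unopp (x + y) = unopp x + unopp y" "unopp (x * y) = unopp y * unopp x"
  by (simp_all add: zero_opposite_def one_opposite_def plus_opposite_def times_opposite_def)

lemma unopp_eq_0_iff: "unopp x = 0 \<longleftrightarrow> x = 0"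
  by (simp add: zero_opposite_def unopp_eq_0)

lemma unopp_sum: "unopp (sum g t) = (\<Sum>i\<in>t. unopp (g i))"
  by (induction t rule: infinite_finite_induct) auto

context fin_space
begin

definition basis where "basis = (SOME B. indep B \<and> finite B \<and> span B = UNIV \<and> card B = n)"

lemma basis: "indep basis" "finite basis" "span basis = UNIV" "card basis = n"
  using someI_ex[OF basis_UNIV] unfolding basis_def by auto

text \<open>The basis dual to \<open>basis\<close>.\<close>

definition coord where
  "coord b = (SOME \<phi>. \<phi> \<in> dual_space scale \<and> (\<forall>v\<in>span (basis - {b}). \<phi> v = 0) \<and> \<phi> b = 1)"

lemma coord:
  assumes "b \<in> basis"
  shows "coord b (u + v) = coord b u + coord b v" "coord b (scale c v) = c * coord b v"
    "b' \<in> basis \<Longrightarrow> coord b b' = (if b' = b then 1 else 0)"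
proof -
  have "b \<notin> span (basis - {b})" using basis(1) assms indep_iff_span by blast
  then obtain \<phi> where "\<phi> \<in> dual_space scale" "\<forall>v\<in>span (basis - {b}). \<phi> v = 0" "\<phi> b = 1"
    by (rule separating_functional[OF sub_span])
  then have "\<exists>\<phi>. \<phi> \<in> dual_space scale \<and> (\<forall>v\<in>span (basis - {b}). \<phi> v = 0) \<and> \<phi> b = 1"
    by (intro exI[of _ \<phi>]) simp
  from someI_ex[OF this, folded coord_def]
  have c: "coord b \<in> dual_space scale" "\<forall>v\<in>span (basis - {b}). coord b v = 0" "coord b b = 1" by auto
  show "coord b (u + v) = coord b u + coord b v" "coord b (scale c v) = c * coord b v"
    using c(1) by (auto simp: dual_space_def)
  show "coord b b' = (if b' = b then 1 else 0)" if "b' \<in> basis"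
    using c(2,3) span_superset[of "basis - {b}"] that by auto
qed

lemma coord_0: "b \<in> basis \<Longrightarrow> coord b 0 = 0"
  using coord(2)[of b 0 0] by simp

lemma coord_sum: "b \<in> basis \<Longrightarrow> coord b (sum g t) = (\<Sum>i\<in>t. coord b (g i))"
  by (induction t rule: infinite_finite_induct) (auto simp: coord_0 coord(1))

lemma coord_lincomb: "b \<in> basis \<Longrightarrow> coord b (\<Sum>b'\<in>basis. scale (r b') b') = r b"
  using basis(2) by (simp add: coord_sum coord if_distrib[of "\<lambda>x. _ * x"] sum.delta' cong: if_cong sum.cong)

lemma lincomb_coord: "(\<Sum>b\<in>basis. scale (coord b x) b) = x"
proof -
  define r where "r v = (\<Sum>b\<in>basis. scale (coord b v) b)" for v
  have "sub {v. r v = v}" unfolding left_subspace_def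
  proof (intro conjI ballI allI)
    show "0 \<in> {v. r v = v}" by (simp add: r_def coord_0)
    show "x + y \<in> {v. r v = v}" if "x \<in> {v. r v = v}" "y \<in> {v. r v = v}" for x y
    proof -
      have "r (x + y) = r x + r y" by (simp add: r_def coord(1) scale_left_distrib sum.distrib)
      then show ?thesis using that by simp
    qed
    show "scale c x \<in> {v. r v = v}" if "x \<in> {v. r v = v}" for c x
    proof -
      have "r (scale c x) = scale c (r x)" by (simp add: r_def coord(2) scale_sum_right)
      then show ?thesis using that by simp
    qed
  qed
  moreover have "basis \<subseteq> {v. r v = v}"
  proof
    fix b assume b: "b \<in> basis"
    have "r b = (\<Sum>b'\<in>basis. if b = b' then b' else 0)"
      unfolding r_def using b by (intro sum.cong) (auto simp: coord)
    then show "b \<in> {v. r v = v}" using b basis(2) by simp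
  qed
  ultimately have "span basis \<subseteq> {v. r v = v}" by (intro span_least)
  then have "r x = x" using basis(3) by auto
  then show ?thesis unfolding r_def .
qed

lemma coord_eqI: "(\<And>b. b \<in> basis \<Longrightarrow> coord b x = coord b y) \<Longrightarrow> x = y"
  using lincomb_coord[of x] lincomb_coord[of y] by (metis (no_types, lifting) sum.cong)

text \<open>Multiplying coordinates from the right makes \<open>V\<close> a copy of its dual space, and a left space over
  the opposite ring.\<close>

definition rscale :: "'k opposite \<Rightarrow> 'v \<Rightarrow> 'v" where
  "rscale a x = (\<Sum>b\<in>basis. scale (coord b x * unopp a) b)"

lemma coord_rscale: "b \<in> basis \<Longrightarrow> coord b (rscale a x) = coord b x * unopp a"
  unfolding rscale_def by (rule coord_lincomb)

lemma rscale_basis: assumes "b \<in> basis" shows "rscale a b = scale (unopp a) b"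
proof (rule coord_eqI)
  fix b' assume "b' \<in> basis"
  then show "coord b' (rscale a b) = coord b' (scale (unopp a) b)"
    using assms by (simp add: coord_rscale coord)
qed

lemma left_vector_space_rscale: "left_vector_space rscale"
proof
  show "rscale a (x + y) = rscale a x + rscale a y" for a x y
    by (rule coord_eqI) (simp add: coord_rscale coord(1) distrib_right)
  show "rscale (a + b) x = rscale a x + rscale b x" for a b x
    by (rule coord_eqI) (simp add: coord_rscale coord(1) distrib_left)
  show "rscale a (rscale b x) = rscale (a * b) x" for a b x
    by (rule coord_eqI) (simp add: coord_rscale mult.assoc)
  show "rscale 1 x = x" for x
    by (rule coord_eqI) (simp add: coord_rscale)
qed

lemma rscale_lincomb: "(\<Sum>b\<in>basis. rscale (Opp (coord b x)) b) = x"
  using lincomb_coord[of x] by (simp add: rscale_basis cong: sum.cong)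

lemma fin_space_rscale: "fin_space rscale n"
proof -
  interpret r: left_vector_space rscale by (rule left_vector_space_rscale)
  have "r.indep basis" unfolding left_independent_def
  proof (intro allI impI ballI, elim conjE)
    fix t u v assume t: "finite t" "t \<subseteq> basis" "(\<Sum>v\<in>t. rscale (u v) v) = 0" "v \<in> t"
    have "(\<Sum>v\<in>t. rscale (u v) v) = (\<Sum>v\<in>t. scale (unopp (u v)) v)"
      using t(2) by (intro sum.cong) (auto simp: rscale_basis)
    then have "unopp (u v) = 0"
      using basis(1)[unfolded left_independent_def, rule_format, of t "\<lambda>v. unopp (u v)" v] t by simp
    then show "u v = 0" by (simp add: unopp_eq_0_iff)
  qed
  moreover have "x \<in> r.span basis" for x
    using r.span_memI[of basis basis "\<lambda>b. Opp (coord b x)"] basis(2) rscale_lincomb[of x] by simp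
  then have "r.span basis = UNIV" by blast
  ultimately have "r.dim UNIV = n" using r.dim_eq_card[of basis UNIV] basis by simp
  then show ?thesis using n_pos by unfold_locales
qed

definition pairing :: "'v \<Rightarrow> 'v \<Rightarrow> 'k" where
  "pairing x y = (\<Sum>b\<in>basis. coord b x * coord b y)"

lemma pairing_add_left: "pairing (x + x') y = pairing x y + pairing x' y"
  unfolding pairing_def by (simp add: coord(1) distrib_right sum.distrib)

lemma pairing_add_right: "pairing x (y + y') = pairing x y + pairing x y'"
  unfolding pairing_def by (simp add: coord(1) distrib_left sum.distrib)

lemma pairing_scale: "pairing (scale c x) y = c * pairing x y"
  unfolding pairing_def by (simp add: coord(2) sum_distrib_left mult.assoc)

lemma pairing_rscale: "pairing x (rscale c y) = pairing x y * unopp c"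
  unfolding pairing_def by (simp add: coord_rscale sum_distrib_right mult.assoc)

lemma pairing_basis: assumes "b \<in> basis" shows "pairing b y = coord b y"
proof -
  have "pairing b y = (\<Sum>b'\<in>basis. if b = b' then coord b' y else 0)"
    unfolding pairing_def using assms by (intro sum.cong) (auto simp: coord)
  then show ?thesis using assms basis(2) by simp
qed

lemma functional_pairing:
  assumes "\<phi> \<in> dual_space scale"
  obtains y where "\<forall>v. \<phi> v = pairing v y"
proof (rule that, rule allI)
  fix v
  have add: "\<And>u v. \<phi> (u + v) = \<phi> u + \<phi> v" and scale: "\<And>c v. \<phi> (scale c v) = c * \<phi> v"
    using assms by (auto simp: dual_space_def)
  have z: "\<phi> 0 = 0" using scale[of 0 0] by simp
  have s: "\<phi> (sum g t) = (\<Sum>i\<in>t. \<phi> (g i))" for g and t :: "'v set"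
    by (induction t rule: infinite_finite_induct) (auto simp: z add)
  have "\<phi> v = \<phi> (\<Sum>b\<in>basis. scale (coord b v) b)" by (simp add: lincomb_coord)
  also have "\<dots> = (\<Sum>b\<in>basis. coord b v * \<phi> b)" by (simp add: s scale)
  also have "\<dots> = pairing v (\<Sum>b\<in>basis. scale (\<phi> b) b)"
    unfolding pairing_def by (simp add: coord_lincomb cong: sum.cong)
  finally show "\<phi> v = pairing v (\<Sum>b\<in>basis. scale (\<phi> b) b)" .
qed

lemma functional_pairing_right:
  assumes "\<psi> \<in> dual_space rscale"
  obtains x where "\<forall>v. unopp (\<psi> v) = pairing x v"
proof (rule that, rule allI)
  fix v
  have add: "\<And>u v. \<psi> (u + v) = \<psi> u + \<psi> v" and scale: "\<And>c v. \<psi> (rscale c v) = c * \<psi> v"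
    using assms by (auto simp: dual_space_def)
  have z: "\<psi> 0 = 0" using add[of 0 0] by simp
  have s: "\<psi> (sum g t) = (\<Sum>i\<in>t. \<psi> (g i))" for g and t :: "'v set"
    by (induction t rule: infinite_finite_induct) (auto simp: z add)
  have "unopp (\<psi> v) = unopp (\<psi> (\<Sum>b\<in>basis. rscale (Opp (coord b v)) b))" by (simp add: rscale_lincomb)
  also have "\<dots> = (\<Sum>b\<in>basis. unopp (\<psi> b) * coord b v)" by (simp add: s scale unopp_sum)
  also have "\<dots> = pairing (\<Sum>b\<in>basis. scale (unopp (\<psi> b)) b) v"
    unfolding pairing_def by (simp add: coord_lincomb cong: sum.cong)
  finally show "unopp (\<psi> v) = pairing (\<Sum>b\<in>basis. scale (unopp (\<psi> b)) b) v" .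
qed

text \<open>Subspaces on either side are intersections of kernels, because every functional on \<open>V\<close>, and every
  functional on the copy of its dual, is a pairing with a fixed vector.\<close>

lemma dual_pairing_rscale: "dual_pairing scale rscale n (\<lambda>x y. pairing x y = 0)"
proof -
  interpret r: fin_space rscale n by (rule fin_space_rscale)
  have z: "pairing 0 y = 0" "pairing x 0 = 0" for x y
    using pairing_scale[of 0 0 y] pairing_add_right[of x 0 0] by auto
  show ?thesis
  proof unfold_locales
    show "r.sub {y. \<forall>x\<in>S. pairing x y = 0}" for S
      unfolding left_subspace_def by (auto simp: z pairing_add_right pairing_rscale)
    show "sub {x. \<forall>y\<in>T. pairing x y = 0}" for T
      unfolding left_subspace_def by (auto simp: z pairing_add_left pairing_scale)
    show "\<exists>y. (\<forall>s\<in>S. pairing s y = 0) \<and> pairing x y \<noteq> 0" if S: "sub S" "x \<notin> S" for S x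
    proof -
      obtain \<phi> where \<phi>: "\<phi> \<in> dual_space scale" "\<forall>v\<in>S. \<phi> v = 0" "\<phi> x = 1"
        by (rule separating_functional[OF S])
      obtain y where y: "\<forall>v. \<phi> v = pairing v y" by (rule functional_pairing[OF \<phi>(1)])
      have "(\<forall>s\<in>S. pairing s y = 0) \<and> pairing x y \<noteq> 0" using \<phi>(2,3) by (simp flip: y[rule_format])
      then show ?thesis ..
    qed
    show "\<exists>x. (\<forall>t\<in>T. pairing x t = 0) \<and> pairing x y \<noteq> 0" if T: "r.sub T" "y \<notin> T" for T y
    proof -
      obtain \<psi> where \<psi>: "\<psi> \<in> dual_space rscale" "\<forall>v\<in>T. \<psi> v = 0" "\<psi> y = 1"
        by (rule r.separating_functional[OF T])
      obtain x where x: "\<forall>v. unopp (\<psi> v) = pairing x v" by (rule functional_pairing_right[OF \<psi>(1)])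
      have "(\<forall>t\<in>T. pairing x t = 0) \<and> pairing x y \<noteq> 0" using \<psi>(2,3) by (simp flip: x[rule_format])
      then show ?thesis ..
    qed
  qed
qed

lemma semilinear_dual:
  assumes sl: "semilinear_between scale rscale \<sigma> l"
  shows "semilinear_isomorphism_dual scale (\<lambda>x v. pairing v (l x))"
proof -
  have l: "bij l" "\<And>x y. l (x + y) = l x + l y" "\<And>a x. l (scale a x) = rscale (\<sigma> a) (l x)"
    and s: "bij \<sigma>" "\<And>a b. \<sigma> (a + b) = \<sigma> a + \<sigma> b" "\<And>a b. \<sigma> (a * b) = \<sigma> a * \<sigma> b" "\<sigma> 1 = 1"
    using sl unfolding semilinear_between_def by auto
  let ?s = "\<lambda>x v. pairing v (l x)"
  have "bij_betw ?s UNIV (dual_space scale)" unfolding bij_betw_def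
  proof (intro conjI)
    show "inj ?s"
    proof (rule injI)
      fix x y assume "?s x = ?s y"
      then have "pairing v (l x) = pairing v (l y)" for v by (rule fun_cong)
      then have "l x = l y" by (intro coord_eqI) (simp flip: pairing_basis)
      then show "x = y" using l(1) by (simp add: bij_def inj_eq)
    qed
    show "range ?s = dual_space scale"
    proof (intro equalityI subsetI)
      fix \<phi> assume "\<phi> \<in> range ?s"
      then show "\<phi> \<in> dual_space scale" by (auto simp: dual_space_def pairing_add_left pairing_scale)
    next
      fix \<phi> assume "\<phi> \<in> dual_space scale"
      then obtain y where y: "\<forall>v. \<phi> v = pairing v y" by (rule functional_pairing)
      obtain x where "y = l x" using l(1) by (metis bij_pointE)
      then have "\<phi> = ?s x" using y by (simp add: fun_eq_iff)
      then show "\<phi> \<in> range ?s" by blast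
    qed
  qed
  moreover have "?s (x + y) = dual_add (?s x) (?s y)" for x y
    by (simp add: dual_add_def l(2) pairing_add_right)
  moreover have "ring_anti_automorphism (\<lambda>a. unopp (\<sigma> a))"
    unfolding ring_anti_automorphism_def
  proof (intro conjI allI)
    have "bij (unopp :: 'k opposite \<Rightarrow> 'k)"
      by (rule bij_betw_byWitness[where f' = Opp]) auto
    then show "bij (\<lambda>a. unopp (\<sigma> a))" using bij_comp[OF s(1)] by (simp add: comp_def)
  qed (simp_all add: s(2-4))
  moreover have "?s (scale a v) = dual_scale (?s v) (unopp (\<sigma> a))" for a v
    by (simp add: dual_scale_def l(3) pairing_rscale)
  ultimately show ?thesis unfolding semilinear_isomorphism_dual_def by blast
qed

text \<open>If stars become tops, composing with \<open>perp\<close> turns these tops into stars of the dual space. Undoing \<open>perp\<close>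
  afterwards shows that the original map is the annihilator of a semilinear image.\<close>

theorem chow:
  assumes h: "bij_betw h (G i) (G j)"
    and adj: "\<And>X Y. X \<in> G i \<Longrightarrow> Y \<in> G i \<Longrightarrow> adj X Y \<longleftrightarrow> adj (h X) (h Y)"
    and ij: "1 < i" "i < n - 1" "1 < j" "j < n - 1"
  shows "(i = j \<and> is_G_map scale i h) \<or> (i + j = n \<and> is_D_map scale i h)"
proof -
  interpret s: two_spaces scale scale n by unfold_locales
  obtain m where m: "i = Suc (Suc m)" using ij(1) by (cases i; cases "i - 1") auto
  obtain p where p: "j = Suc (Suc p)" using ij(3) by (cases j; cases "j - 1") auto
  have n4: "4 \<le> n" using ij by linarith
  have n: "Suc (Suc (Suc m)) < n" "Suc (Suc (Suc p)) < n" using ij m p by auto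
  have "(\<forall>S\<in>G (Suc m). \<exists>T\<in>G (Suc p). h ` star (Suc (Suc m)) S = star (Suc (Suc p)) T) \<or>
    (\<forall>S\<in>G (Suc m). \<exists>U\<in>G (Suc (Suc (Suc p))). h ` star (Suc (Suc m)) S = tops (Suc (Suc p)) U)"
    by (rule s.star_type_constant[OF h[unfolded m p] _ n]) (use adj m in auto)
  then show ?thesis
  proof
    assume st: "\<forall>S\<in>G (Suc m). \<exists>T\<in>G (Suc p). h ` star (Suc (Suc m)) S = star (Suc (Suc p)) T"
    have "m = p \<and> (\<exists>\<sigma> l. semilinear_between scale scale \<sigma> l \<and> (\<forall>X\<in>G (Suc (Suc m)). h X = l ` X))"
      by (rule s.chow_stars[OF n4 h[unfolded m p] _ n st]) (use adj m in auto)
    then obtain \<sigma> l where mp: "m = p" and sl: "semilinear_between scale scale \<sigma> l"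
      and hl: "\<forall>X\<in>G i. h X = l ` X" using m by auto
    have "semilinear_isomorphism scale l"
      using sl unfolding semilinear_between_def semilinear_isomorphism_def ring_automorphism_def by blast
    then have "is_G_map scale i h" using hl unfolding is_G_map_def by blast
    then show ?thesis using mp m p by simp
  next
    assume tp: "\<forall>S\<in>G (Suc m). \<exists>U\<in>G (Suc (Suc (Suc p))). h ` star (Suc (Suc m)) S = tops (Suc (Suc p)) U"
    interpret r: dual_pairing scale rscale n "\<lambda>x y. pairing x y = 0" by (rule dual_pairing_rscale)
    define q where "q = n - p - 4"
    have q: "Suc (Suc p) + Suc (Suc q) = n" "Suc (Suc (Suc p)) + Suc q = n" "Suc (Suc (Suc q)) < n"
      using n n4 by (auto simp: q_def)
    let ?g = "\<lambda>X. r.perp (h X)"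
    have hG: "h X \<in> G (Suc (Suc p))" if "X \<in> G i" for X using bij_betw_apply[OF h that] p by simp
    have g: "bij_betw ?g (G (Suc (Suc m))) (r.W.G (Suc (Suc q)))"
      using bij_betw_trans[OF h[unfolded m p] r.perp_bij[OF q(1)]] by (simp add: comp_def)
    have gadj: "adj X Y \<longleftrightarrow> r.W.adj (?g X) (?g Y)"
      if "X \<in> G (Suc (Suc m))" "Y \<in> G (Suc (Suc m))" for X Y
      using adj[of X Y] that m r.perp_adj[OF q(1) hG hG] by simp
    have gst: "\<forall>S\<in>G (Suc m). \<exists>T\<in>r.W.G (Suc q). ?g ` star (Suc (Suc m)) S = r.W.star (Suc (Suc q)) T"
    proof
      fix S assume "S \<in> G (Suc m)"
      then obtain U where U: "U \<in> G (Suc (Suc (Suc p)))" "h ` star (Suc (Suc m)) S = tops (Suc (Suc p)) U"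
        using tp by blast
      have "?g ` star (Suc (Suc m)) S = r.perp ` (h ` star (Suc (Suc m)) S)" by (simp add: image_image)
      also have "\<dots> = r.W.star (Suc (Suc q)) (r.perp U)"
        unfolding U(2) using U(1) by (intro r.perp_tops q) (simp add: G_iff)
      finally show "\<exists>T\<in>r.W.G (Suc q). ?g ` star (Suc (Suc m)) S = r.W.star (Suc (Suc q)) T"
        using r.perp_G[OF U(1) q(2)] by blast
    qed
    have "m = q \<and> (\<exists>\<sigma> l. semilinear_between scale rscale \<sigma> l \<and> (\<forall>X\<in>G (Suc (Suc m)). ?g X = l ` X))"
      by (rule r.chow_stars[OF n4 g _ n(1) q(3) gst]) (rule gadj)
    then obtain \<sigma> l where mq: "m = q" and sl: "semilinear_between scale rscale \<sigma> l"
      and gl: "\<And>X. X \<in> G i \<Longrightarrow> r.perp (h X) = l ` X" using m by auto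
    have "h X = dual_annihilator ((\<lambda>x v. pairing v (l x)) ` X)" if X: "X \<in> G i" for X
    proof -
      have "h X = r.perp' (r.perp (h X))" using r.perp'_perp hG[OF X] by (simp add: G_iff)
      also have "\<dots> = dual_annihilator ((\<lambda>x v. pairing v (l x)) ` X)"
        unfolding gl[OF X] r.perp'_def dual_annihilator_def by auto
      finally show ?thesis .
    qed
    then have "is_D_map scale i h" using semilinear_dual[OF sl] unfolding is_D_map_def by blast
    then show ?thesis using mq m p q by simp
  qed
qed

end

section \<open>Transformations of pairs of subspaces\<close>

lemma preserves_both_directions_iff:
  assumes "bij_betw f A B"
  shows "preserves_both_directions R A Q B f \<longleftrightarrow> (\<forall>x\<in>A. \<forall>y\<in>A. R x y \<longleftrightarrow> Q (f x) (f y))"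
proof -
  have inverse: "(\<forall>x\<in>B. \<forall>y\<in>B. Q x y \<longrightarrow> R (inv_into A f x) (inv_into A f y)) \<longleftrightarrow>
    (\<forall>x\<in>A. \<forall>y\<in>A. Q (f x) (f y) \<longrightarrow> R x y)"
    by (simp add: bij_betw_imp_surj_on[OF assms, symmetric] bij_betw_inv_into_left[OF assms])
  show ?thesis unfolding preserves_both_directions_def inverse by auto
qed

context fin_space
begin

lemma adjacency_bijection_iff:
  "adjacency_bijection scale i j h \<longleftrightarrow>
    bij_betw h (G i) (G j) \<and> (\<forall>X\<in>G i. \<forall>Y\<in>G i. adj X Y \<longleftrightarrow> adj (h X) (h Y))"
  by (cases "bij_betw h (G i) (G j)")
    (simp_all add: adjacency_bijection_def preserves_both_directions_iff)

lemma factor_graph_G: assumes "0 < i" "i < n" shows "factor_graph (G i) adj"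
proof
  show "adj x y \<Longrightarrow> adj y x" for x y by (rule adj_sym)
  show "\<not> adj x x" for x by (rule adj_irrefl)
  show "x \<in> G i \<Longrightarrow> y \<in> G i \<Longrightarrow> (\<lambda>x y. x \<in> G i \<and> y \<in> G i \<and> adj x y)\<^sup>*\<^sup>* x y" for x y
    by (rule grassmann_connected)
  show "\<exists>y\<in>G i. adj x y" if "x \<in> G i" for x
    by (rule G_other[OF that assms]) blast
  show "\<exists>u\<in>G i. \<exists>v\<in>G i. u \<noteq> v \<and> u \<noteq> z \<and> v \<noteq> z \<and> adj u x \<and> adj u y \<and> adj v x \<and> adj v y"
    if "x \<in> G i" "y \<in> G i" "z \<in> G i" "adj z x" "adj z y" "x \<noteq> y" "\<not> adj x y" for x y z
    using three_common_neighbours[OF that] by blast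
qed

lemma G_map_or_D_map:
  assumes "adjacency_bijection scale i j h" "1 < i" "i < n - 1" "1 < j" "j < n - 1"
  shows "(i = j \<and> is_G_map scale i h) \<or> (i + j = n \<and> is_D_map scale i h)"
  using assms chow[of h i j] unfolding adjacency_bijection_iff by blast

lemma complete_graph: "i = 1 \<or> i = n - 1 \<Longrightarrow> X \<in> G i \<Longrightarrow> Y \<in> G i \<Longrightarrow> adj X Y \<longleftrightarrow> X \<noteq> Y"
  using adj_G1 adj_Gn1 adj_irrefl by blast

lemma bijection_of_complete_graphs:
  assumes "i = 1 \<or> i = n - 1" "j = 1 \<or> j = n - 1" "bij_betw h (G i) (G j)"
  shows "adjacency_bijection scale i j h"
  unfolding adjacency_bijection_iff
proof (intro conjI ballI assms(3))
  fix X Y assume XY: "X \<in> G i" "Y \<in> G i"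
  have "h X \<in> G j" "h Y \<in> G j" using bij_betw_apply[OF assms(3)] XY by auto
  moreover have "h X = h Y \<longleftrightarrow> X = Y" using inj_on_eq_iff[OF bij_betw_imp_inj_on[OF assms(3)] XY] .
  ultimately show "adj X Y \<longleftrightarrow> adj (h X) (h Y)"
    using complete_graph[OF assms(1) XY] complete_graph[OF assms(2)] by simp
qed

end

theorem theorem4:
  fixes scale :: "'k::division_ring \<Rightarrow> 'v::ab_group_add \<Rightarrow> 'v"
    and n k :: nat
    and f :: "'v set \<times> 'v set \<Rightarrow> 'v set \<times> 'v set"
  assumes "left_vector_space scale"
    and "left_dim scale (UNIV :: 'v set) = n"
    and "2 \<le> n"
    and "k \<in> {1..n - 1}"
    and "adjacency_preserving_transformation scale k (n - k) f"
  shows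
    "((\<exists>f' f''.
        adjacency_bijection scale k k f' \<and>
        adjacency_bijection scale (n - k) (n - k) f'' \<and>
        (\<forall>p \<in> grassmannian scale k \<times> grassmannian scale (n - k). f p = map_prod f' f'' p) \<and>
        (1 < k \<and> k < n - 1 \<longrightarrow>
          (is_G_map scale k f' \<or> (n = 2 * k \<and> is_D_map scale k f')) \<and>
          (is_G_map scale (n - k) f'' \<or> (n = 2 * k \<and> is_D_map scale k f'')))) \<or>
      (\<exists>g' g''.
        adjacency_bijection scale k (n - k) g' \<and>
        adjacency_bijection scale (n - k) k g'' \<and>
        (\<forall>p \<in> grassmannian scale k \<times> grassmannian scale (n - k). f p = dot_times g' g'' p) \<and>
        (1 < k \<and> k < n - 1 \<longrightarrow>
          (is_D_map scale k g' \<or> (n = 2 * k \<and> is_G_map scale k g')) \<and>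
          (is_D_map scale (n - k) g'' \<or> (n = 2 * k \<and> is_G_map scale k g''))))) \<and>
     (k = 1 \<or> k = n - 1 \<longrightarrow>
       (\<forall>i \<in> {k, n - k}. \<forall>j \<in> {k, n - k}. \<forall>h.
         bij_betw h (grassmannian scale i) (grassmannian scale j) \<longrightarrow>
         adjacency_bijection scale i j h))"
proof -
  interpret left_vector_space scale by fact
  interpret fin_space scale n using assms(2,3) by unfold_locales auto
  have k: "0 < k" "k < n" "0 < n - k" "n - k < n" using assms(3,4) by auto
  let ?A = "G k" and ?B = "G (n - k)"
  have pa: "adjacent_pairs scale = product_adjacent adj adj"
    by (simp add: fun_eq_iff adjacent_pairs_def product_adjacent_def)
  have bij: "bij_betw f (?A \<times> ?B) (?A \<times> ?B)"
    and pres: "preserves_both_directions (adjacent_pairs scale) (?A \<times> ?B) (adjacent_pairs scale) (?A \<times> ?B) f"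
    using assms(5) unfolding adjacency_preserving_transformation_def Let_def by auto
  have edges: "product_adjacent adj adj p q \<longleftrightarrow> product_adjacent adj adj (f p) (f q)"
    if "p \<in> ?A \<times> ?B" "q \<in> ?A \<times> ?B" for p q
    using pres that unfolding preserves_both_directions_iff[OF bij] pa by blast
  interpret a: factor_graph ?A adj using k by (intro factor_graph_G)
  interpret b: factor_graph ?B adj using k by (intro factor_graph_G)
  have iso: "product_isomorphism ?A adj ?B adj ?A adj ?B adj f"
    by unfold_locales (use bij edges in auto)
  have "?A \<noteq> {}" "?B \<noteq> {}" using sub_G_exists[of k] sub_G_exists[of "n - k"] k by auto
  note cases = product_isomorphism_cases[OF iso this]
  have explicit: "(i = j \<and> is_G_map scale i h) \<or> (i + j = n \<and> is_D_map scale i h)"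
    if "adjacency_bijection scale i j h" "1 < k \<and> k < n - 1" "i \<in> {k, n - k}" "j \<in> {k, n - k}" for i j h
    using that by (intro G_map_or_D_map) auto
  have complete: "k = 1 \<or> k = n - 1 \<longrightarrow>
    (\<forall>i \<in> {k, n - k}. \<forall>j \<in> {k, n - k}. \<forall>h. bij_betw h (G i) (G j) \<longrightarrow> adjacency_bijection scale i j h)"
  proof (intro impI ballI allI)
    fix i j h assume "k = 1 \<or> k = n - 1" "i \<in> {k, n - k}" "j \<in> {k, n - k}" "bij_betw h (G i) (G j)"
    then show "adjacency_bijection scale i j h" using k by (intro bijection_of_complete_graphs) auto
  qed
  have half: "k + k = n \<longleftrightarrow> n = 2 * k" "n - k + (n - k) = n \<longleftrightarrow> n = 2 * k"
    "k = n - k \<longleftrightarrow> n = 2 * k" "n - k = k \<longleftrightarrow> n = 2 * k" using k by auto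
  from cases show ?thesis
  proof (elim disjE exE conjE)
    fix f' f'' assume *: "bij_betw f' ?A ?A" "bij_betw f'' ?B ?B"
      "\<forall>x\<in>?A. \<forall>y\<in>?A. adj x y \<longleftrightarrow> adj (f' x) (f' y)" "\<forall>x\<in>?B. \<forall>y\<in>?B. adj x y \<longleftrightarrow> adj (f'' x) (f'' y)"
      "\<forall>x\<in>?A. \<forall>y\<in>?B. f (x, y) = (f' x, f'' y)"
    have ab: "adjacency_bijection scale k k f'" "adjacency_bijection scale (n - k) (n - k) f''"
      unfolding adjacency_bijection_iff using * by blast+
    have "(is_G_map scale k f' \<or> (n = 2 * k \<and> is_D_map scale k f')) \<and>
        (is_G_map scale (n - k) f'' \<or> (n = 2 * k \<and> is_D_map scale k f''))" if kk: "1 < k \<and> k < n - 1"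
      using explicit[OF ab(1) kk] explicit[OF ab(2) kk] half k by auto
    then show ?thesis
      using ab * by (intro conjI complete disjI1 exI[of _ f'] exI[of _ f'']) auto
  next
    fix g' g'' assume *: "bij_betw g' ?A ?B" "bij_betw g'' ?B ?A"
      "\<forall>x\<in>?A. \<forall>y\<in>?A. adj x y \<longleftrightarrow> adj (g' x) (g' y)" "\<forall>x\<in>?B. \<forall>y\<in>?B. adj x y \<longleftrightarrow> adj (g'' x) (g'' y)"
      "\<forall>x\<in>?A. \<forall>y\<in>?B. f (x, y) = (g'' y, g' x)"
    have ab: "adjacency_bijection scale k (n - k) g'" "adjacency_bijection scale (n - k) k g''"
      unfolding adjacency_bijection_iff using * by blast+
    have "(is_D_map scale k g' \<or> (n = 2 * k \<and> is_G_map scale k g')) \<and>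
        (is_D_map scale (n - k) g'' \<or> (n = 2 * k \<and> is_G_map scale k g''))" if kk: "1 < k \<and> k < n - 1"
      using explicit[OF ab(1) kk] explicit[OF ab(2) kk] half k by auto
    then show ?thesis
      using ab * by (intro conjI complete disjI2 exI[of _ g'] exI[of _ g'']) (auto simp: dot_times_def)
  qed
qed

end
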